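(* The min-cost augmentation problem is NP-hard, even for strict preference lists of length at most 3. Further, the lists can be derived from a master list.
   Context: Popular matchings: a preference instance is a bipartite graph $G=(\mathcal{A}\cup\mathcal{B},E)$ with $\mathcal{A}$ a set of people and $\mathcal{B}$ a set of items; each person ranks the items adjacent to her in order of preference (ties allowed in general); each item $b$ has a number $\mathsf{copies}(b)$ of copies. A matching $M$ assigns each person at most one acceptable item such that each item $b$ is assigned to at most $\mathsf{copies}(b)$ people (people may be unmatched); $M(a)$ is the item assigned to $a$. A person $a$ prefers $M$ to $M'$ if $a$ is matched in $M$ and unmatched in $M'$, or matched in both and prefers $M(a)$ to $M'(a)$. $M$ is more popular than $M'$ if more people prefer $M$ to $M'$ than prefer $M'$ to $M$; $M$ is popular if no matching is more popular than $M$. Min-cost augmentation problem: the input is a preference instance $G=(\mathcal{A}\cup\mathcal{B},E)$ in which each item is available in one copy, together with a price $\mathsf{cost}(b)\ge 0$ for each item. Extra copies of any item $b$ can be added at price $\mathsf{cost}(b)$ per copy, without limit. The task is to choose numbers $k_b\ge 0$ of extra copies so that the resulting instance admits a popular matching, minimizing $\sum_b k_b\,\mathsf{cost}(b)$. Preference lists are derived from a master list if there is a total order on the items such that each person's list is strict and, whenever $b$ precedes $b'$ in the master list and both are on a person's list, $b$ precedes $b'$ on that list. *)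

theory Defs
  imports "HOL-Computational_Algebra.Polynomial"
begin

section \<open>Polynomial time, NP and NP-hardness\<close>

text \<open>
  Deterministic multi-tape Turing machines with two-way infinite tapes. States, tapes and tape
  symbols are numbered from 0. State 0 is the start state and state 1 the halting state;
  symbol 0 is the blank, symbols 1 and 2 stand for the bits 0 and 1. The input is on tape 0,
  the output on tape 1.
\<close>

datatype move = Move_Left | Move_Stay | Move_Right

record tm =
  tapes :: nat
  symbols :: nat
  states :: nat
  delta :: "nat \<Rightarrow> nat list \<Rightarrow> nat \<times> (nat \<times> move) list"

definition wf_tm :: "tm \<Rightarrow> bool" where
  "wf_tm M \<longleftrightarrow> 2 \<le> tapes M \<and> 3 \<le> symbols M \<and> 2 \<le> states M \<and>
     (\<forall>q<states M. \<forall>ss. length ss = tapes M \<and> set ss \<subseteq> {..<symbols M} \<longrightarrow>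
        (case delta M q ss of (q', as) \<Rightarrow>
           q' < states M \<and> length as = tapes M \<and> fst ` set as \<subseteq> {..<symbols M}))"

text \<open>A tape is a pair of a head position and a cell contents function.\<close>

type_synonym tape = "int \<times> (int \<Rightarrow> nat)"
type_synonym config = "nat \<times> tape list"

fun offset :: "move \<Rightarrow> int" where
  "offset Move_Left = - 1"
| "offset Move_Stay = 0"
| "offset Move_Right = 1"

fun act :: "nat \<times> move \<Rightarrow> tape \<Rightarrow> tape" where
  "act (s, d) (h, t) = (h + offset d, t(h := s))"

fun tm_step :: "tm \<Rightarrow> config \<Rightarrow> config" where
  "tm_step M (q, ts) =
     (if q = 1 then (q, ts)
      else (case delta M q (map (\<lambda>(h, t). t h) ts) of (q', as) \<Rightarrow> (q', map2 act as ts)))"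

definition word_cells :: "bool list \<Rightarrow> int \<Rightarrow> nat" where
  "word_cells x i =
     (if 0 \<le> i \<and> i < int (length x) then (if x ! nat i then 2 else 1) else 0)"

definition init_config :: "tm \<Rightarrow> bool list \<Rightarrow> config" where
  "init_config M x = (0, (0, word_cells x) # replicate (tapes M - 1) (0, \<lambda>_. 0))"

text \<open>The output word extends from cell 0 of tape 1 up to the first blank cell.\<close>

definition halts_with :: "config \<Rightarrow> bool list \<Rightarrow> bool" where
  "halts_with c y \<longleftrightarrow>
     fst c = 1 \<and> (\<forall>i\<in>{0..int (length y)}. snd (snd c ! 1) i = word_cells y i)"

definition poly_time :: "(bool list \<Rightarrow> bool list) \<Rightarrow> bool" where
  "poly_time f \<longleftrightarrow>
     (\<exists>M (p :: nat poly). wf_tm M \<and>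
        (\<forall>x. \<exists>n \<le> poly p (length x). halts_with ((tm_step M ^^ n) (init_config M x)) (f x)))"

type_synonym language = "bool list set"

definition class_P :: "language set" where
  "class_P = {L. poly_time (\<lambda>x. [x \<in> L])}"

text \<open>Pairing of words: the bits of the first word are doubled, and the block 01 separates.\<close>

definition pair_word :: "bool list \<Rightarrow> bool list \<Rightarrow> bool list" where
  "pair_word x u = concat (map (\<lambda>b. [b, b]) x) @ [False, True] @ u"

definition class_NP :: "language set" where
  "class_NP =
     {L. \<exists>R\<in>class_P. \<exists>p :: nat poly.
        \<forall>x. x \<in> L \<longleftrightarrow> (\<exists>u. length u \<le> poly p (length x) \<and> pair_word x u \<in> R)}"

definition NP_hard :: "language \<Rightarrow> bool" where
  "NP_hard Q \<longleftrightarrow>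
     (\<forall>L\<in>class_NP. \<exists>f. poly_time f \<and> (\<forall>x. x \<in> L \<longleftrightarrow> f x \<in> Q))"

text \<open>
  Hardness of a problem \<open>Q\<close> restricted to a class \<open>C\<close> of inputs: the reductions
  produce only inputs in \<open>C\<close>. This implies \<open>NP_hard Q\<close> as well as \<open>NP_hard (Q \<inter> C)\<close>.
\<close>

definition NP_hard_on :: "language \<Rightarrow> language \<Rightarrow> bool" where
  "NP_hard_on C Q \<longleftrightarrow>
     (\<forall>L\<in>class_NP. \<exists>f. poly_time f \<and> (\<forall>x. f x \<in> C \<and> (x \<in> L \<longleftrightarrow> f x \<in> Q)))"


section \<open>Preference instances and popular matchings\<close>

text \<open>
  A preference list is the list of its indifference classes, most preferred first; the order
  inside a class is irrelevant.
\<close>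

type_synonym pref_list = "nat list list"

definition listed :: "pref_list \<Rightarrow> nat set" where
  "listed l = set (concat l)"

definition wf_pref_list :: "pref_list \<Rightarrow> bool" where
  "wf_pref_list l \<longleftrightarrow> distinct (concat l) \<and> [] \<notin> set l"

definition ranks_before :: "pref_list \<Rightarrow> nat \<Rightarrow> nat \<Rightarrow> bool" where
  "ranks_before l b b' \<longleftrightarrow>
     (\<exists>i j. i < j \<and> j < length l \<and> b \<in> set (l ! i) \<and> b' \<in> set (l ! j))"

definition strict_pref_list :: "pref_list \<Rightarrow> bool" where
  "strict_pref_list l \<longleftrightarrow> (\<forall>c\<in>set l. length c = 1)"

text \<open>
  People and items are the positions in the lists \<open>prefs\<close> and \<open>costs\<close>; the edges of the bipartite
  graph join each person to the items on her list.
\<close>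

record aug_instance =
  prefs :: "pref_list list"
  costs :: "rat list"

definition people :: "aug_instance \<Rightarrow> nat set" where
  "people G = {..<length (prefs G)}"

definition items :: "aug_instance \<Rightarrow> nat set" where
  "items G = {..<length (costs G)}"

definition wf_aug_instance :: "aug_instance \<Rightarrow> bool" where
  "wf_aug_instance G \<longleftrightarrow>
     (\<forall>l\<in>set (prefs G). wf_pref_list l \<and> listed l \<subseteq> items G) \<and> (\<forall>r\<in>set (costs G). 0 \<le> r)"

definition matching :: "aug_instance \<Rightarrow> (nat \<Rightarrow> nat) \<Rightarrow> (nat \<Rightarrow> nat option) \<Rightarrow> bool" where
  "matching G copies M \<longleftrightarrow>
     dom M \<subseteq> people G \<and>
     (\<forall>a b. M a = Some b \<longrightarrow> b \<in> listed (prefs G ! a)) \<and>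
     (\<forall>b\<in>items G. card {a. M a = Some b} \<le> copies b)"

definition prefers ::
  "aug_instance \<Rightarrow> nat \<Rightarrow> (nat \<Rightarrow> nat option) \<Rightarrow> (nat \<Rightarrow> nat option) \<Rightarrow> bool" where
  "prefers G a M M' \<longleftrightarrow>
     (\<exists>b. M a = Some b \<and>
        (M' a = None \<or> (\<exists>b'. M' a = Some b' \<and> ranks_before (prefs G ! a) b b')))"

definition more_popular ::
  "aug_instance \<Rightarrow> (nat \<Rightarrow> nat option) \<Rightarrow> (nat \<Rightarrow> nat option) \<Rightarrow> bool" where
  "more_popular G M M' \<longleftrightarrow>
     card {a \<in> people G. prefers G a M M'} > card {a \<in> people G. prefers G a M' M}"

definition popular :: "aug_instance \<Rightarrow> (nat \<Rightarrow> nat) \<Rightarrow> (nat \<Rightarrow> nat option) \<Rightarrow> bool" where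
  "popular G copies M \<longleftrightarrow>
     matching G copies M \<and> \<not> (\<exists>M'. matching G copies M' \<and> more_popular G M' M)"

definition strict_prefs :: "aug_instance \<Rightarrow> bool" where
  "strict_prefs G \<longleftrightarrow> (\<forall>l\<in>set (prefs G). strict_pref_list l)"

definition max_list_length :: "nat \<Rightarrow> aug_instance \<Rightarrow> bool" where
  "max_list_length n G \<longleftrightarrow> (\<forall>l\<in>set (prefs G). length (concat l) \<le> n)"

definition from_master_list :: "aug_instance \<Rightarrow> bool" where
  "from_master_list G \<longleftrightarrow>
     (\<exists>r. linear_order_on (items G) r \<and>
        (\<forall>l\<in>set (prefs G). strict_pref_list l \<and>
           (\<forall>b\<in>listed l. \<forall>b'\<in>listed l. b \<noteq> b' \<and> (b, b') \<in> r \<longrightarrow> ranks_before l b b')))"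


section \<open>The min-cost augmentation problem\<close>

text \<open>\<open>k b\<close> is the number of extra copies of item \<open>b\<close>, in addition to the one copy present.\<close>

definition feasible_augmentation :: "aug_instance \<Rightarrow> (nat \<Rightarrow> nat) \<Rightarrow> bool" where
  "feasible_augmentation G k \<longleftrightarrow> (\<exists>M. popular G (\<lambda>b. 1 + k b) M)"

definition augmentation_cost :: "aug_instance \<Rightarrow> (nat \<Rightarrow> nat) \<Rightarrow> rat" where
  "augmentation_cost G k = (\<Sum>b\<in>items G. of_nat (k b) * costs G ! b)"

text \<open>
  Encoding of instances as words. Numbers are written in binary, least significant bit first.
  List elements are each preceded by \<open>True\<close>, and \<open>False\<close> ends the list, which makes the
  code prefix-free.
\<close>

fun bits :: "nat \<Rightarrow> bool list" where
  "bits n = (if n = 0 then [] else odd n # bits (n div 2))"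

declare bits.simps [simp del]

definition enc_list :: "('a \<Rightarrow> bool list) \<Rightarrow> 'a list \<Rightarrow> bool list" where
  "enc_list e xs = concat (map (\<lambda>x. True # e x) xs) @ [False]"

definition enc_nat :: "nat \<Rightarrow> bool list" where
  "enc_nat n = enc_list (\<lambda>b. [b]) (bits n)"

text \<open>Only nonnegative rationals are encoded; \<open>quotient_of\<close> is the reduced fraction.\<close>

definition enc_rat :: "rat \<Rightarrow> bool list" where
  "enc_rat r = (case quotient_of r of (m, n) \<Rightarrow> enc_nat (nat m) @ enc_nat (nat n))"

definition enc_input :: "aug_instance \<Rightarrow> rat \<Rightarrow> bool list" where
  "enc_input G K =
     enc_list (enc_list (enc_list enc_nat)) (prefs G) @ enc_list enc_rat (costs G) @ enc_rat K"

lemma enc_list_inject: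
  assumes "\<And>x y u v. \<lbrakk>x \<in> S; y \<in> S; e x @ u = e y @ v\<rbrakk> \<Longrightarrow> x = y \<and> u = v"
    and "set xs \<subseteq> S" "set ys \<subseteq> S" "enc_list e xs @ u = enc_list e ys @ v"
  shows "xs = ys \<and> u = v"
  using assms(2-4)
proof (induction xs arbitrary: ys)
  case Nil
  then show ?case by (cases ys) (auto simp: enc_list_def)
next
  case (Cons x xs)
  then obtain y ys' where ys: "ys = y # ys'"
    by (cases ys) (auto simp: enc_list_def)
  have "e x @ (enc_list e xs @ u) = e y @ (enc_list e ys' @ v)"
    using Cons.prems ys by (simp add: enc_list_def)
  then have "x = y \<and> enc_list e xs @ u = enc_list e ys' @ v"
    using assms(1) Cons.prems ys by (metis insert_subset list.simps(15))
  then show ?case using Cons.IH[of ys'] Cons.prems ys by simp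
qed

lemma bits_inject: "bits m = bits n \<Longrightarrow> m = n"
proof (induction m arbitrary: n rule: less_induct)
  case (less m)
  show ?case
  proof (cases "m = 0 \<or> n = 0")
    case True
    with less.prems bits.simps[of m] bits.simps[of n] show ?thesis by (metis list.distinct(1))
  next
    case False
    then have "odd m = odd n" "bits (m div 2) = bits (n div 2)"
      using less.prems bits.simps[of m] bits.simps[of n] by (metis list.inject)+
    moreover have "m div 2 = n div 2"
      using less.IH[of "m div 2" "n div 2"] False calculation(2) by simp
    ultimately show ?thesis
      by (metis odd_two_times_div_two_succ even_two_times_div_two)
  qed
qed

lemma enc_nat_inject: "enc_nat m @ u = enc_nat n @ v \<Longrightarrow> m = n \<and> u = v"
  using enc_list_inject[of UNIV "\<lambda>b. [b]" "bits m" "bits n" u v] bits_inject[of m n]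
  by (simp add: enc_nat_def)

lemma enc_rat_inject:
  assumes "0 \<le> r" "0 \<le> s" "enc_rat r @ u = enc_rat s @ v"
  shows "r = s \<and> u = v"
proof -
  obtain a b c d where q: "quotient_of r = (a, b)" "quotient_of s = (c, d)"
    by (metis surj_pair)
  have pos: "b > 0" "d > 0"
    using q quotient_of_denom_pos by auto
  have "r = of_int a / of_int b" "s = of_int c / of_int d"
    using q quotient_of_div by auto
  then have "a \<ge> 0" "c \<ge> 0"
    using assms(1,2) pos by (auto simp: zero_le_divide_iff)
  have "enc_nat (nat a) @ (enc_nat (nat b) @ u) = enc_nat (nat c) @ (enc_nat (nat d) @ v)"
    using assms(3) q by (simp add: enc_rat_def)
  then have "nat a = nat c \<and> nat b = nat d \<and> u = v"
    using enc_nat_inject by blast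
  then have "a = c \<and> b = d \<and> u = v"
    using \<open>a \<ge> 0\<close> \<open>c \<ge> 0\<close> pos by linarith
  then show ?thesis
    using q by (metis quotient_of_div)
qed

lemma enc_input_inject:
  assumes "wf_aug_instance G" "0 \<le> K" "wf_aug_instance G'" "0 \<le> K'"
    and "enc_input G K = enc_input G' K'"
  shows "G = G' \<and> K = K'"
proof -
  have 1: "l = l' \<and> u = v" if "enc_list enc_nat l @ u = enc_list enc_nat l' @ v" for l l' u v
    using enc_list_inject[of UNIV enc_nat] enc_nat_inject that by blast
  have 2: "l = l' \<and> u = v"
    if "enc_list (enc_list enc_nat) l @ u = enc_list (enc_list enc_nat) l' @ v" for l l' u v
    using enc_list_inject[of UNIV "enc_list enc_nat"] 1 that by blast
  have 3: "l = l' \<and> u = v"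
    if "enc_list (enc_list (enc_list enc_nat)) l @ u = enc_list (enc_list (enc_list enc_nat)) l' @ v"
    for l l' u v
    using enc_list_inject[of UNIV "enc_list (enc_list enc_nat)"] 2 that by blast
  have p: "prefs G = prefs G' \<and>
      enc_list enc_rat (costs G) @ enc_rat K = enc_list enc_rat (costs G') @ enc_rat K'"
    by (rule 3) (use assms(5) in \<open>simp add: enc_input_def\<close>)
  have "costs G = costs G' \<and> enc_rat K = enc_rat K'"
  proof (rule enc_list_inject[where S = "{0..}" and e = enc_rat])
    show "set (costs G) \<subseteq> {0..}" "set (costs G') \<subseteq> {0..}"
      using assms(1,3) by (auto simp: wf_aug_instance_def)
    show "enc_list enc_rat (costs G) @ enc_rat K = enc_list enc_rat (costs G') @ enc_rat K'"
      using p by (rule conjunct2)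
    show "r = s \<and> u = v" if "r \<in> {0..}" "s \<in> {0..}" "enc_rat r @ u = enc_rat s @ v" for r s u v
      using that by (intro enc_rat_inject) simp_all
  qed
  moreover from this have "K = K'"
    using enc_rat_inject[OF assms(2,4), of "[]" "[]"] by simp
  ultimately show ?thesis
    using p by simp
qed

definition inputs_satisfying :: "(aug_instance \<Rightarrow> bool) \<Rightarrow> language" where
  "inputs_satisfying P = {enc_input G K | G K. wf_aug_instance G \<and> 0 \<le> K \<and> P G}"

text \<open>The decision version: is there a feasible augmentation within a given budget?\<close>

definition MIN_COST_AUGMENTATION :: language where
  "MIN_COST_AUGMENTATION =
     {enc_input G K | G K. wf_aug_instance G \<and> 0 \<le> K \<and>
        (\<exists>k. feasible_augmentation G k \<and> augmentation_cost G k \<le> K)}"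

end

theory Submission
  imports Defs
begin

text \<open>
  A constraint "\<open>x\<close>, \<open>y\<close>, \<open>w\<close> are not all equal" becomes three people with the lists \<open>f, x, z\<close>;
  \<open>f, y, z\<close>; \<open>f, w, z\<close>, where \<open>f\<close> and \<open>z\<close> occur nowhere else, and every variable \<open>x\<close> also has an
  owner whose list is \<open>x\<close> alone. In a popular matching the owners get their items and all people
  are matched; since \<open>f\<close> and \<open>z\<close> serve one person each, some constraint person uses an extra copy of
  a variable item. An item with an extra copy is true. The person who gets \<open>z\<close> has a false variable,
  as otherwise she could claim a copy of it and its former holder could move up to the top of her
  list. With cost 1 for variable items, cost 2 for the items \<open>f\<close> and \<open>z\<close> and one unit of
  budget per constraint, every constraint has to use exactly one extra copy, so it contains a true
  and a false variable. Ordering the items as first choices, variables, last choices is a master list.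

  Every language in NP reduces to not-all-equal satisfiability. The tableau of a computation is
  described by Horn clauses that derive the facts true in each row from those of the preceding row,
  apart from a positive clause for every cell of the guessed certificate. All clauses are local, so
  that a program with finitely many counters can write the instance, and a counter is the head
  position on a tape.
\<close>

section \<open>Not-all-equal constraints as augmentation instances\<close>

text \<open>A copy of \<open>f\<close> or \<open>z\<close> would seat a clause person just as well
  as a copy of a variable item. The price 2 excludes it: seating three persons on two single items
  takes one extra copy per constraint, so a budget of one unit per constraint leaves no slack
  anywhere. Not-all-equal constraints are preserved by complementing all values, so the constant
  False is only an item with which the others are compared. On the machine side the Horn clauses do
  not have to forbid false facts: whatever else a satisfying assignment makes true, the facts of
  some run are forced, and the only demand in the other direction is one negative clause saying that
  this run does not reject. A 3-clause has room for two premises, which is why the scanned symbols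
  are collected tape by tape. Counters are unary and reading empties them; hence all varying numbers
  are affine in one counter, with gadgets numbered modulo 12, and lists written by countdowns are
  reversed.\<close>

lemma ranks_before_single: "ranks_before [[x]] b b' \<longleftrightarrow> False"
  by (auto simp: ranks_before_def less_Suc_eq)

lemma ranks_before_triple:
  "ranks_before [[f], [x], [z]] b b' \<longleftrightarrow> b = f \<and> b' = x \<or> b = f \<and> b' = z \<or> b = x \<and> b' = z"
  unfolding ranks_before_def
proof
  assume "\<exists>i j. i < j \<and> j < length [[f], [x], [z]] \<and>
    b \<in> set ([[f], [x], [z]] ! i) \<and> b' \<in> set ([[f], [x], [z]] ! j)"
  then obtain i j where ij: "i < j" "j < 3" "b \<in> set ([[f], [x], [z]] ! i)" "b' \<in> set ([[f], [x], [z]] ! j)"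
    by auto
  then have "i = 0 \<and> j = 1 \<or> i = 0 \<and> j = 2 \<or> i = 1 \<and> j = 2" by linarith
  with ij show "b = f \<and> b' = x \<or> b = f \<and> b' = z \<or> b = x \<and> b' = z"
    by (auto simp: numeral_2_eq_2)
next
  assume "b = f \<and> b' = x \<or> b = f \<and> b' = z \<or> b = x \<and> b' = z"
  then consider "b = f" "b' = x" | "b = f" "b' = z" | "b = x" "b' = z" by blast
  then show "\<exists>i j. i < j \<and> j < length [[f], [x], [z]] \<and>
    b \<in> set ([[f], [x], [z]] ! i) \<and> b' \<in> set ([[f], [x], [z]] ! j)"
  proof cases
    case 1 then show ?thesis by (intro exI[of _ 0] exI[of _ 1]) simp
  next
    case 2 then show ?thesis by (intro exI[of _ 0] exI[of _ 2]) simp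
  next
    case 3 then show ?thesis by (intro exI[of _ 1] exI[of _ 2]) simp
  qed
qed

section \<open>Popularity: exchanges that a popular matching excludes\<close>

lemma finite_people: "finite (people G)"
  by (simp add: people_def)

lemma matching_capacity:
  assumes "matching G cp M" "b \<in> items G"
  shows "finite {a. M a = Some b}" "card {a. M a = Some b} \<le> cp b"
proof -
  have "{a. M a = Some b} \<subseteq> people G"
    using assms(1) by (auto simp: matching_def)
  then show "finite {a. M a = Some b}"
    using finite_people by (rule finite_subset)
  show "card {a. M a = Some b} \<le> cp b"
    using assms by (simp add: matching_def)
qed

lemma matching_capacity_one:
  assumes "matching G cp M" "b \<in> items G" "cp b = 1" "M a = Some b" "M a' = Some b"
  shows "a = a'"
proof -
  have "card {a. M a = Some b} \<le> Suc 0"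
    using matching_capacity(2)[OF assms(1,2)] assms(3) by simp
  then show ?thesis
    using assms(4,5) matching_capacity(1)[OF assms(1,2)] card_le_Suc0_iff_eq[of "{a. M a = Some b}"] by auto
qed

text \<open>An item occurs in only one class, so being ranked both before and after another item
  would give a cyclic order of positions.\<close>

lemma ranks_before_asym:
  assumes "wf_pref_list l" "ranks_before l b b'"
  shows "\<not> ranks_before l b' b"
proof
  have d: "distinct (concat l)" and ne: "[] \<notin> set l"
    using assms(1) by (auto simp: wf_pref_list_def)
  have eq: "i = j" if "i < length l" "j < length l" "b \<in> set (l ! i)" "b \<in> set (l ! j)" for i j b
  proof (rule ccontr)
    assume "i \<noteq> j"
    \<comment> \<open>\<open>distinct_concat_iff\<close> speaks of the list without its empty
      classes; a well-formed list has none.\<close>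
    moreover have "distinct (removeAll [] l)" "\<And>ys zs. ys \<in> set l \<Longrightarrow> zs \<in> set l \<Longrightarrow> ys \<noteq> zs \<Longrightarrow> set ys \<inter> set zs = {}"
      using d by (auto simp: distinct_concat_iff)
    moreover have "removeAll [] l = l"
      using ne by simp
    ultimately show False
      using that by (metis disjoint_iff nth_eq_iff_index_eq nth_mem)
  qed
  assume "ranks_before l b' b"
  with assms(2) obtain i j i' j' where
    "i < j" "j < length l" "b \<in> set (l ! i)" "b' \<in> set (l ! j)"
    "i' < j'" "j' < length l" "b' \<in> set (l ! i')" "b \<in> set (l ! j')"
    unfolding ranks_before_def by blast
  then show False
    using eq[of i j' b] eq[of j i' b'] by linarith
qed

text \<open>Capacities are ignored, so the item may be fully taken. For an unmatched person every
  listed item is an improvement.\<close>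

definition improves :: "aug_instance \<Rightarrow> (nat \<Rightarrow> nat option) \<Rightarrow> nat \<Rightarrow> nat \<Rightarrow> bool" where
  "improves G M a b \<longleftrightarrow> a \<in> people G \<and> b \<in> listed (prefs G ! a) \<and>
     (\<forall>b'. M a = Some b' \<longrightarrow> ranks_before (prefs G ! a) b b')"

lemma improves_prefers:
  assumes "wf_aug_instance G" "improves G M a b" "M' a = Some b"
  shows "prefers G a M' M" "\<not> prefers G a M M'"
proof -
  have wf: "wf_pref_list (prefs G ! a)"
    using assms(1,2) by (auto simp: wf_aug_instance_def improves_def people_def)
  show "prefers G a M' M"
    using assms(2,3) unfolding prefers_def improves_def by (cases "M a") auto
  show "\<not> prefers G a M M'"
    using assms(2,3) ranks_before_asym[OF wf] unfolding prefers_def improves_def by auto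
qed

lemma prefers_irrefl:
  assumes "wf_aug_instance G" "a \<in> people G" "M' a = M a"
  shows "\<not> prefers G a M M'"
proof -
  have wf: "wf_pref_list (prefs G ! a)"
    using assms(1,2) by (auto simp: wf_aug_instance_def people_def)
  show ?thesis
    using assms(3) ranks_before_asym[OF wf] unfolding prefers_def by auto
qed

text \<open>A free copy of \<open>b\<close> could be given to \<open>a\<close> without disturbing
  anyone else, and \<open>a\<close> alone would notice the difference.\<close>

lemma popular_improves_full:
  assumes wf: "wf_aug_instance G" and pop: "popular G cp M" and imp: "improves G M a b"
  shows "cp b \<le> card {a. M a = Some b}"
proof (rule ccontr)
  assume not_full: "\<not> cp b \<le> card {a. M a = Some b}"
  have m: "matching G cp M"
    using pop by (simp add: popular_def)
  have fin: "finite {a. M a = Some b'}" if "b' \<in> items G" for b'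
    using matching_capacity(1)[OF m that] .
  have bi: "b \<in> items G"
    using wf imp by (auto simp: wf_aug_instance_def improves_def people_def)
  let ?M = "M(a \<mapsto> b)"
  have "matching G cp ?M"
    unfolding matching_def
  proof (intro conjI allI ballI impI)
    show "dom ?M \<subseteq> people G"
      using m imp by (auto simp: matching_def improves_def)
  next
    fix a' b' assume "?M a' = Some b'"
    then show "b' \<in> listed (prefs G ! a')"
      using m imp by (auto simp: matching_def improves_def split: if_splits)
  next
    fix b' assume b': "b' \<in> items G"
    show "card {a'. ?M a' = Some b'} \<le> cp b'"
    proof (cases "b' = b")
      case True
      have "{a'. ?M a' = Some b} \<subseteq> insert a {a. M a = Some b}" by auto
      then have "card {a'. ?M a' = Some b} \<le> card (insert a {a. M a = Some b})"
        using fin[OF bi] by (intro card_mono) auto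
      also have "\<dots> \<le> Suc (card {a. M a = Some b})"
        by (rule card_insert_le_m1) auto
      finally show ?thesis
        using not_full True by simp
    next
      case False
      then have "{a'. ?M a' = Some b'} \<subseteq> {a. M a = Some b'}" by auto
      then have "card {a'. ?M a' = Some b'} \<le> card {a. M a = Some b'}"
        using fin[OF b'] by (intro card_mono) auto
      then show ?thesis
        using matching_capacity(2)[OF m b'] by simp
    qed
  qed
  moreover have "more_popular G ?M M"
  proof -
    have "{a' \<in> people G. prefers G a' M ?M} = {}"
    proof (intro equals0I)
      fix v assume "v \<in> {a' \<in> people G. prefers G a' M ?M}"
      then show False
        using improves_prefers(2)[OF wf imp, of ?M] prefers_irrefl[OF wf, of v ?M M] by (cases "v = a") auto
    qed
    moreover have "a \<in> {a' \<in> people G. prefers G a' ?M M}"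
      using improves_prefers(1)[OF wf imp, of ?M] imp by (auto simp: improves_def)
    ultimately show ?thesis
      unfolding more_popular_def using finite_people[of G]
      by (metis (no_types, lifting) card.empty card_gt_0_iff empty_iff finite_subset mem_Collect_eq subsetI)
  qed
  ultimately show False
    using pop by (auto simp: popular_def)
qed

text \<open>Two people move up at the expense of at most one.\<close>

lemma popular_no_promotion_chain:
  assumes wf: "wf_aug_instance G" and pop: "popular G cp M"
    and imp1: "improves G M a b" and imp2: "improves G M a' g"
    and a': "M a' = Some b" and ne: "a \<noteq> a'" "M a \<noteq> Some g" "b \<noteq> g" and pos: "0 < cp g"
  shows False
proof -
  have m: "matching G cp M"
    using pop by (simp add: popular_def)
  have fin: "finite {a. M a = Some b'}" if "b' \<in> items G" for b'
    using matching_capacity(1)[OF m that] .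
  have bi: "b \<in> items G" and gi: "g \<in> items G"
    using wf imp1 imp2 by (auto simp: wf_aug_instance_def improves_def people_def)
  \<comment> \<open>\<open>D\<close> consists of the persons who lose their copy of
    \<open>g\<close>: nobody if a copy is free, otherwise one arbitrary holder.\<close>
  obtain D where D: "\<And>v. v \<in> D \<Longrightarrow> M v = Some g" "card D \<le> 1" "finite D"
    and Dfull: "card ({v. M v = Some g} - D) < cp g"
  proof (cases "card {v. M v = Some g} < cp g")
    case True
    then show ?thesis by (intro that[of "{}"]) auto
  next
    case False
    then have "{v. M v = Some g} \<noteq> {}" using pos by (intro notI) simp
    then obtain v where v: "M v = Some g" by auto
    have "card ({v. M v = Some g} - {v}) < card {v. M v = Some g}"
      using v fin[OF gi] by (intro card_Diff1_less) auto
    then have "card ({v. M v = Some g} - {v}) < cp g"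
      using matching_capacity(2)[OF m gi] by simp
    then show ?thesis using v by (intro that[of "{v}"]) auto
  qed
  have aD: "a \<notin> D" "a' \<notin> D"
    using D(1) ne a' by auto
  \<comment> \<open>The copy of \<open>b\<close> passes from \<open>a'\<close> to \<open>a\<close>,
    and \<open>a'\<close> moves on to \<open>g\<close>.\<close>
  define M' where "M' = (\<lambda>v. if v = a then Some b else if v = a' then Some g else if v \<in> D then None else M v)"
  have "matching G cp M'"
    unfolding matching_def
  proof (intro conjI allI ballI impI)
    show "dom M' \<subseteq> people G"
      using m imp1 imp2 by (auto simp: matching_def improves_def M'_def dom_def split: if_splits)
  next
    fix v b' assume "M' v = Some b'"
    then show "b' \<in> listed (prefs G ! v)"
      using m imp1 imp2 by (auto simp: matching_def improves_def M'_def split: if_splits)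
  next
    fix b' assume b': "b' \<in> items G"
    consider "b' = b" | "b' = g" | "b' \<noteq> b" "b' \<noteq> g" by blast
    then show "card {v. M' v = Some b'} \<le> cp b'"
    proof cases
      case 1
      have "{v. M' v = Some b} \<subseteq> insert a ({v. M v = Some b} - {a'})"
        using ne by (auto simp: M'_def split: if_splits)
      then have "card {v. M' v = Some b} \<le> card (insert a ({v. M v = Some b} - {a'}))"
        using fin[OF bi] by (intro card_mono) auto
      also have "\<dots> \<le> Suc (card ({v. M v = Some b} - {a'}))"
        by (rule card_insert_le_m1) auto
      also have "\<dots> = card {v. M v = Some b}"
        using a' fin[OF bi] by (subst card_Suc_Diff1) auto
      finally show ?thesis
        using matching_capacity(2)[OF m bi] 1 by simp
    next
      case 2
      have "{v. M' v = Some g} \<subseteq> insert a' ({v. M v = Some g} - D)"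
        using ne by (auto simp: M'_def split: if_splits)
      then have "card {v. M' v = Some g} \<le> card (insert a' ({v. M v = Some g} - D))"
        using fin[OF gi] by (intro card_mono) auto
      also have "\<dots> \<le> Suc (card ({v. M v = Some g} - D))"
        by (rule card_insert_le_m1) auto
      finally show ?thesis
        using Dfull 2 by simp
    next
      case 3
      then have "{v. M' v = Some b'} \<subseteq> {v. M v = Some b'}"
        by (auto simp: M'_def split: if_splits)
      then have "card {v. M' v = Some b'} \<le> card {v. M v = Some b'}"
        using fin[OF b'] by (intro card_mono) auto
      then show ?thesis
        using matching_capacity(2)[OF m b'] by simp
    qed
  qed
  moreover have "more_popular G M' M"
  proof -
    have M'a: "M' a = Some b" and M'a': "M' a' = Some g"
      using ne by (auto simp: M'_def)
    have "{v \<in> people G. prefers G v M M'} \<subseteq> D"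
    proof (intro subsetI, rule ccontr)
      fix v assume v: "v \<in> {v \<in> people G. prefers G v M M'}" "v \<notin> D"
      then show False
        using improves_prefers(2)[OF wf imp1, of M', OF M'a] improves_prefers(2)[OF wf imp2, of M', OF M'a']
          prefers_irrefl[OF wf, of v M' M] by (cases "v = a \<or> v = a'") (auto simp: M'_def)
    qed
    then have "card {v \<in> people G. prefers G v M M'} \<le> 1"
      using D(2,3) card_mono le_trans by meson
    moreover have "{a, a'} \<subseteq> {v \<in> people G. prefers G v M' M}"
      using improves_prefers(1)[OF wf imp1, of M', OF M'a] improves_prefers(1)[OF wf imp2, of M', OF M'a'] imp1 imp2
      by (auto simp: improves_def)
    then have "card {a, a'} \<le> card {v \<in> people G. prefers G v M' M}"
      using finite_people[of G] by (intro card_mono) auto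
    then have "2 \<le> card {v \<in> people G. prefers G v M' M}"
      using ne by simp
    ultimately show ?thesis
      unfolding more_popular_def by linarith
  qed
  ultimately show False
    using pop by (auto simp: popular_def)
qed


text \<open>Persons \<open>3 * c\<close>, \<open>3 * c + 1\<close>, \<open>3 * c + 2\<close> belong
  to constraint \<open>c\<close>, so \<open>a div 3\<close> is the constraint of person
  \<open>a\<close> and \<open>X a\<close> the variable item on her list; the owner of
  \<open>xs ! j\<close> is person \<open>3 * m + j\<close>. Item numbers are left abstract: the
  popularity argument uses only that first choices, last choices and variable items are disjoint and
  that no two constraints share a first or a last choice.\<close>

locale nae_instance =
  fixes G :: aug_instance and m :: nat and F Z X :: "nat \<Rightarrow> nat" and xs :: "nat list"
  assumes length_prefs: "length (prefs G) = 3 * m + length xs"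
    and prefs_clause: "\<And>a. a < 3 * m \<Longrightarrow> prefs G ! a = [[F (a div 3)], [X a], [Z (a div 3)]]"
    and prefs_owner: "\<And>j. j < length xs \<Longrightarrow> prefs G ! (3 * m + j) = [[xs ! j]]"
    and distinct_xs: "distinct xs"
    and inj_F: "inj_on F {..<m}" and inj_Z: "inj_on Z {..<m}"
    and F_Z: "\<And>c c'. c < m \<Longrightarrow> c' < m \<Longrightarrow> F c \<noteq> Z c'"
    and F_xs: "\<And>c. c < m \<Longrightarrow> F c \<notin> set xs" and Z_xs: "\<And>c. c < m \<Longrightarrow> Z c \<notin> set xs"
    and X_xs: "\<And>a. a < 3 * m \<Longrightarrow> X a \<in> set xs"
    and F_items: "\<And>c. c < m \<Longrightarrow> F c \<in> items G" and Z_items: "\<And>c. c < m \<Longrightarrow> Z c \<in> items G"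
    and xs_items: "set xs \<subseteq> items G"
    and cost_F: "\<And>c. c < m \<Longrightarrow> costs G ! F c = 2" and cost_Z: "\<And>c. c < m \<Longrightarrow> costs G ! Z c = 2"
    and cost_xs: "\<And>x. x \<in> set xs \<Longrightarrow> costs G ! x = 1"
    and cost_nonneg: "\<And>r. r \<in> set (costs G) \<Longrightarrow> 0 \<le> r"
begin

section \<open>Popular matchings of such an instance\<close>

lemma people_eq: "people G = {..<3 * m} \<union> (\<lambda>j. 3 * m + j) ` {..<length xs}"
proof -
  have "a \<in> (\<lambda>j. 3 * m + j) ` {..<length xs}" if "a < 3 * m + length xs" "\<not> a < 3 * m" for a
    using that by (intro image_eqI[of _ _ "a - 3 * m"]) auto
  then show ?thesis
    by (auto simp: people_def length_prefs)
qed

lemma person_cases: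
  assumes "a \<in> people G"
  obtains (clause) "a < 3 * m" | (owner) j where "j < length xs" "a = 3 * m + j"
  using assms unfolding people_eq by auto

lemma wf: "wf_aug_instance G"
  unfolding wf_aug_instance_def
proof (intro conjI ballI)
  fix l assume "l \<in> set (prefs G)"
  then obtain a where a: "a \<in> people G" "l = prefs G ! a"
    by (auto simp: in_set_conv_nth people_def)
  from a(1) have "wf_pref_list l \<and> listed l \<subseteq> items G"
  proof (cases rule: person_cases)
    case clause
    then have c: "a div 3 < m" by auto
    have "F (a div 3) \<noteq> X a" "Z (a div 3) \<noteq> X a"
      using F_xs[OF c] Z_xs[OF c] X_xs[OF clause] by metis+
    then show ?thesis
      using a(2) F_Z[OF c c] prefs_clause[OF clause] F_items[OF c] Z_items[OF c] X_xs[OF clause] xs_items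
      by (auto simp: wf_pref_list_def listed_def)
  next
    case (owner j)
    then show ?thesis
      using a(2) prefs_owner[of j] xs_items by (auto simp: wf_pref_list_def listed_def)
  qed
  then show "wf_pref_list l" "listed l \<subseteq> items G" by auto
qed (use cost_nonneg in auto)

lemma improves_owner: "j < length xs \<Longrightarrow> M (3 * m + j) = None \<Longrightarrow> improves G M (3 * m + j) (xs ! j)"
  by (simp add: improves_def people_def length_prefs prefs_owner listed_def)

lemma improves_clause:
  assumes "a < 3 * m"
  shows "improves G M a b \<longleftrightarrow>
    b = F (a div 3) \<and> (M a = None \<or> M a = Some (X a) \<or> M a = Some (Z (a div 3)) \<or> (\<forall>b'. M a \<noteq> Some b')) \<or>
    b = X a \<and> (M a = None \<or> M a = Some (Z (a div 3))) \<or>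
    b = Z (a div 3) \<and> M a = None"
proof -
  have c: "a div 3 < m" using assms by auto
  have "F (a div 3) \<noteq> X a" "Z (a div 3) \<noteq> X a" "F (a div 3) \<noteq> Z (a div 3)"
    using F_xs[OF c] Z_xs[OF c] X_xs[OF assms] F_Z[OF c c] by metis+
  then show ?thesis
    using assms by (cases "M a") (auto simp: improves_def people_def length_prefs prefs_clause listed_def ranks_before_triple)
qed

lemma matched_clause:
  assumes "matching G cp M" "a < 3 * m" "M a = Some b"
  shows "b = F (a div 3) \<or> b = X a \<or> b = Z (a div 3)"
proof -
  have "b \<in> listed (prefs G ! a)" using assms by (auto simp: matching_def)
  then show ?thesis by (auto simp: prefs_clause[OF assms(2)] listed_def)
qed

lemma matched_owner:
  assumes "matching G cp M" "j < length xs" "M (3 * m + j) = Some b"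
  shows "b = xs ! j"
proof -
  have "b \<in> listed (prefs G ! (3 * m + j))" using assms by (auto simp: matching_def)
  then show ?thesis by (auto simp: prefs_owner[OF assms(2)] listed_def)
qed

lemma matched_person:
  assumes "matching G cp M" "M a = Some b"
  shows "a \<in> people G"
  using assms by (auto simp: matching_def)

lemma matched_to_Z:
  assumes "matching G cp M" "M a = Some (Z c)" "c < m"
  shows "a < 3 * m \<and> a div 3 = c"
proof (cases rule: person_cases[OF matched_person[OF assms(1,2)]])
  case 1
  then have "a div 3 < m" by auto
  then show ?thesis
    using matched_clause[OF assms(1) 1 assms(2)] Z_xs[OF assms(3)] X_xs[OF 1] F_Z[of "a div 3" c]
      inj_onD[OF inj_Z, of c "a div 3"] assms(3) 1 by auto
next
  case (2 j)
  then show ?thesis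
    using matched_owner[OF assms(1), of j] assms(2) Z_xs[OF assms(3)] by auto
qed

lemma matched_to_x:
  assumes "matching G cp M" "M a = Some (xs ! j)" "j < length xs"
  shows "a = 3 * m + j \<or> a < 3 * m \<and> X a = xs ! j"
proof (cases rule: person_cases[OF matched_person[OF assms(1,2)]])
  case 1
  then have "a div 3 < m" by auto
  then show ?thesis
    using matched_clause[OF assms(1) 1 assms(2)] F_xs[of "a div 3"] Z_xs[of "a div 3"] assms(3) 1 nth_mem[of j xs] by metis
next
  case (2 j')
  then show ?thesis
    using matched_owner[OF assms(1), of j'] assms(2,3) distinct_xs by (auto simp: nth_eq_iff_index_eq)
qed

text \<open>The holder \<open>a'\<close> of the wanted item is below the top of her list, so she
  moves to her first choice and leaves the item to \<open>a\<close>. A first choice always has a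
  copy, so the chain may end there.\<close>

lemma clause_occupant_contradiction:
  assumes pop: "popular G (\<lambda>b. 1 + k b) M" and "improves G M a b" "a' < 3 * m" "M a' = Some b" "b \<noteq> F (a' div 3)"
    "a \<noteq> a'" "M a \<noteq> Some (F (a' div 3))"
  shows False
proof (rule popular_no_promotion_chain[OF wf pop assms(2) _ assms(4,6,7,5)])
  have "matching G (\<lambda>b. 1 + k b) M" using pop by (simp add: popular_def)
  then show "improves G M a' (F (a' div 3))"
    using matched_clause[of _ M, OF _ assms(3,4)] assms(3-5) by (auto simp: improves_clause)
qed simp

text \<open>If her item is full although she is unmatched, a clause person holds it, since no other
  owner lists it. That person can be promoted to her first choice.\<close>

lemma owner_matched:
  assumes pop: "popular G (\<lambda>b. 1 + k b) M" and j: "j < length xs"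
  shows "M (3 * m + j) = Some (xs ! j)"
proof (rule ccontr)
  have mt: "matching G (\<lambda>b. 1 + k b) M" using pop by (simp add: popular_def)
  assume "M (3 * m + j) \<noteq> Some (xs ! j)"
  then have none: "M (3 * m + j) = None"
    using matched_owner[OF mt j] by (cases "M (3 * m + j)") auto
  then have imp: "improves G M (3 * m + j) (xs ! j)"
    using improves_owner[OF j] by simp
  then have "1 + k (xs ! j) \<le> card {a. M a = Some (xs ! j)}"
    using popular_improves_full[OF wf pop] by simp
  then have "{a. M a = Some (xs ! j)} \<noteq> {}" by (intro notI) simp
  then obtain a' where a': "M a' = Some (xs ! j)" by auto
  then have "a' \<noteq> 3 * m + j" using none by auto
  with a' have a'2: "a' < 3 * m" using matched_to_x[OF mt a' j] by auto
  have "F (a' div 3) \<notin> set xs" using a'2 by (intro F_xs) auto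
  then show False
    using clause_occupant_contradiction[OF pop imp a'2 a'] a'2 none j nth_mem[of j xs]
    by (metis nat_neq_iff not_add_less1 option.distinct(1))
qed

text \<open>Even the last choice would improve an unmatched person, so it is full; its holder
  belongs to the same constraint and can be promoted to the first choice.\<close>

lemma clause_person_matched:
  assumes pop: "popular G (\<lambda>b. 1 + k b) M" and a: "a < 3 * m"
  shows "M a \<noteq> None"
proof
  have mt: "matching G (\<lambda>b. 1 + k b) M" using pop by (simp add: popular_def)
  have c: "a div 3 < m" using a by auto
  assume none: "M a = None"
  then have imp: "improves G M a (Z (a div 3))"
    using a by (auto simp: improves_clause)
  then have "1 + k (Z (a div 3)) \<le> card {a'. M a' = Some (Z (a div 3))}"
    using popular_improves_full[OF wf pop] by simp
  then have "{a'. M a' = Some (Z (a div 3))} \<noteq> {}" by (intro notI) simp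
  then obtain a' where a': "M a' = Some (Z (a div 3))" by auto
  with matched_to_Z[OF mt a' c] have a'2: "a' < 3 * m" "a' div 3 = a div 3" by auto
  show False
    using clause_occupant_contradiction[OF pop imp a'2(1) a'] a'2 none a' F_Z[OF c c] by (metis option.distinct(1))
qed

text \<open>Otherwise the item of \<open>a\<close> would be full with at least two holders, only one
  of them its owner. The other one is a clause person, who could move up in favour of
  \<open>a\<close>.\<close>

lemma no_surplus_at_Z:
  assumes pop: "popular G (\<lambda>b. 1 + k b) M" and a: "a < 3 * m" and Ma: "M a = Some (Z (a div 3))"
  shows "k (X a) = 0"
proof (rule ccontr)
  have mt: "matching G (\<lambda>b. 1 + k b) M" using pop by (simp add: popular_def)
  have c: "a div 3 < m" using a by auto
  obtain j where j: "j < length xs" "X a = xs ! j"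
    using X_xs[OF a] by (auto simp: in_set_conv_nth)
  assume "k (X a) \<noteq> 0"
  moreover have imp: "improves G M a (X a)"
    using a Ma by (auto simp: improves_clause)
  then have "1 + k (X a) \<le> card {a'. M a' = Some (X a)}"
    using popular_improves_full[OF wf pop] by simp
  ultimately have "\<not> {a'. M a' = Some (X a)} \<subseteq> {3 * m + j}"
    using card_mono[of "{3 * m + j}" "{a'. M a' = Some (X a)}"] by auto
  then obtain a' where a': "M a' = Some (X a)" "a' \<noteq> 3 * m + j" by auto
  with matched_to_x[OF mt, of a' j] j have a'2: "a' < 3 * m" by auto
  then have c': "a' div 3 < m" by auto
  have "F (a' div 3) \<noteq> X a" "F (a' div 3) \<noteq> Z (a div 3)" "a \<noteq> a'"
    using F_xs[OF c'] X_xs[OF a] F_Z[OF c' c] a' Ma Z_xs[OF c] by auto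
  then show False
    using clause_occupant_contradiction[OF pop imp a'2 a'(1)] Ma by auto
qed

section \<open>Counting copies against the budget\<close>

lemma div_3_fibre: "{a. a div 3 = c} = {3 * c, 3 * c + 1, 3 * c + 2 :: nat}"
  by auto

lemma card_clause_sum:
  "card {a. a < 3 * m \<and> P a} = (\<Sum>c<m. card {a. a div 3 = c \<and> P a})"
proof -
  have eq: "{a \<in> {a. a < 3 * m \<and> P a}. a div 3 = c} = {a. a div 3 = c \<and> P a}" if "c < m" for c
    using that by auto
  have "card {a. a < 3 * m \<and> P a} = (\<Sum>a\<in>{a. a < 3 * m \<and> P a}. 1)" by simp
  also have "\<dots> = (\<Sum>c<m. \<Sum>a\<in>{a \<in> {a. a < 3 * m \<and> P a}. a div 3 = c}. 1)"
    by (subst sum.group) auto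
  also have "\<dots> = (\<Sum>c<m. card {a. a div 3 = c \<and> P a})"
    by (intro sum.cong) (simp_all only: card_eq_sum eq lessThan_iff)
  finally show ?thesis .
qed

lemma card_x_sum:
  assumes "finite A" "\<And>a. a \<in> A \<Longrightarrow> g a \<in> set xs"
  shows "(\<Sum>x\<in>set xs. card {a \<in> A. g a = x}) = card A"
proof -
  have "card A = (\<Sum>a\<in>A. 1)" by simp
  also have "\<dots> = (\<Sum>x\<in>set xs. \<Sum>a\<in>{a \<in> A. g a = x}. 1)"
    using assms by (subst sum.group) auto
  finally show ?thesis by simp
qed

text \<open>Items outside the three families may be copied as well, at a nonnegative price, whence
  only an inequality.\<close>

lemma cost_lower_bound:
  "of_nat ((\<Sum>x\<in>set xs. k x) + (\<Sum>c<m. 2 * k (F c)) + (\<Sum>c<m. 2 * k (Z c))) \<le> augmentation_cost G k"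
proof -
  let ?w = "\<lambda>b. of_nat (k b) * costs G ! b"
  have fin: "finite (items G)" by (simp add: items_def)
  have nn: "0 \<le> ?w b" if "b \<in> items G" for b
    using that cost_nonneg[of "costs G ! b"] by (auto simp: items_def)
  have "of_nat ((\<Sum>x\<in>set xs. k x) + (\<Sum>c<m. 2 * k (F c)) + (\<Sum>c<m. 2 * k (Z c))) =
    (\<Sum>b\<in>set xs. ?w b) + (\<Sum>c<m. ?w (F c)) + (\<Sum>c<m. ?w (Z c))"
    by (simp add: cost_xs cost_F cost_Z mult.commute sum_distrib_left sum_distrib_right)
  also have "\<dots> = (\<Sum>b\<in>set xs. ?w b) + (\<Sum>b\<in>F ` {..<m}. ?w b) + (\<Sum>b\<in>Z ` {..<m}. ?w b)"
    by (simp add: sum.reindex inj_F inj_Z)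
  also have "\<dots> = (\<Sum>b\<in>set xs \<union> F ` {..<m} \<union> Z ` {..<m}. ?w b)"
    using F_xs Z_xs F_Z by (subst sum.union_disjoint, simp, simp, force)+ simp
  also have "\<dots> \<le> (\<Sum>b\<in>items G. ?w b)"
    using fin nn xs_items F_items Z_items by (intro sum_mono2) auto
  finally show ?thesis by (simp add: augmentation_cost_def)
qed

text \<open>Let \<open>u c\<close> be the number of persons of constraint \<open>c\<close> on
  variable items. Three matched persons face \<open>1 + k (F c)\<close> and
  \<open>1 + k (Z c)\<close> copies, which gives \<open>u c + k (F c) + k (Z c) \<ge> 1\<close>, and
  the numbers \<open>u c\<close> add up to at most the number of extra variable copies. The budget
  therefore forces \<open>u c + 2 * k (F c) + 2 * k (Z c) = 1\<close> for each
  \<open>c\<close>.\<close>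

lemma feasible_imp_nae:
  assumes feas: "feasible_augmentation G k" and cost: "augmentation_cost G k \<le> of_nat m" and c: "c < m"
  shows "\<exists>a b. a div 3 = c \<and> b div 3 = c \<and> 0 < k (X a) \<and> k (X b) = 0"
proof -
  obtain M where pop: "popular G (\<lambda>b. 1 + k b) M"
    using feas by (auto simp: feasible_augmentation_def)
  then have mt: "matching G (\<lambda>b. 1 + k b) M" by (simp add: popular_def)
  define u where "u c = card {a. a div 3 = c \<and> M a = Some (X a)}" for c
  have three: "3 \<le> card {a. a div 3 = c \<and> M a = Some (F c)} + u c + card {a. a div 3 = c \<and> M a = Some (Z c)}"
    if "c < m" for c
  proof -
    have fin: "finite {a. a div 3 = c \<and> P a}" for P
      by (rule finite_subset[of _ "{a. a div 3 = c}"]) (auto simp: div_3_fibre)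
    have "a < 3 * m" if "a div 3 = c" for a using that \<open>c < m\<close> by auto
    then have "{a. a div 3 = c} \<subseteq> {a. a div 3 = c \<and> M a = Some (F c)} \<union>
       {a. a div 3 = c \<and> M a = Some (X a)} \<union> {a. a div 3 = c \<and> M a = Some (Z c)}"
      using clause_person_matched[OF pop] matched_clause[OF mt] by blast
    then have "card {a. a div 3 = c} \<le> card ({a. a div 3 = c \<and> M a = Some (F c)} \<union>
       {a. a div 3 = c \<and> M a = Some (X a)} \<union> {a. a div 3 = c \<and> M a = Some (Z c)})"
      using fin by (intro card_mono) auto
    also have "\<dots> \<le> card {a. a div 3 = c \<and> M a = Some (F c)} + u c + card {a. a div 3 = c \<and> M a = Some (Z c)}"
      unfolding u_def by (meson card_Un_le add_le_mono1 le_trans)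
    finally show ?thesis by (simp add: div_3_fibre)
  qed
  have capF: "card {a. a div 3 = c \<and> M a = Some (F c)} \<le> 1 + k (F c)" if "c < m" for c
    using matching_capacity[OF mt F_items[OF that]] card_mono[of "{a. M a = Some (F c)}" "{a. a div 3 = c \<and> M a = Some (F c)}"]
    by fastforce
  have capZ: "card {a. a div 3 = c \<and> M a = Some (Z c)} \<le> 1 + k (Z c)" if "c < m" for c
    using matching_capacity[OF mt Z_items[OF that]] card_mono[of "{a. M a = Some (Z c)}" "{a. a div 3 = c \<and> M a = Some (Z c)}"]
    by fastforce
  \<comment> \<open>The owner occupies one of the \<open>1 + k x\<close> copies, so the clause
    persons share the extra ones.\<close>
  have users: "card {a \<in> {a. a < 3 * m \<and> M a = Some (X a)}. X a = x} \<le> k x" if x: "x \<in> set xs" for x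
  proof -
    obtain j where j: "j < length xs" "x = xs ! j" using x by (auto simp: in_set_conv_nth)
    let ?A = "{a \<in> {a. a < 3 * m \<and> M a = Some (X a)}. X a = x}"
    have "card (insert (3 * m + j) ?A) \<le> card {a. M a = Some x}"
      using matching_capacity(1)[OF mt, of x] x xs_items owner_matched[OF pop j(1)] j(2)
      by (intro card_mono) (blast, auto)
    moreover have "card (insert (3 * m + j) ?A) = Suc (card ?A)"
      by (subst card_insert_disjoint) auto
    ultimately show ?thesis
      using matching_capacity(2)[OF mt, of x] xs_items that by auto
  qed
  have "(\<Sum>c<m. u c) = card {a. a < 3 * m \<and> M a = Some (X a)}"
    unfolding u_def by (rule card_clause_sum[symmetric])
  also have "\<dots> = (\<Sum>x\<in>set xs. card {a \<in> {a. a < 3 * m \<and> M a = Some (X a)}. X a = x})"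
    using X_xs by (subst card_x_sum) auto
  also have "\<dots> \<le> (\<Sum>x\<in>set xs. k x)"
    by (rule sum_mono) (rule users)
  finally have "(\<Sum>c<m. u c + 2 * k (F c) + 2 * k (Z c)) \<le> (\<Sum>x\<in>set xs. k x) + (\<Sum>c<m. 2 * k (F c)) + (\<Sum>c<m. 2 * k (Z c))"
    by (simp add: sum.distrib)
  also have "\<dots> \<le> m"
    using cost_lower_bound[of k] cost by (metis (no_types, lifting) of_nat_le_iff order_trans)
  finally have le: "(\<Sum>c<m. u c + 2 * k (F c) + 2 * k (Z c)) \<le> m" .
  have ge: "1 \<le> u c + 2 * k (F c) + 2 * k (Z c)" if "c < m" for c
    using three[OF that] capF[OF that] capZ[OF that] by linarith
  \<comment> \<open>There are \<open>m\<close> summands, each at least 1, with sum at most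
    \<open>m\<close>.\<close>
  have one: "u c + 2 * k (F c) + 2 * k (Z c) = 1"
  proof (rule ccontr)
    assume "u c + 2 * k (F c) + 2 * k (Z c) \<noteq> 1"
    then have "1 < u c + 2 * k (F c) + 2 * k (Z c)" using ge[OF c] by linarith
    then have "(\<Sum>c<m. 1) < (\<Sum>c<m. u c + 2 * k (F c) + 2 * k (Z c))"
      using ge c by (intro sum_strict_mono_ex1) auto
    then show False using le by simp
  qed
  \<comment> \<open>The factor 2 decides: a single extra copy of \<open>F c\<close> or
    \<open>Z c\<close> would exceed the value 1.\<close>
  have kF: "k (F c) = 0" and kZ: "k (Z c) = 0" and uc: "u c = 1"
    using one by arith+
  from uc have "{a. a div 3 = c \<and> M a = Some (X a)} \<noteq> {}" unfolding u_def by (intro notI) simp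
  then obtain a where a: "a div 3 = c" "M a = Some (X a)" by blast
  \<comment> \<open>At most one person on \<open>F c\<close> and exactly one on her variable leave
    somebody for \<open>Z c\<close>; her variable is false by
    \<open>no_surplus_at_Z\<close>.\<close>
  have "card {a. a div 3 = c \<and> M a = Some (Z c)} \<noteq> 0"
    using three[OF c] capF[OF c] kF uc by linarith
  then have "{a. a div 3 = c \<and> M a = Some (Z c)} \<noteq> {}" by (metis card.empty)
  then obtain b where b: "b div 3 = c" "M b = Some (Z c)"
    by blast
  have a3: "a < 3 * m" "b < 3 * m" using a b c by auto
  have "a \<in> {a' \<in> {a. a < 3 * m \<and> M a = Some (X a)}. X a' = X a}" using a a3 by auto
  then have "0 < card {a' \<in> {a. a < 3 * m \<and> M a = Some (X a)}. X a' = X a}"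
    by (subst card_gt_0_iff) auto
  then have "0 < k (X a)" using users[OF X_xs[OF a3(1)]] by linarith
  then show ?thesis
    using a b no_surplus_at_Z[OF pop a3(2)] by auto
qed

text \<open>In each constraint \<open>U c\<close> has a true variable and gets a new copy of it,
  \<open>V c\<close> has a false one and gets \<open>Z c\<close>, and \<open>W c\<close> gets
  \<open>F c\<close>. Whoever does better in another matching displaces either \<open>W c\<close>
  from the only copy of \<open>F c\<close> or an owner from the only copy of a false variable, and
  different winners displace different losers.\<close>

lemma nae_imp_feasible:
  assumes nae: "\<And>c. c < m \<Longrightarrow> \<exists>a b. a div 3 = c \<and> b div 3 = c \<and> \<tau> (X a) \<and> \<not> \<tau> (X b)"
  shows "\<exists>k. feasible_augmentation G k \<and> augmentation_cost G k \<le> of_nat m"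
proof -
  define Q where "Q c u v w \<longleftrightarrow>
    {u, v, w} = {a. a div 3 = c} \<and> u \<noteq> v \<and> u \<noteq> w \<and> v \<noteq> w \<and> \<tau> (X u) \<and> \<not> \<tau> (X v)" for c u v w
  have "\<exists>u v w. Q c u v w"
    if c: "c < m" for c
  proof -
    obtain a b where ab: "a div 3 = c" "b div 3 = c" "\<tau> (X a)" "\<not> \<tau> (X b)"
      using nae[OF c] by blast
    then have "a \<noteq> b" by auto
    then have "card ({a. a div 3 = c} - {a, b}) = 1"
      using ab by (subst card_Diff_subset) (auto simp: div_3_fibre)
    then obtain w where "{a. a div 3 = c} - {a, b} = {w}" by (auto simp: card_1_singleton_iff)
    then have abw: "{a, b, w} = {a. a div 3 = c}" "a \<noteq> w" "b \<noteq> w" using ab(1,2) by auto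
    show ?thesis
      unfolding Q_def by (intro exI[of _ a] exI[of _ b] exI[of _ w] conjI \<open>a \<noteq> b\<close> ab(3,4) abw)
  qed
  then obtain U V W where Q: "\<And>c. c < m \<Longrightarrow> Q c (U c) (V c) (W c)" by metis
  have UVW: "\<And>c. c < m \<Longrightarrow> {U c, V c, W c} = {a. a div 3 = c}"
    "\<And>c. c < m \<Longrightarrow> U c \<noteq> V c" "\<And>c. c < m \<Longrightarrow> U c \<noteq> W c" "\<And>c. c < m \<Longrightarrow> V c \<noteq> W c"
    "\<And>c. c < m \<Longrightarrow> \<tau> (X (U c))" "\<And>c. c < m \<Longrightarrow> \<not> \<tau> (X (V c))"
    using Q unfolding Q_def by simp_all
  have div: "U c div 3 = c" "V c div 3 = c" "W c div 3 = c" if "c < m" for c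
    using UVW(1)[OF that] by auto
  have lt: "U c < 3 * m" "V c < 3 * m" "W c < 3 * m" if "c < m" for c
    using div[OF that] that by auto
  \<comment> \<open>One copy is bought per constraint, each at price 1, so the total cost is the
    number of constraints.\<close>
  define k where "k x = (if x \<in> set xs then card {c \<in> {..<m}. X (U c) = x} else 0)" for x
  define M where "M a = (if a < 3 * m then
      (if a = U (a div 3) then Some (X a) else if a = V (a div 3) then Some (Z (a div 3)) else Some (F (a div 3)))
    else if a < 3 * m + length xs then Some (xs ! (a - 3 * m)) else None)" for a
  have M_U: "M (U c) = Some (X (U c))" and M_V: "M (V c) = Some (Z c)" and M_W: "M (W c) = Some (F c)" if "c < m" for c
    using lt[OF that] div[OF that] UVW(2-4)[OF that] by (auto simp: M_def)
  have M_own: "M (3 * m + j) = Some (xs ! j)" if "j < length xs" for j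
    using that by (simp add: M_def)
  have clause_cases: "a = U (a div 3) \<or> a = V (a div 3) \<or> a = W (a div 3)" if "a < 3 * m" for a
  proof -
    have "a div 3 < m" using that by auto
    then show ?thesis using UVW(1)[of "a div 3"] by blast
  qed
  have dom_M: "a \<in> people G" if "M a = Some b" for a b
    using that by (auto simp: M_def people_def length_prefs split: if_splits)
  have M_F: "a = W c" if "M a = Some (F c)" "c < m" for a c
  proof (cases rule: person_cases[OF dom_M[OF that(1)]])
    case 1
    then have "a div 3 < m" by auto
    then show ?thesis
      using clause_cases[OF 1] that F_xs[OF that(2)] X_xs[OF 1] F_Z[OF that(2), of "a div 3"]
        inj_onD[OF inj_F, of "a div 3" c] M_U[of "a div 3"] M_V[of "a div 3"] M_W[of "a div 3"]
      by (metis lessThan_iff option.inject)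
  next
    case (2 j) then show ?thesis using that F_xs[OF that(2)] M_own[of j] nth_mem[of j xs] by auto
  qed
  have M_Z: "a = V c" if "M a = Some (Z c)" "c < m" for a c
  proof (cases rule: person_cases[OF dom_M[OF that(1)]])
    case 1
    then have "a div 3 < m" by auto
    then show ?thesis
      using clause_cases[OF 1] that Z_xs[OF that(2)] X_xs[OF 1] F_Z[of "a div 3" c]
        inj_onD[OF inj_Z, of "a div 3" c] M_U[of "a div 3"] M_V[of "a div 3"] M_W[of "a div 3"]
      by (metis lessThan_iff option.inject)
  next
    case (2 j) then show ?thesis using that Z_xs[OF that(2)] M_own[of j] nth_mem[of j xs] by auto
  qed
  have M_x: "a = 3 * m + j \<or> a \<in> U ` {c \<in> {..<m}. X (U c) = xs ! j}" if "M a = Some (xs ! j)" "j < length xs" for a j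
  proof (cases rule: person_cases[OF dom_M[OF that(1)]])
    case 1
    then have c: "a div 3 < m" by auto
    then have "a = U (a div 3)"
      using clause_cases[OF 1] that F_xs[OF c] Z_xs[OF c] M_V[OF c] M_W[OF c]
      by (metis nth_mem option.inject)
    moreover from this have "X (U (a div 3)) = xs ! j" using M_U[OF c] that(1) by simp
    ultimately show ?thesis using c by blast
  next
    case (2 j')
    then show ?thesis using that M_own[of j'] distinct_xs by (auto simp: nth_eq_iff_index_eq)
  qed
  have mt: "matching G (\<lambda>b. 1 + k b) M"
    unfolding matching_def
  proof (intro conjI allI ballI impI)
    show "dom M \<subseteq> people G" using dom_M by auto
  next
    fix a b assume "M a = Some b"
    then show "b \<in> listed (prefs G ! a)"
      by (cases rule: person_cases[OF dom_M[OF \<open>M a = Some b\<close>]])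
        (auto simp: M_def prefs_clause prefs_owner listed_def split: if_splits)
  next
    fix b assume "b \<in> items G"
    have one: "card {a. M a = Some b} \<le> 1 + k b" if "\<And>a. M a = Some b \<Longrightarrow> a = a0" for a0
    proof -
      have "card {a. M a = Some b} \<le> card {a0}" using that by (intro card_mono) auto
      then show ?thesis by simp
    qed
    consider (F) c where "c < m" "b = F c" | (Z) c where "c < m" "b = Z c" | (x) j where "j < length xs" "b = xs ! j"
      | (none) "\<And>a. M a \<noteq> Some b"
    proof (cases "\<exists>a. M a = Some b")
      case True
      then obtain a where "M a = Some b" by blast
      then show ?thesis
      proof (cases rule: person_cases[OF dom_M[OF \<open>M a = Some b\<close>]])
        case 1
        then have "a div 3 < m" by auto
        with 1 \<open>M a = Some b\<close> show ?thesis using that(1,2,3) X_xs[OF 1] 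
          by (auto simp: M_def in_set_conv_nth split: if_splits)
      next
        case (2 j) with \<open>M a = Some b\<close> show ?thesis using that(3) M_own[of j] by auto
      qed
    qed blast
    then show "card {a. M a = Some b} \<le> 1 + k b"
    proof cases
      case F then show ?thesis using M_F one by blast
    next
      case Z then show ?thesis using M_Z one by blast
    next
      case x
      let ?U = "U ` {c \<in> {..<m}. X (U c) = b}"
      have "{a. M a = Some b} \<subseteq> insert (3 * m + j) ?U"
        using M_x x by auto
      then have "card {a. M a = Some b} \<le> card (insert (3 * m + j) ?U)"
        by (intro card_mono) auto
      also have "\<dots> \<le> Suc (card ?U)" by (rule card_insert_le_m1) auto
      also have "card ?U \<le> card {c \<in> {..<m}. X (U c) = b}" by (rule card_image_le) simp
      finally show ?thesis using x by (simp add: k_def)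
    next
      case none then show ?thesis by simp
    qed
  qed
  have "popular G (\<lambda>b. 1 + k b) M"
    unfolding popular_def
  proof (intro conjI mt notI)
    assume "\<exists>M'. matching G (\<lambda>b. 1 + k b) M' \<and> more_popular G M' M"
    then obtain M' where mt': "matching G (\<lambda>b. 1 + k b) M'" and more: "more_popular G M' M" by blast
    define I where "I = {a \<in> people G. prefers G a M' M}"
    define D where "D = {a \<in> people G. prefers G a M M'}"
    have k_F: "1 + k (F c) = 1" if "c < m" for c using F_xs[OF that] by (simp add: k_def)
    \<comment> \<open>Copies are bought for true variables only, so the item of \<open>V c\<close>
      keeps its single copy.\<close>
    have k_V: "1 + k (X (V c)) = 1" if "c < m" for c
    proof -
      have "{c' \<in> {..<m}. X (U c') = X (V c)} = {}" using UVW(5,6) that by force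
      then show ?thesis by (simp add: k_def)
    qed
    \<comment> \<open>\<open>W c\<close> and the owners already have their best item, and
      \<open>U c\<close> can gain nothing but the first choice.\<close>
    have I_cases: "\<exists>c<m. a < 3 * m \<and> a div 3 = c \<and> (a \<noteq> W c \<and> M' a = Some (F c) \<or> a = V c \<and> M' a = Some (X a))" if "a \<in> I" for a
    proof -
      have "a \<in> people G" and pr: "prefers G a M' M" using that by (auto simp: I_def)
      show ?thesis
      proof (cases rule: person_cases[OF \<open>a \<in> people G\<close>])
        case 1
        then have c: "a div 3 < m" by auto
        have ne: "F (a div 3) \<noteq> X a" "Z (a div 3) \<noteq> X a" "F (a div 3) \<noteq> Z (a div 3)"
          using F_xs[OF c] Z_xs[OF c] X_xs[OF 1] F_Z[OF c c] by metis+
        have "M a \<noteq> None" using 1 by (simp add: M_def)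
        with pr obtain b b' where b: "M' a = Some b" "M a = Some b'" "ranks_before (prefs G ! a) b b'"
          unfolding prefers_def by auto
        then show ?thesis
          using ne clause_cases[OF 1] c 1 M_U[OF c] M_V[OF c] M_W[OF c]
          by (auto simp: prefs_clause ranks_before_triple)
      next
        case (2 j)
        then show ?thesis using pr M_own[of j] by (auto simp: prefers_def prefs_owner ranks_before_single)
      qed
    qed
    have owner_ex: "\<exists>j<length xs. xs ! j = X (V c)" if "c < m" for c
      using X_xs[OF lt(2)[OF that]] by (auto simp: in_set_conv_nth)
    then obtain ow where ow: "\<And>c. c < m \<Longrightarrow> ow c < length xs" "\<And>c. c < m \<Longrightarrow> xs ! ow c = X (V c)" by metis
    \<comment> \<open>\<open>g a\<close> is the person who pays for the gain of \<open>a\<close>: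
      the former holder of the first choice, or the owner of the false variable.\<close>
    define g where "g a = (if M' a = Some (F (a div 3)) then W (a div 3) else 3 * m + ow (a div 3))" for a
    have "inj_on g I"
    proof (rule inj_onI)
      fix a a' assume "a \<in> I" "a' \<in> I" and eq: "g a = g a'"
      note a = I_cases[OF \<open>a \<in> I\<close>] and a' = I_cases[OF \<open>a' \<in> I\<close>]
      have c: "a div 3 < m" "a' div 3 < m" using a a' by auto
      have W: "W (a div 3) < 3 * m" "W (a' div 3) < 3 * m" using lt c by auto
      show "a = a'"
      proof (cases "M' a = Some (F (a div 3))")
        case True
        then have "M' a' = Some (F (a' div 3))" "W (a div 3) = W (a' div 3)"
          using eq W by (auto simp: g_def split: if_splits)
        moreover from this(2) have "a div 3 = a' div 3" using div(3) c by metis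
        ultimately show ?thesis
          using matching_capacity_one[OF mt' F_items[OF c(1)] k_F[OF c(1)], of a a'] True by simp
      next
        case False
        then have "M' a' \<noteq> Some (F (a' div 3))" "ow (a div 3) = ow (a' div 3)"
          using eq W by (auto simp: g_def split: if_splits)
        \<comment> \<open>A common owner means a common variable item, of which \<open>M'\<close>
          can use only one copy.\<close>
        then have "M' a = Some (X a)" "M' a' = Some (X a')" "a = V (a div 3)" "a' = V (a' div 3)" "X a = X a'"
          using a a' False c ow(2) by metis+
        then show ?thesis
          using matching_capacity_one[OF mt', of "X a" a a'] k_V[OF c(1)] X_xs[of a] a xs_items by auto
      qed
    qed
    moreover have "g ` I \<subseteq> D"
    proof
      fix y assume "y \<in> g ` I"
      then obtain a where a: "a \<in> I" "y = g a" by blast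
      note Ia = I_cases[OF a(1)]
      then have c: "a div 3 < m" by auto
      show "y \<in> D"
      proof (cases "M' a = Some (F (a div 3))")
        case True
        have y: "y = W (a div 3)" using a True by (simp add: g_def)
        have y3: "y < 3 * m" "y div 3 = a div 3" using y lt(3)[OF c] div(3)[OF c] by auto
        have My: "M y = Some (F (a div 3))" using y M_W[OF c] by simp
        have ne: "F (a div 3) \<noteq> X a" "Z (a div 3) \<noteq> X a" using F_xs[OF c] Z_xs[OF c] X_xs[of a] Ia by metis+
        then have "a \<noteq> y" using Ia True y by auto
        then have "M' y \<noteq> Some (F (a div 3))"
          using matching_capacity_one[OF mt' F_items[OF c] k_F[OF c], of a y] True by auto
        then have "M' y = None \<or> M' y = Some (X y) \<or> M' y = Some (Z (a div 3))"
          using matched_clause[OF mt' y3(1)] y3(2) by (cases "M' y") auto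
        then have "prefers G y M M'"
          using My y3 by (auto simp: prefers_def prefs_clause ranks_before_triple)
        then show ?thesis using dom_M[OF My] by (simp add: D_def)
      next
        case False
        have y: "y = 3 * m + ow (a div 3)" using a False by (simp add: g_def)
        have aV: "a = V (a div 3)" "M' a = Some (X a)" "a < 3 * m" using Ia False by auto
        have "y \<noteq> a" using aV y by auto
        then have "M' y \<noteq> Some (X a)"
          using matching_capacity_one[OF mt', of "X a" a y] k_V[OF c] aV X_xs[of a] xs_items by auto
        then have "M' y = None"
          using matched_owner[OF mt' ow(1)[OF c]] y ow(2)[OF c] aV(1) by (cases "M' y") auto
        moreover have "M y = Some (X a)" using M_own[OF ow(1)[OF c]] y ow(2)[OF c] aV(1) by simp
        ultimately show ?thesis using dom_M[of y "X a"] by (simp add: D_def prefers_def)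
      qed
    qed
    ultimately have "card I \<le> card D"
      using finite_people[of G] by (intro card_inj_on_le[of g]) (auto simp: D_def)
    then show False using more by (simp add: more_popular_def I_def D_def)
  qed
  then have "feasible_augmentation G k" by (auto simp: feasible_augmentation_def)
  moreover have "augmentation_cost G k \<le> of_nat m"
  proof -
    have "augmentation_cost G k = (\<Sum>b\<in>set xs. of_nat (k b) * costs G ! b)"
      unfolding augmentation_cost_def
      by (rule sum.mono_neutral_right) (use xs_items in \<open>auto simp: k_def items_def\<close>)
    also have "\<dots> = of_nat (\<Sum>b\<in>set xs. card {c \<in> {..<m}. X (U c) = b})"
      by (simp add: cost_xs k_def)
    also have "(\<Sum>b\<in>set xs. card {c \<in> {..<m}. X (U c) = b}) = card {..<m}"
      using X_xs lt by (intro card_x_sum) auto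
    finally show ?thesis by simp
  qed
  ultimately show ?thesis by blast
qed

end

section \<open>From 3-clauses to not-all-equal constraints\<close>

type_synonym literal = "bool \<times> nat"
type_synonym clause3 = "literal \<times> literal \<times> literal"

fun lit_true :: "(nat \<Rightarrow> bool) \<Rightarrow> literal \<Rightarrow> bool" where
  "lit_true \<nu> (s, v) = (\<nu> v = s)"

fun clause_true :: "(nat \<Rightarrow> bool) \<Rightarrow> clause3 \<Rightarrow> bool" where
  "clause_true \<nu> (l1, l2, l3) = (lit_true \<nu> l1 \<or> lit_true \<nu> l2 \<or> lit_true \<nu> l3)"

definition satisfiable :: "clause3 list \<Rightarrow> bool" where
  "satisfiable cls \<longleftrightarrow> (\<exists>\<nu>. \<forall>cl\<in>set cls. clause_true \<nu> cl)"

fun clause_vars :: "clause3 \<Rightarrow> nat set" where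
  "clause_vars (l1, l2, l3) = {snd l1, snd l2, snd l3}"

text \<open>
  Residues modulo 12: 0 and 1 are the two literals of a variable, 2 and 3 the auxiliary variable
  of a clause and its negation, and the other even and odd residues are the first and the
  last choices in the gadgets. Item 0 stands for the constant False.
\<close>

fun lit_item :: "literal \<Rightarrow> nat" where
  "lit_item (s, v) = 12 * v + (if s then 0 else 1)"

text \<open>A constraint is a tuple of first choice, last choice and three variable items. With
  \<open>p\<close> for item \<open>12 * c + 2\<close> and \<open>p'\<close> for item
  \<open>12 * c + 3\<close>, the three constraints are on (l1, l2, p), (p', l3, False) and (p, p,
  p'). The last one makes \<open>p'\<close> the negation of \<open>p\<close>; the first two can then
  be met for some \<open>p\<close> exactly when one of the literals differs from the
  constant.\<close>

fun clause_triples :: "nat \<Rightarrow> clause3 \<Rightarrow> (nat \<times> nat \<times> nat \<times> nat \<times> nat) list" where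
  "clause_triples c (l1, l2, l3) =
     [(12 * c + 6, 12 * c + 7, lit_item l1, lit_item l2, 12 * c + 2),
      (12 * c + 8, 12 * c + 9, 12 * c + 3, lit_item l3, 0),
      (12 * c + 10, 12 * c + 11, 12 * c + 2, 12 * c + 2, 12 * c + 3)]"

definition var_triple :: "nat \<Rightarrow> nat \<times> nat \<times> nat \<times> nat \<times> nat" where
  "var_triple v = (12 * v + 4, 12 * v + 5, 12 * v, 12 * v, 12 * v + 1)"

fun triple_prefs :: "nat \<times> nat \<times> nat \<times> nat \<times> nat \<Rightarrow> pref_list list" where
  "triple_prefs (f, z, x, y, w) = [[[f], [x], [z]], [[f], [y], [z]], [[f], [w], [z]]]"

text \<open>Clause gadgets stand in the order in which the clauses are generated. Variables are
  listed downwards, because a loop that counts a register down writes them.\<close>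

definition sat_triples :: "nat \<Rightarrow> clause3 list \<Rightarrow> (nat \<times> nat \<times> nat \<times> nat \<times> nat) list" where
  "sat_triples V cls =
     concat (map (\<lambda>c. clause_triples c (cls ! c)) [0..<length cls]) @ map var_triple (rev [0..<V])"

definition sat_owners :: "nat \<Rightarrow> clause3 list \<Rightarrow> nat list" where
  "sat_owners V cls =
     concat (map (\<lambda>v. [12 * v, 12 * v + 1]) (rev [0..<V])) @
     concat (map (\<lambda>c. [12 * c + 2, 12 * c + 3]) (rev [0..<length cls]))"

text \<open>One period of the costs modulo 12: residues 0 to 3 are literals and auxiliary variables,
  the others are first and last choices.\<close>

definition cost_block :: "rat list" where
  "cost_block = [1, 1, 1, 1, 2, 2, 2, 2, 2, 2, 2, 2]"

text \<open>The costs consist of one block per variable and one per clause, which two countdowns can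
  write. This covers all item numbers in use; an item on no list is never assigned to
  anybody.\<close>

definition sat_instance :: "nat \<Rightarrow> clause3 list \<Rightarrow> aug_instance" where
  "sat_instance V cls =
     \<lparr>prefs = concat (map triple_prefs (sat_triples V cls)) @ map (\<lambda>x. [[x]]) (sat_owners V cls),
      costs = concat (replicate (V + length cls) cost_block)\<rparr>"

section \<open>Item numbers and their residues\<close>

lemma length_concat_blocks:
  "(\<And>b. b \<in> set bs \<Longrightarrow> length b = k) \<Longrightarrow> length (concat bs) = k * length bs"
  by (induction bs) auto

lemma nth_concat_blocks:
  assumes "\<And>b. b \<in> set bs \<Longrightarrow> length b = k" "i < k * length bs"
  shows "concat bs ! i = bs ! (i div k) ! (i mod k)"
  using assms
proof (induction bs arbitrary: i)
  case (Cons b bs)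
  show ?case
  proof (cases "i < k")
    case True
    then show ?thesis using Cons.prems(1)[of b] by (simp add: nth_append)
  next
    case False
    then have "0 < k" using Cons.prems(2) by (cases k) auto
    with False have "i div k = Suc ((i - k) div k)" "i mod k = (i - k) mod k"
      by (auto simp: le_div_geq le_mod_geq)
    moreover have "concat bs ! (i - k) = bs ! ((i - k) div k) ! ((i - k) mod k)"
      using Cons.prems False by (intro Cons.IH) auto
    ultimately show ?thesis
      using False Cons.prems(1)[of b] by (simp add: nth_append)
  qed
qed simp

lemma length_sat_triples: "length (sat_triples V cls) = V + 3 * length cls"
proof -
  have l3: "length (clause_triples c cl) = 3" for c cl by (cases cl rule: prod_cases3) simp
  show ?thesis
    unfolding sat_triples_def by (subst length_append, subst length_concat_blocks[of _ 3]) (auto simp: l3)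
qed

lemma distinct_sat_owners: "distinct (sat_owners V cls)"
proof -
  have "distinct (concat (map (\<lambda>v. [12 * v, 12 * v + 1]) (rev [0..<n])))"
    "distinct (concat (map (\<lambda>v. [12 * v + 2, 12 * v + 3]) (rev [0..<n])))" for n :: nat
    by (induction n) auto
  moreover have "12 * v \<noteq> 12 * c + 2" "12 * v \<noteq> 12 * c + 3"
    "12 * v + 1 \<noteq> 12 * c + 2" "12 * v + 1 \<noteq> 12 * c + 3" for v c :: nat
    by presburger+
  ultimately show ?thesis
    unfolding sat_owners_def by (subst distinct_append) auto
qed

lemma set_residue_blocks:
  assumes "r < k" "s < k"
  shows "set (concat (map (\<lambda>v. [k * v + r, k * v + s]) (rev [0..<n]))) = {x. x mod k \<in> {r, s} \<and> x div k < n}"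
proof (intro equalityI subsetI)
  fix x assume "x \<in> {x. x mod k \<in> {r, s} \<and> x div k < n}"
  moreover have "x = k * (x div k) + x mod k" by simp
  ultimately have "x div k \<in> set (rev [0..<n])" "x \<in> set [k * (x div k) + r, k * (x div k) + s]"
    by (simp, metis (no_types, lifting) insert_iff list.set(1,2) mem_Collect_eq singletonD)
  then show "x \<in> set (concat (map (\<lambda>v. [k * v + r, k * v + s]) (rev [0..<n])))"
    unfolding set_concat set_map by blast
qed (use assms in auto)

lemma set_sat_owners:
  "set (sat_owners V cls) = {x. x mod 12 \<in> {0, 1} \<and> x div 12 < V \<or> x mod 12 \<in> {2, 3} \<and> x div 12 < length cls}"
proof -
  have "set (sat_owners V cls) = {x. x mod 12 \<in> {0, 1} \<and> x div 12 < V} \<union> {x. x mod 12 \<in> {2, 3} \<and> x div 12 < length cls}"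
    unfolding sat_owners_def set_append
    using set_residue_blocks[of 0 12 1 V, unfolded add_0_right] set_residue_blocks[of 2 12 3 "length cls"]
    by (intro arg_cong2[where f = "(\<union>)"]) simp_all
  then show ?thesis by (simp only: Collect_disj_eq)
qed

text \<open>Variable 0 is excluded because its positive literal would be item 0, the constant
  False.\<close>

definition well_formed_clauses :: "nat \<Rightarrow> clause3 list \<Rightarrow> bool" where
  "well_formed_clauses V cls \<longleftrightarrow> (\<forall>cl\<in>set cls. clause_vars cl \<subseteq> {1..<V})"

lemma sat_triple_cases:
  assumes "t \<in> set (sat_triples V cls)"
  obtains (clause) c where "c < length cls" "t \<in> set (clause_triples c (cls ! c))"
  | (var) v where "v < V" "t = var_triple v"
  using assms by (auto simp: sat_triples_def)

text \<open>The blocks of the master list: 0 for first choices, 1 for variable items, 2 for last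
  choices.\<close>

definition item_class :: "nat \<Rightarrow> nat" where
  "item_class b = (if b mod 12 < 4 then 1 else if even b then 0 else 2)"

lemma lit_item_class: "item_class (lit_item l) = 1"
  by (cases l) (simp add: item_class_def)

lemma lit_item_owner: "snd l < V \<Longrightarrow> lit_item l \<in> set (sat_owners V cls)"
  by (cases l) (simp add: set_sat_owners)

lemma sat_triple_items:
  assumes wfc: "well_formed_clauses V cls" and V: "0 < V" and t: "(f, z, x, y, w) \<in> set (sat_triples V cls)"
  shows "item_class f = 0" "item_class z = 2" "{x, y, w} \<subseteq> set (sat_owners V cls)"
    "f < 12 * (V + length cls)" "z < 12 * (V + length cls)"
    "item_class ` {x, y, w} = {1}"
proof -
  have mods: "(12 * c + 2) mod 12 = 2" "(12 * c + 3) mod 12 = 3" "(12 * c) mod 12 = 0" "(12 * c + 1) mod 12 = 1" for c :: nat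
    by presburger+
  have cl: "item_class (12 * c + 6) = 0" "item_class (12 * c + 7) = 2" "item_class (12 * c + 8) = 0"
    "item_class (12 * c + 9) = 2" "item_class (12 * c + 10) = 0" "item_class (12 * c + 11) = 2"
    "item_class (12 * c + 4) = 0" "item_class (12 * c + 5) = 2" "item_class (12 * c + 2) = 1"
    "item_class (12 * c + 3) = 1" "item_class (12 * c) = 1" "item_class (12 * c + 1) = 1" for c
    unfolding item_class_def by presburger+
  have cl0: "item_class 0 = 1" by (simp add: item_class_def)
  have divs: "(12 * c + 2) div 12 = c" "(12 * c + 3) div 12 = c" "(12 * c) div 12 = c" "(12 * c + 1) div 12 = c" for c :: nat
    by presburger+
  have "item_class f = 0 \<and> item_class z = 2 \<and> {x, y, w} \<subseteq> set (sat_owners V cls) \<and>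
    f < 12 * (V + length cls) \<and> z < 12 * (V + length cls) \<and> item_class ` {x, y, w} = {1}"
    using t
  proof (cases rule: sat_triple_cases)
    case (clause c)
    obtain l1 l2 l3 where l: "cls ! c = (l1, l2, l3)" by (metis surj_pair)
    have "snd l1 < V" "snd l2 < V" "snd l3 < V"
      using wfc clause(1) l nth_mem[OF clause(1)] by (force simp: well_formed_clauses_def)+
    moreover have "(0::nat) \<in> set (sat_owners V cls)" using V by (simp add: set_sat_owners)
    moreover have "12 * c + 2 \<in> set (sat_owners V cls)" "12 * c + 3 \<in> set (sat_owners V cls)"
      using clause(1) unfolding set_sat_owners mem_Collect_eq mods divs by simp_all
    ultimately show ?thesis
      using clause l lit_item_owner[of _ V cls] lit_item_class cl cl0
      by (simp del: One_nat_def add_2_eq_Suc') (elim disjE; simp del: One_nat_def add_2_eq_Suc')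
  next
    case (var v)
    then have "12 * v \<in> set (sat_owners V cls)" "12 * v + 1 \<in> set (sat_owners V cls)"
      unfolding set_sat_owners mem_Collect_eq mods divs by simp_all
    then show ?thesis using var cl[of v]
      by (simp add: var_triple_def del: One_nat_def)
  qed
  then show "item_class f = 0" "item_class z = 2" "{x, y, w} \<subseteq> set (sat_owners V cls)"
    "f < 12 * (V + length cls)" "z < 12 * (V + length cls)"
    "item_class ` {x, y, w} = {1}"
    by blast+
qed

lemma distinct_sat_triples:
  "distinct (map fst (sat_triples V cls))" "distinct (map (fst \<circ> snd) (sat_triples V cls))"
proof -
  have 1: "map fst (clause_triples c cl) = [12 * c + 6, 12 * c + 8, 12 * c + 10]"
    "map (fst \<circ> snd) (clause_triples c cl) = [12 * c + 7, 12 * c + 9, 12 * c + 11]" for c cl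
    by (cases cl, simp)+
  have 2: "distinct (concat (map (\<lambda>c. [12 * c + 6, 12 * c + 8, 12 * c + 10]) [0..<n]))"
    "distinct (concat (map (\<lambda>c. [12 * c + 7, 12 * c + 9, 12 * c + 11]) [0..<n]))" for n :: nat
    by (induction n) (auto; presburger)+
  have 3: "map fst (sat_triples V cls) = concat (map (\<lambda>c. [12 * c + 6, 12 * c + 8, 12 * c + 10]) [0..<length cls]) @
      map (\<lambda>v. 12 * v + 4) (rev [0..<V])"
    "map (fst \<circ> snd) (sat_triples V cls) = concat (map (\<lambda>c. [12 * c + 7, 12 * c + 9, 12 * c + 11]) [0..<length cls]) @
      map (\<lambda>v. 12 * v + 5) (rev [0..<V])"
    unfolding sat_triples_def by (simp_all add: map_concat o_def 1[unfolded o_def] var_triple_def)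
  show "distinct (map fst (sat_triples V cls))"
    unfolding 3 by (subst distinct_append) (use 2 in \<open>auto simp: distinct_map inj_on_def; presburger\<close>)
  show "distinct (map (fst \<circ> snd) (sat_triples V cls))"
    unfolding 3 by (subst distinct_append) (use 2 in \<open>auto simp: distinct_map inj_on_def; presburger\<close>)
qed

lemma length_sat_costs: "length (costs (sat_instance V cls)) = 12 * (V + length cls)"
proof -
  have "length (concat (replicate (V + length cls) cost_block)) = 12 * length (replicate (V + length cls) cost_block)"
    by (rule length_concat_blocks) (simp add: cost_block_def)
  then show ?thesis by (simp add: sat_instance_def)
qed

lemma nth_sat_costs:
  assumes "b < 12 * (V + length cls)"
  shows "costs (sat_instance V cls) ! b = (if item_class b = 1 then 1 else 2)"
proof -
  have "costs (sat_instance V cls) ! b = replicate (V + length cls) cost_block ! (b div 12) ! (b mod 12)"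
    unfolding sat_instance_def aug_instance.simps using assms
    by (intro nth_concat_blocks) (auto simp: cost_block_def)
  also have "\<dots> = cost_block ! (b mod 12)"
    using assms by (subst nth_replicate) auto
  also have "\<dots> = (if item_class b = 1 then 1 else 2)"
  proof -
    have "cost_block ! r = (if r < 4 then 1 else 2)" if "r < 12" for r
    proof -
      have "r \<in> set [0..<12]" using that by simp
      moreover have "\<forall>r\<in>set [0..<12]. cost_block ! r = (if r < 4 then 1 else 2)"
        by (simp add: cost_block_def upt_rec numeral_eq_Suc)
      ultimately show ?thesis by blast
    qed
    then show ?thesis by (simp add: item_class_def)
  qed
  finally show ?thesis .
qed

lemma length_prefs_triples: "length (concat (map triple_prefs ts)) = 3 * length ts"
proof -
  have "length (triple_prefs t) = 3" for t by (cases t) simp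
  then show ?thesis by (subst length_concat_blocks[of _ 3]) auto
qed

definition nae_assignment :: "(nat \<Rightarrow> bool) \<Rightarrow> (nat \<times> nat \<times> nat \<times> nat \<times> nat) list \<Rightarrow> bool" where
  "nae_assignment \<tau> ts \<longleftrightarrow> (\<forall>f z x y w. (f, z, x, y, w) \<in> set ts \<longrightarrow> \<not> (\<tau> x = \<tau> y \<and> \<tau> y = \<tau> w))"

section \<open>Satisfiability and the augmentation instance\<close>

context
  fixes V :: nat and cls :: "clause3 list"
  assumes wfc: "well_formed_clauses V cls" and V: "0 < V"
begin

lemma sat_instance_nae:
  "nae_instance (sat_instance V cls) (V + 3 * length cls)
     (\<lambda>c. fst (sat_triples V cls ! c)) (\<lambda>c. fst (snd (sat_triples V cls ! c)))
     (\<lambda>a. case sat_triples V cls ! (a div 3) of (f, z, x, y, w) \<Rightarrow> [x, y, w] ! (a mod 3))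
     (sat_owners V cls)"
    (is "nae_instance ?G ?m ?F ?Z ?X ?xs")
proof
  let ?ts = "sat_triples V cls"
  have len: "length ?ts = ?m" by (rule length_sat_triples)
  have ts: "(?F c, ?Z c, snd (snd (?ts ! c))) \<in> set ?ts" if "c < ?m" for c
    using that len by (metis nth_mem prod.collapse)
  have F: "item_class (?F c) = 0" "?F c < 12 * (V + length cls)" if "c < ?m" for c
    using sat_triple_items[OF wfc V] ts[OF that] by (metis surj_pair)+
  have Z: "item_class (?Z c) = 2" "?Z c < 12 * (V + length cls)" if "c < ?m" for c
    using sat_triple_items[OF wfc V] ts[OF that] by (metis surj_pair)+
  have xs: "item_class x = 1" "x < 12 * (V + length cls)" if "x \<in> set ?xs" for x
    using that by (auto simp: set_sat_owners item_class_def)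
  have mod3: "a mod 3 = 0 \<or> a mod 3 = 1 \<or> a mod 3 = 2" for a :: nat by auto
  have items: "items ?G = {..<12 * (V + length cls)}"
    unfolding items_def length_sat_costs ..
  show "length (prefs ?G) = 3 * ?m + length ?xs"
    by (simp add: sat_instance_def length_prefs_triples len)
  show "prefs ?G ! a = [[?F (a div 3)], [?X a], [?Z (a div 3)]]" if "a < 3 * ?m" for a
  proof -
    have l3: "length (triple_prefs t) = 3" for t by (cases t) simp
    have "prefs ?G ! a = concat (map triple_prefs ?ts) ! a"
      using that by (simp add: sat_instance_def nth_append length_prefs_triples len)
    also have "\<dots> = map triple_prefs ?ts ! (a div 3) ! (a mod 3)"
      using that l3 by (intro nth_concat_blocks) (auto simp: len)
    also have "\<dots> = triple_prefs (?ts ! (a div 3)) ! (a mod 3)"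
      using that len by (subst nth_map) auto
    also have "\<dots> = [[?F (a div 3)], [?X a], [?Z (a div 3)]]"
      using mod3[of a] by (cases "?ts ! (a div 3)") (auto simp: numeral_2_eq_2)
    finally show ?thesis .
  qed
  show "prefs ?G ! (3 * ?m + j) = [[?xs ! j]]" if "j < length ?xs" for j
    using that by (simp add: sat_instance_def nth_append length_prefs_triples len)
  show "distinct ?xs" by (rule distinct_sat_owners)
  show "inj_on ?F {..<?m}"
    using distinct_sat_triples(1)[of V cls] len by (auto simp: inj_on_def distinct_conv_nth)
  show "inj_on ?Z {..<?m}"
    using distinct_sat_triples(2)[of V cls] len by (auto simp: inj_on_def distinct_conv_nth)
  show "?F c \<noteq> ?Z c'" if "c < ?m" "c' < ?m" for c c'
    using F(1)[OF that(1)] Z(1)[OF that(2)] by auto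
  show "?F c \<notin> set ?xs" if "c < ?m" for c using F(1)[OF that] xs(1) by force
  show "?Z c \<notin> set ?xs" if "c < ?m" for c using Z(1)[OF that] xs(1) by force
  show "?X a \<in> set ?xs" if "a < 3 * ?m" for a
  proof -
    have "a div 3 < ?m" using that by auto
    moreover obtain f z x y w where "?ts ! (a div 3) = (f, z, x, y, w)" by (metis surj_pair)
    ultimately show ?thesis
      using sat_triple_items(3)[OF wfc V, of f z x y w] mod3[of a] len nth_mem[of "a div 3" ?ts]
      by (auto simp: numeral_2_eq_2)
  qed
  show "?F c \<in> items ?G" "?Z c \<in> items ?G" if "c < ?m" for c
    using F(2)[OF that] Z(2)[OF that] by (auto simp: items)
  show "set ?xs \<subseteq> items ?G" using xs by (auto simp: items)
  show "costs ?G ! ?F c = 2" "costs ?G ! ?Z c = 2" if "c < ?m" for c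
    using F[OF that] Z[OF that] by (simp_all add: nth_sat_costs)
  show "costs ?G ! x = 1" if "x \<in> set ?xs" for x
    using xs[OF that] by (simp add: nth_sat_costs)
  show "0 \<le> r" if "r \<in> set (costs ?G)" for r
    proof -
    have "\<forall>r\<in>set cost_block. 0 \<le> r" by (simp add: cost_block_def)
    moreover have "r \<in> set cost_block" using that by (auto simp: sat_instance_def split: if_splits)
    ultimately show ?thesis by blast
  qed
qed

lemma sat_instance_prefs_cases:
  assumes "l \<in> set (prefs (sat_instance V cls))"
  obtains (triple) f z x y w p where "(f, z, x, y, w) \<in> set (sat_triples V cls)" "p \<in> {x, y, w}" "l = [[f], [p], [z]]"
  | (owner) x where "x \<in> set (sat_owners V cls)" "l = [[x]]"
proof -
  consider (1) "l \<in> set (concat (map triple_prefs (sat_triples V cls)))" | (2) "l \<in> (\<lambda>x. [[x]]) ` set (sat_owners V cls)"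
    using assms by (auto simp: sat_instance_def)
  then show thesis
  proof cases
    case 1
    then obtain t where t: "t \<in> set (sat_triples V cls)" "l \<in> set (triple_prefs t)" by auto
    obtain f z x y w where "t = (f, z, x, y, w)" by (metis surj_pair)
    then show thesis using t triple[of f z x y w] by auto
  next
    case 2
    then show thesis using owner by auto
  qed
qed

lemma sat_instance_strict: "strict_prefs (sat_instance V cls)"
  unfolding strict_prefs_def strict_pref_list_def by (auto elim!: sat_instance_prefs_cases)

lemma sat_instance_length: "max_list_length 3 (sat_instance V cls)"
  unfolding max_list_length_def by (auto elim!: sat_instance_prefs_cases)

lemma sat_instance_master: "from_master_list (sat_instance V cls)"
proof -
  let ?G = "sat_instance V cls"
  define r where "r = {(a, b). a \<in> items ?G \<and> b \<in> items ?G \<and>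
     (item_class a < item_class b \<or> item_class a = item_class b \<and> a \<le> b)}"
  have "linear_order_on (items ?G) r"
    unfolding linear_order_on_def partial_order_on_def preorder_on_def total_on_def
    by (auto simp: r_def refl_on_def intro!: transI antisymI)
  moreover have "ranks_before l b b'"
    if l: "l \<in> set (prefs ?G)" and b: "b \<in> listed l" "b' \<in> listed l" "b \<noteq> b' \<and> (b, b') \<in> r" for l b b'
    using l
  proof (cases rule: sat_instance_prefs_cases)
    case (triple f z x y w p)
    have "item_class p = 1" using sat_triple_items(6)[OF wfc V triple(1)] triple(2) by blast
    then show ?thesis
      using triple sat_triple_items(1,2)[OF wfc V triple(1)] b
      by (auto simp: ranks_before_triple r_def listed_def)
  next
    case (owner x)
    then show ?thesis using b by (auto simp: listed_def)
  qed
  ultimately show ?thesis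
    unfolding from_master_list_def using sat_instance_strict by (auto simp: strict_prefs_def)
qed

text \<open>Complementing all values preserves the constraints, so item 0 may come out true; a
  literal therefore counts as true when its item differs from item 0. In the other direction the
  valuation is chosen so that item 0 is false.\<close>

lemma satisfiable_iff_nae:
  "satisfiable cls \<longleftrightarrow> (\<exists>\<tau>. nae_assignment \<tau> (sat_triples V cls))"
proof
  assume "satisfiable cls"
  then obtain \<nu> where \<nu>: "\<And>cl. cl \<in> set cls \<Longrightarrow> clause_true \<nu> cl" by (auto simp: satisfiable_def)
  \<comment> \<open>No clause contains variable 0, so it can be reset to provide the constant
    False.\<close>
  define \<mu> where "\<mu> = \<nu>(0 := False)"
  \<comment> \<open>The auxiliary variable is true when neither of the first two literals is, which
    leaves the clause to the third one.\<close>
  define aux where "aux c = (case cls ! c of (l1, l2, l3) \<Rightarrow> \<not> (lit_true \<mu> l1 \<or> lit_true \<mu> l2))" for c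
  define \<tau> where "\<tau> b = (if b mod 12 = 0 then \<mu> (b div 12) else if b mod 12 = 1 then \<not> \<mu> (b div 12)
     else if b mod 12 = 2 then aux (b div 12) else \<not> aux (b div 12))" for b
  have lit: "\<tau> (lit_item l) = lit_true \<mu> l" for l
  proof -
    have "(12 * b + 1) div 12 = b" "(12 * b + 1) mod 12 = 1" for b :: nat by presburger+
    then show ?thesis by (cases l) (auto simp: \<tau>_def)
  qed
  have 2: "\<tau> (12 * c + 2) = aux c" and 3: "\<tau> (12 * c + 3) = (\<not> aux c)" for c
  proof -
    have "(12 * c + 2) mod 12 = 2" "(12 * c + 3) mod 12 = 3" "(12 * c + 2) div 12 = c" "(12 * c + 3) div 12 = c"
      by presburger+
    then show "\<tau> (12 * c + 2) = aux c" "\<tau> (12 * c + 3) = (\<not> aux c)" by (simp_all add: \<tau>_def)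
  qed
  have "\<not> (\<tau> x = \<tau> y \<and> \<tau> y = \<tau> w)" if t: "(f, z, x, y, w) \<in> set (sat_triples V cls)" for f z x y w
    using t
  proof (cases rule: sat_triple_cases)
    case (clause c)
    obtain l1 l2 l3 where cl: "cls ! c = (l1, l2, l3)" by (metis surj_pair)
    then have mem: "(l1, l2, l3) \<in> set cls" using nth_mem[OF clause(1)] by simp
    then have "0 \<notin> {snd l1, snd l2, snd l3}" using wfc by (force simp: well_formed_clauses_def)
    then have "lit_true \<mu> l = lit_true \<nu> l" if "l \<in> {l1, l2, l3}" for l
      using that by (cases l) (auto simp: \<mu>_def)
    then have "lit_true \<mu> l1 \<or> lit_true \<mu> l2 \<or> lit_true \<mu> l3" using \<nu>[OF mem] by simp
    moreover have "aux c = (\<not> (lit_true \<mu> l1 \<or> lit_true \<mu> l2))" by (simp add: aux_def cl)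
    moreover have "\<tau> 0 = False" by (simp add: \<tau>_def \<mu>_def)
    ultimately show ?thesis
      using clause(2) cl 2[of c] 3[of c] lit[of l1] lit[of l2] lit[of l3] by auto
  next
    case (var v)
    then show ?thesis using lit[of "(True, v)"] lit[of "(False, v)"] by (auto simp: var_triple_def)
  qed
  then show "\<exists>\<tau>. nae_assignment \<tau> (sat_triples V cls)"
    unfolding nae_assignment_def by (intro exI[of _ \<tau>]) simp
next
  assume "\<exists>\<tau>. nae_assignment \<tau> (sat_triples V cls)"
  then obtain \<tau> where "nae_assignment \<tau> (sat_triples V cls)" ..
  then have \<tau>: "\<not> (\<tau> x = \<tau> y \<and> \<tau> y = \<tau> w)" if "(f, z, x, y, w) \<in> set (sat_triples V cls)" for f z x y w
    using that unfolding nae_assignment_def by blast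
  define \<nu> where "\<nu> v = (\<tau> (12 * v) \<noteq> \<tau> 0)" for v
  have lit: "lit_true \<nu> l = (\<tau> (lit_item l) \<noteq> \<tau> 0)" if "snd l < V" for l
  proof -
    have "var_triple (snd l) \<in> set (sat_triples V cls)" using that by (simp add: sat_triples_def)
    then have "\<tau> (12 * snd l + 1) \<noteq> \<tau> (12 * snd l)" using \<tau> unfolding var_triple_def by blast
    then show ?thesis by (cases l) (auto simp: \<nu>_def)
  qed
  have "clause_true \<nu> cl" if cl: "cl \<in> set cls" for cl
  proof -
    obtain c where c: "c < length cls" "cls ! c = cl" using cl by (auto simp: in_set_conv_nth)
    obtain l1 l2 l3 where l: "cl = (l1, l2, l3)" by (metis surj_pair)
    have "set (clause_triples c cl) \<subseteq> set (sat_triples V cls)" using c by (auto simp: sat_triples_def)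
    then have sub: "(12 * c + 6, 12 * c + 7, lit_item l1, lit_item l2, 12 * c + 2) \<in> set (sat_triples V cls)"
      "(12 * c + 8, 12 * c + 9, 12 * c + 3, lit_item l3, 0) \<in> set (sat_triples V cls)"
      "(12 * c + 10, 12 * c + 11, 12 * c + 2, 12 * c + 2, 12 * c + 3) \<in> set (sat_triples V cls)"
      unfolding l clause_triples.simps list.set by simp_all
    have v: "snd l1 < V" "snd l2 < V" "snd l3 < V"
      using wfc cl l by (force simp: well_formed_clauses_def)+
    \<comment> \<open>Here \<open>e\<close> is the value of the constant, \<open>r\<close> and
      \<open>r'\<close> are those of the auxiliary variable and its negation, and \<open>p\<close>,
      \<open>q\<close>, \<open>s\<close> those of the literals.\<close>
    have *: "\<not> (p = q \<and> q = r) \<Longrightarrow> \<not> (r' = s \<and> s = e) \<Longrightarrow> \<not> (r = r \<and> r = r') \<Longrightarrow> p \<noteq> e \<or> q \<noteq> e \<or> s \<noteq> e"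
      for p q r r' s e :: bool
      by (cases p; cases q; cases s; cases r; simp)
    show ?thesis
      unfolding l clause_true.simps lit[OF v(1)] lit[OF v(2)] lit[OF v(3)]
      by (rule *[OF \<tau>[OF sub(1)] \<tau>[OF sub(2)] \<tau>[OF sub(3)]])
  qed
  then show "satisfiable cls" unfolding satisfiable_def by blast
qed

text \<open>The budget is the number of constraints, one per variable and three per clause.\<close>

lemma sat_instance_correct:
  "satisfiable cls \<longleftrightarrow>
    (\<exists>k. feasible_augmentation (sat_instance V cls) k \<and>
         augmentation_cost (sat_instance V cls) k \<le> of_nat (V + 3 * length cls))"
proof -
  interpret nae_instance "sat_instance V cls" "V + 3 * length cls"
     "\<lambda>c. fst (sat_triples V cls ! c)" "\<lambda>c. fst (snd (sat_triples V cls ! c))"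
     "\<lambda>a. case sat_triples V cls ! (a div 3) of (f, z, x, y, w) \<Rightarrow> [x, y, w] ! (a mod 3)"
     "sat_owners V cls"
    by (rule sat_instance_nae)
  let ?X = "\<lambda>a. case sat_triples V cls ! (a div 3) of (f, z, x, y, w) \<Rightarrow> [x, y, w] ! (a mod 3)"
  have X: "?X ` {a. a div 3 = c} = {x, y, w}" if "sat_triples V cls ! c = (f, z, x, y, w)" for c f z x y w
  proof -
    have "(3 * c + 1) div 3 = c" "(3 * c + 1) mod 3 = 1" "(3 * c + 2) div 3 = c" "(3 * c + 2) mod 3 = 2"
      by presburger+
    then show ?thesis using that unfolding div_3_fibre image_insert by (simp add: insert_commute)
  qed
  show ?thesis
  proof
    assume sat: "satisfiable cls"
    obtain \<tau> where nae: "nae_assignment \<tau> (sat_triples V cls)"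
      using iffD1[OF satisfiable_iff_nae sat] ..
    have \<tau>: "\<not> (\<tau> x = \<tau> y \<and> \<tau> y = \<tau> w)" if "(f, z, x, y, w) \<in> set (sat_triples V cls)" for f z x y w
      using nae that unfolding nae_assignment_def by blast
    show "\<exists>k. feasible_augmentation (sat_instance V cls) k \<and>
         augmentation_cost (sat_instance V cls) k \<le> of_nat (V + 3 * length cls)"
    proof (rule nae_imp_feasible)
      fix c assume c: "c < V + 3 * length cls"
      obtain f z x y w where t: "sat_triples V cls ! c = (f, z, x, y, w)" by (metis surj_pair)
      then have "\<not> (\<tau> x = \<tau> y \<and> \<tau> y = \<tau> w)" using \<tau> c by (metis length_sat_triples nth_mem)
      then have "\<exists>p\<in>{x, y, w}. \<exists>q\<in>{x, y, w}. \<tau> p \<and> \<not> \<tau> q" by auto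
      then show "\<exists>a b. a div 3 = c \<and> b div 3 = c \<and> \<tau> (?X a) \<and> \<not> \<tau> (?X b)"
        unfolding X[OF t, symmetric] by blast
    qed
  next
    assume "\<exists>k. feasible_augmentation (sat_instance V cls) k \<and>
         augmentation_cost (sat_instance V cls) k \<le> of_nat (V + 3 * length cls)"
    then obtain k where k: "feasible_augmentation (sat_instance V cls) k"
      "augmentation_cost (sat_instance V cls) k \<le> of_nat (V + 3 * length cls)" by blast
    have "\<not> ((0 < k x) = (0 < k y) \<and> (0 < k y) = (0 < k w))" if t: "(f, z, x, y, w) \<in> set (sat_triples V cls)" for f z x y w
    proof -
      obtain c where c: "c < V + 3 * length cls" "sat_triples V cls ! c = (f, z, x, y, w)"
        using t by (auto simp: in_set_conv_nth length_sat_triples)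
      have "\<exists>p\<in>{x, y, w}. \<exists>q\<in>{x, y, w}. 0 < k p \<and> k q = 0"
        unfolding X[OF c(2), symmetric] using feasible_imp_nae[OF k c(1)] by blast
      then show ?thesis by auto
    qed
    then show "satisfiable cls"
      by (intro iffD2[OF satisfiable_iff_nae] exI[of _ "\<lambda>x. 0 < k x"]) (simp add: nae_assignment_def)
  qed
qed

lemma sat_instance_wf: "wf_aug_instance (sat_instance V cls)"
  using nae_instance.wf[OF sat_instance_nae] .

lemma sat_instance_input:
  "enc_input (sat_instance V cls) (of_nat (V + 3 * length cls))
     \<in> inputs_satisfying (\<lambda>G. strict_prefs G \<and> max_list_length 3 G \<and> from_master_list G)"
  unfolding inputs_satisfying_def
  using sat_instance_wf sat_instance_strict sat_instance_length sat_instance_master of_nat_0_le_iff by blast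

text \<open>A word in the language is the code of some solvable input; that this input is the
  intended one follows from the injectivity of the encoding.\<close>

lemma sat_instance_reduction:
  "enc_input (sat_instance V cls) (of_nat (V + 3 * length cls)) \<in> MIN_COST_AUGMENTATION \<longleftrightarrow> satisfiable cls"
proof
  assume "enc_input (sat_instance V cls) (of_nat (V + 3 * length cls)) \<in> MIN_COST_AUGMENTATION"
  then obtain G K k where G: "enc_input (sat_instance V cls) (of_nat (V + 3 * length cls)) = enc_input G K"
    "wf_aug_instance G" "0 \<le> K" "feasible_augmentation G k" "augmentation_cost G k \<le> K"
    unfolding MIN_COST_AUGMENTATION_def by blast
  then have "sat_instance V cls = G \<and> of_nat (V + 3 * length cls) = K"
    using enc_input_inject[OF sat_instance_wf of_nat_0_le_iff G(2,3,1)] by simp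
  with G show "satisfiable cls" unfolding sat_instance_correct by blast
next
  assume "satisfiable cls"
  then show "enc_input (sat_instance V cls) (of_nat (V + 3 * length cls)) \<in> MIN_COST_AUGMENTATION"
    unfolding sat_instance_correct MIN_COST_AUGMENTATION_def
    using sat_instance_wf of_nat_0_le_iff by blast
qed

end

section \<open>Counter programs compiled to Turing machines\<close>

text \<open>Counters are tested only for zero, which a mark on cell 0 of a tape makes visible.
  \<open>InLoop c d\<close> consumes the remaining input, running \<open>c\<close> for a bit 0 and
  \<open>d\<close> for a bit 1.\<close>

datatype com = Skip | Out bool | Inc nat | Dec nat | Seq com com | While nat com | If nat com com
  | InLoop com com | Rewind

text \<open>Input head position, counters, output.\<close>

type_synonym counter_state = "nat \<times> (nat \<Rightarrow> nat) \<times> bool list"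

text \<open>The number in the relation is the exact number of steps of the compiled machine.
  \<open>Dec\<close> on an empty counter has no execution, since the head would pass the
  mark.\<close>

inductive exec :: "bool list \<Rightarrow> com \<Rightarrow> counter_state \<Rightarrow> nat \<Rightarrow> counter_state \<Rightarrow> bool" for x where
  exec_Skip: "exec x Skip s 1 s"
| exec_Out: "exec x (Out b) (h, R, w) 1 (h, R, w @ [b])"
| exec_Inc: "exec x (Inc r) (h, R, w) 1 (h, R(r := Suc (R r)), w)"
| exec_Dec: "R r = Suc m \<Longrightarrow> exec x (Dec r) (h, R, w) 1 (h, R(r := m), w)"
| exec_Seq: "exec x c s t s' \<Longrightarrow> exec x d s' t' s'' \<Longrightarrow> exec x (Seq c d) s (t + t') s''"
| exec_While_False: "R r = 0 \<Longrightarrow> exec x (While r c) (h, R, w) 1 (h, R, w)"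
| exec_While_True: "R r \<noteq> 0 \<Longrightarrow> exec x c (h, R, w) t s' \<Longrightarrow> exec x (While r c) s' t' s'' \<Longrightarrow>
    exec x (While r c) (h, R, w) (Suc (t + t')) s''"
| exec_If_True: "R r \<noteq> 0 \<Longrightarrow> exec x c (h, R, w) t s' \<Longrightarrow> exec x (If r c d) (h, R, w) (Suc t) s'"
| exec_If_False: "R r = 0 \<Longrightarrow> exec x d (h, R, w) t s' \<Longrightarrow> exec x (If r c d) (h, R, w) (Suc t) s'"
| exec_InLoop_end: "h = length x \<Longrightarrow> exec x (InLoop c d) (h, R, w) 1 (h, R, w)"
| exec_InLoop_step: "h < length x \<Longrightarrow> exec x (if x ! h then d else c) (h, R, w) t (h', R', w') \<Longrightarrow>
    exec x (InLoop c d) (Suc h', R', w') t' s'' \<Longrightarrow>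
    exec x (InLoop c d) (h, R, w) (Suc (t + Suc t')) s''"
| exec_Rewind: "h \<le> length x \<Longrightarrow> exec x Rewind (h, R, w) (h + 2) (0, R, w)"

fun regs :: "com \<Rightarrow> nat set" where
  "regs (Inc r) = {r}"
| "regs (Dec r) = {r}"
| "regs (Seq c d) = regs c \<union> regs d"
| "regs (While r c) = insert r (regs c)"
| "regs (If r c d) = insert r (regs c \<union> regs d)"
| "regs (InLoop c d) = regs c \<union> regs d"
| "regs _ = {}"

lemma finite_regs: "finite (regs c)"
  by (induction c) auto

fun code_size :: "com \<Rightarrow> nat" where
  "code_size (Seq c d) = code_size c + code_size d"
| "code_size (While r c) = Suc (code_size c)"
| "code_size (If r c d) = Suc (code_size c + code_size d)"
| "code_size (InLoop c d) = Suc (Suc (code_size c + code_size d))"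
| "code_size Rewind = 2"
| "code_size _ = 1"

lemma code_size_pos: "0 < code_size c"
  by (induction c) auto

text \<open>
  An instruction reads one tape and maps the symbol to the next address, the symbol written
  and the move. Counter \<open>r\<close> is the head position on tape \<open>r + 2\<close>, whose cell 0 carries the mark 1.
\<close>

type_synonym instr = "nat \<times> (nat \<Rightarrow> nat \<times> nat \<times> move)"

text \<open>\<open>a\<close> is the address of the code and \<open>e\<close> the address at which to
  continue; the body of a \<open>While\<close> has the loop test as its exit.\<close>

fun compile :: "com \<Rightarrow> nat \<Rightarrow> nat \<Rightarrow> instr list" where
  "compile Skip a e = [(0, \<lambda>s. (e, s, Move_Stay))]"
| "compile (Out b) a e = [(1, \<lambda>s. (e, if b then 2 else 1, Move_Right))]"
| "compile (Inc r) a e = [(r + 2, \<lambda>s. (e, s, Move_Right))]"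
| "compile (Dec r) a e = [(r + 2, \<lambda>s. (e, s, Move_Left))]"
| "compile (Seq c d) a e = compile c a (a + code_size c) @ compile d (a + code_size c) e"
| "compile (While r c) a e = (r + 2, \<lambda>s. (if s = 1 then e else a + 1, s, Move_Stay)) # compile c (a + 1) a"
| "compile (If r c d) a e = (r + 2, \<lambda>s. (if s = 1 then a + 1 + code_size c else a + 1, s, Move_Stay)) #
     compile c (a + 1) e @ compile d (a + 1 + code_size c) e"
| "compile (InLoop c d) a e =
     (0, \<lambda>s. (if s = 0 then e else if s = 1 then a + 2 else a + 2 + code_size c, s, Move_Stay)) #
     (0, \<lambda>s. (a, s, Move_Right)) # compile c (a + 2) (a + 1) @ compile d (a + 2 + code_size c) (a + 1)"
| "compile Rewind a e = [(0, \<lambda>s. (a + 1, s, Move_Left)),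
     (0, \<lambda>s. if s = 0 then (e, s, Move_Right) else (a + 1, s, Move_Left))]"

lemma length_compile: "length (compile c a e) = code_size c"
  by (induction c arbitrary: a e) auto

definition valid_instr :: "nat \<Rightarrow> nat \<Rightarrow> instr \<Rightarrow> bool" where
  "valid_instr k B i \<longleftrightarrow> fst i < k + 2 \<and> (\<forall>s<3. fst (snd i s) < B \<and> fst (snd (snd i s)) < 3)"

lemma valid_compile:
  assumes "regs c \<subseteq> {..<k}" "e < B" "a + code_size c \<le> B"
  shows "\<forall>i\<in>set (compile c a e). valid_instr k B i"
  using assms
proof (induction c arbitrary: a e)
  case (Seq c d)
  then have "\<forall>i\<in>set (compile c a (a + code_size c)). valid_instr k B i"
    "\<forall>i\<in>set (compile d (a + code_size c) e). valid_instr k B i"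
    using code_size_pos[of d] by (intro Seq.IH; auto)+
  then show ?case by auto
next
  case (While r c)
  have "\<forall>i\<in>set (compile c (a + 1) a). valid_instr k B i"
    using While.prems by (intro While.IH) auto
  then show ?case using While.prems code_size_pos[of c] by (auto simp: valid_instr_def)
next
  case (If r c d)
  have "\<forall>i\<in>set (compile c (a + 1) e). valid_instr k B i" "\<forall>i\<in>set (compile d (a + 1 + code_size c) e). valid_instr k B i"
    using If.prems by (intro If.IH; auto)+
  then show ?case using If.prems code_size_pos[of c] code_size_pos[of d] by (auto simp: valid_instr_def)
next
  case (InLoop c d)
  have "\<forall>i\<in>set (compile c (a + 2) (a + 1)). valid_instr k B i"
    "\<forall>i\<in>set (compile d (a + 2 + code_size c) (a + 1)). valid_instr k B i"
    using InLoop.prems by (intro InLoop.IH; auto)+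
  then show ?case using InLoop.prems code_size_pos[of c] code_size_pos[of d] by (auto simp: valid_instr_def)
qed (auto simp: valid_instr_def)

definition run_instr :: "instr \<Rightarrow> nat list \<Rightarrow> nat \<times> (nat \<times> move) list" where
  "run_instr i ss = (case snd i (ss ! fst i) of (q, w, d) \<Rightarrow>
     (q, (map (\<lambda>s. (s, Move_Stay)) ss)[fst i := (w, d)]))"

text \<open>Two placeholders align addresses with states: 0 is the start state, which the machine
  treats separately, and 1 is the halting state.\<close>

definition program :: "com \<Rightarrow> instr list" where
  "program c = [(0, \<lambda>s. (1, s, Move_Stay)), (0, \<lambda>s. (1, s, Move_Stay))] @ compile c 2 1"

text \<open>All tapes but the first are blank at the beginning, so the start state has to write the
  mark on every counter tape.\<close>

definition compiled_tm :: "nat \<Rightarrow> com \<Rightarrow> tm" where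
  "compiled_tm k c = \<lparr>tapes = k + 2, symbols = 3, states = length (program c),
     delta = (\<lambda>q ss. if q = 0 then (2, (ss ! 0, Move_Stay) # (ss ! 1, Move_Stay) # replicate k (1, Move_Stay))
        else run_instr (program c ! q) ss)\<rparr>"

lemma wf_compiled_tm:
  assumes "regs c \<subseteq> {..<k}"
  shows "wf_tm (compiled_tm k c)"
proof -
  have len: "length (program c) = 2 + code_size c"
    by (simp add: program_def length_compile)
  have valid: "valid_instr k (length (program c)) (program c ! q)" if "q < length (program c)" for q
  proof -
    have "\<forall>i\<in>set (compile c 2 1). valid_instr k (2 + code_size c) i"
      using assms by (intro valid_compile) auto
    then have "\<forall>i\<in>set (program c). valid_instr k (length (program c)) i"
      unfolding len by (auto simp: program_def valid_instr_def)
    then show ?thesis using that by auto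
  qed
  have "case delta (compiled_tm k c) q ss of (q', as) \<Rightarrow>
      q' < states (compiled_tm k c) \<and> length as = tapes (compiled_tm k c) \<and>
      fst ` set as \<subseteq> {..<symbols (compiled_tm k c)}"
    if q: "q < states (compiled_tm k c)" and ss: "length ss = k + 2" "set ss \<subseteq> {..<3}" for q ss
  proof (cases "q = 0")
    case True
    have "ss ! 0 < 3" "ss ! 1 < 3" using ss nth_mem[of _ ss] by fastforce+
    then show ?thesis
      using True ss len code_size_pos[of c] by (auto simp: compiled_tm_def)
  next
    case False
    obtain j f where jf: "program c ! q = (j, f)" by fastforce
    obtain q' w d where f: "f (ss ! j) = (q', w, d)" by (metis surj_pair)
    have v: "valid_instr k (length (program c)) (j, f)"
      using valid[of q] q jf by (simp add: compiled_tm_def)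
    then have j: "j < k + 2" by (simp add: valid_instr_def)
    then have "ss ! j < 3" using ss by (metis lessThan_iff nth_mem subsetD)
    then have "q' < length (program c)" "w < 3"
      using v f by (auto simp: valid_instr_def)
    moreover have "fst ` set ((map (\<lambda>s. (s, Move_Stay)) ss)[j := (w, d)]) \<subseteq> {..<3}"
    proof -
      have "fst ` set ((map (\<lambda>s. (s, Move_Stay)) ss)[j := (w, d)]) \<subseteq>
          fst ` insert (w, d) (set (map (\<lambda>s. (s, Move_Stay)) ss))"
        by (intro image_mono set_update_subset_insert)
      also have "\<dots> \<subseteq> {..<3}" using ss(2) \<open>w < 3\<close> by auto
      finally show ?thesis .
    qed
    ultimately show ?thesis
      using False jf f ss j by (simp add: compiled_tm_def run_instr_def)
  qed
  then show ?thesis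
    using len by (simp add: wf_tm_def compiled_tm_def)
qed

section \<open>Simulation of programs by the compiled machine\<close>

definition counter_cells :: "int \<Rightarrow> nat" where
  "counter_cells i = (if i = 0 then 1 else 0)"

definition counter_config :: "nat \<Rightarrow> bool list \<Rightarrow> nat \<Rightarrow> int \<Rightarrow> (nat \<Rightarrow> nat) \<Rightarrow> bool list \<Rightarrow> config" where
  "counter_config k x q h R w = (q, (h, word_cells x) # (int (length w), word_cells w) #
     map (\<lambda>r. (int (R r), counter_cells)) [0..<k])"

lemma run_instr_acts:
  assumes "j < length ts" "f ((\<lambda>(h, t). t h) (ts ! j)) = (q, w, d)"
  shows "(case run_instr (j, f) (map (\<lambda>(h, t). t h) ts) of (q', as) \<Rightarrow> (q', map2 act as ts)) =
    (q, ts[j := act (w, d) (ts ! j)])"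
proof -
  have "map2 act ((map (\<lambda>s. (s, Move_Stay)) (map (\<lambda>(h, t). t h) ts))[j := (w, d)]) ts = ts[j := act (w, d) (ts ! j)]"
  proof (rule nth_equalityI)
    fix i assume "i < length (map2 act ((map (\<lambda>s. (s, Move_Stay)) (map (\<lambda>(h, t). t h) ts))[j := (w, d)]) ts)"
    then have "i < length ts" by simp
    then show "map2 act ((map (\<lambda>s. (s, Move_Stay)) (map (\<lambda>(h, t). t h) ts))[j := (w, d)]) ts ! i =
        ts[j := act (w, d) (ts ! j)] ! i"
      by (cases "i = j"; cases "ts ! i") auto
  qed simp
  then show ?thesis using assms by (simp add: run_instr_def)
qed

lemma map_upt_update: "r < k \<Longrightarrow> (map f [0..<k])[r := y] = map (\<lambda>i. if i = r then y else f i) [0..<k]"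
  by (rule nth_equalityI) (auto simp: nth_list_update)

locale compiled_program =
  fixes k :: nat and x :: "bool list" and Q :: "instr list" and M :: tm
  assumes delta: "\<And>q ss. 2 \<le> q \<Longrightarrow> delta M q ss = run_instr (Q ! q) ss"
begin

definition embedded :: "nat \<Rightarrow> instr list \<Rightarrow> bool" where
  "embedded a code \<longleftrightarrow> (\<forall>i<length code. Q ! (a + i) = code ! i)"

lemma embedded_append: "embedded a (p @ q) \<longleftrightarrow> embedded a p \<and> embedded (a + length p) q"
proof
  assume emb: "embedded a (p @ q)"
  have "Q ! (a + i) = p ! i" if "i < length p" for i
    using emb that unfolding embedded_def by (metis length_append nth_append trans_less_add1)
  moreover have "Q ! (a + length p + i) = q ! i" if "i < length q" for i
    using emb that unfolding embedded_def
    by (metis add.assoc length_append nat_add_left_cancel_less nth_append_length_plus)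
  ultimately show "embedded a p \<and> embedded (a + length p) q" by (simp add: embedded_def)
next
  assume emb: "embedded a p \<and> embedded (a + length p) q"
  show "embedded a (p @ q)"
    unfolding embedded_def
  proof (intro allI impI)
    fix i assume i: "i < length (p @ q)"
    show "Q ! (a + i) = (p @ q) ! i"
    proof (cases "i < length p")
      case False
      then have "i - length p < length q" using i by auto
      then have "Q ! (a + length p + (i - length p)) = q ! (i - length p)"
        using emb unfolding embedded_def by blast
      then show ?thesis using False by (simp add: nth_append)
    qed (use emb in \<open>simp add: embedded_def nth_append\<close>)
  qed
qed

lemma embedded_Cons: "embedded a (i # q) \<longleftrightarrow> Q ! a = i \<and> embedded (Suc a) q"
  using embedded_append[of a "[i]" q] by (simp add: embedded_def)

abbreviation cfg :: "nat \<Rightarrow> int \<Rightarrow> (nat \<Rightarrow> nat) \<Rightarrow> bool list \<Rightarrow> config" where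
  "cfg q h R w \<equiv> counter_config k x q h R w"

definition steps :: "nat \<Rightarrow> config \<Rightarrow> config \<Rightarrow> bool" where
  "steps n c c' \<longleftrightarrow> (tm_step M ^^ n) c = c'"

lemma steps_trans: "steps m c c' \<Longrightarrow> steps n c' c'' \<Longrightarrow> steps (m + n) c c''"
  by (simp add: steps_def funpow_add add.commute[of m])

lemma steps_1: "tm_step M c = c' \<Longrightarrow> steps (Suc 0) c c'"
  by (simp add: steps_def)

lemma steps_Suc: "tm_step M c = c' \<Longrightarrow> steps n c' c'' \<Longrightarrow> steps (Suc n) c c''"
  using steps_trans[OF steps_1] by simp

lemma step_input:
  assumes "2 \<le> a" "Q ! a = (0, f)" "f (word_cells x h) = (q, word_cells x h, d)"
  shows "tm_step M (cfg a h R w) = cfg q (h + offset d) R w"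
proof -
  have "tm_step M (cfg a h R w) = (q, (snd (cfg a h R w))[0 := act (word_cells x h, d) (snd (cfg a h R w) ! 0)])"
    using assms run_instr_acts[of 0 "snd (cfg a h R w)" f q "word_cells x h" d] by (simp add: counter_config_def delta)
  then show ?thesis by (simp add: counter_config_def)
qed

lemma step_output:
  assumes "2 \<le> a" "Q ! a = (1, \<lambda>s. (q, if b then 2 else 1, Move_Right))"
  shows "tm_step M (cfg a h R w) = cfg q h R (w @ [b])"
proof -
  have *: "(word_cells w)(int (length w) := if b then 2 else 1) = word_cells (w @ [b])"
    by (rule ext) (auto simp: word_cells_def nth_append nat_less_iff)
  have "tm_step M (cfg a h R w) =
      (q, (snd (cfg a h R w))[1 := act (if b then 2 else 1, Move_Right) (snd (cfg a h R w) ! 1)])"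
    using assms run_instr_acts[of 1 "snd (cfg a h R w)" "\<lambda>s. (q, if b then 2 else 1, Move_Right)"]
    by (simp add: counter_config_def delta)
  then show ?thesis using * by (simp add: counter_config_def)
qed

lemma step_counter:
  assumes "2 \<le> a" "Q ! a = (r + 2, f)" "r < k"
    and f: "f (if R r = 0 then 1 else 0) = (q, if R r = 0 then 1 else 0, d)" and m: "int m = int (R r) + offset d"
  shows "tm_step M (cfg a h R w) = cfg q h (R(r := m)) w"
proof -
  let ?s = "if R r = 0 then 1 else 0 :: nat"
  have c: "counter_cells (int (R r)) = ?s" by (simp add: counter_cells_def)
  have "tm_step M (cfg a h R w) = (q, (snd (cfg a h R w))[r + 2 := act (?s, d) (snd (cfg a h R w) ! (r + 2))])"
    using assms run_instr_acts[of "r + 2" "snd (cfg a h R w)" f q ?s d] c by (simp add: counter_config_def delta)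
  moreover have "counter_cells(int (R r) := ?s) = counter_cells" using c by auto
  ultimately show ?thesis
    using m \<open>r < k\<close> by (simp add: counter_config_def map_upt_update) 
qed

text \<open>These are the steps after an unconditional move to the left. That move protects against
  the case that the head stands on the blank cell behind the input, which would be taken for the
  left end. The run reaches the blank cell -1 and turns back to cell 0.\<close>

lemma rewind_steps:
  assumes "2 \<le> a" "Q ! a = (0, \<lambda>s. if s = 0 then (e, s, Move_Right) else (a, s, Move_Left))" "h \<le> length x"
  shows "steps (Suc h) (cfg a (int h - 1) R w) (cfg e 0 R w)"
  using assms(3)
proof (induction h)
  case 0
  have "tm_step M (cfg a (- 1) R w) = cfg e (- 1 + offset Move_Right) R w"
    by (intro step_input[OF assms(1,2)]) (simp add: word_cells_def)
  from steps_1[OF this] show ?case by simp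
next
  case (Suc h)
  have "tm_step M (cfg a (int h) R w) = cfg a (int h + offset Move_Left) R w"
    using Suc.prems by (intro step_input[OF assms(1,2)]) (simp add: word_cells_def)
  then show ?case using Suc by (intro steps_Suc[OF _ Suc.IH]) auto
qed

text \<open>Induction on the execution, so that loops are unfolded round by round; the addresses
  vary because a body sits elsewhere than its loop and has another exit.\<close>

lemma exec_steps:
  assumes "exec x c (h, R, w) t (h', R', w')" "2 \<le> a" "2 \<le> e \<or> e = 1" "regs c \<subseteq> {..<k}" "embedded a (compile c a e)"
  shows "steps t (cfg a (int h) R w) (cfg e (int h') R' w')"
  using assms
proof (induction c "(h, R, w)" t "(h', R', w')" arbitrary: h R w h' R' w' a e rule: exec.induct)
  case (exec_Skip)
  then have "tm_step M (cfg a (int h) R w) = cfg e (int h + offset Move_Stay) R w"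
    by (intro step_input) (auto simp: embedded_Cons)
  from steps_1[OF this] show ?case using exec_Skip by simp
next
  case (exec_Out b h R w)
  then show ?case unfolding One_nat_def by (intro steps_1 step_output) (auto simp: embedded_Cons)
next
  case (exec_Inc r h R w)
  then show ?case unfolding One_nat_def by (intro steps_1 step_counter[where d = Move_Right]) (auto simp: embedded_Cons)
next
  case (exec_Dec R r m h w)
  then show ?case unfolding One_nat_def by (intro steps_1 step_counter[where d = Move_Left]) (auto simp: embedded_Cons)
next
  case (exec_Seq c t s' d t')
  obtain h1 R1 w1 where s': "s' = (h1, R1, w1)" by (metis surj_pair)
  have "embedded a (compile c a (a + code_size c))" "embedded (a + code_size c) (compile d (a + code_size c) e)"
    using exec_Seq.prems by (simp_all add: embedded_append length_compile)
  then have "steps t (cfg a (int h) R w) (cfg (a + code_size c) (int h1) R1 w1)"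
    "steps t' (cfg (a + code_size c) (int h1) R1 w1) (cfg e (int h') R' w')"
    using exec_Seq.prems by (auto intro!: exec_Seq.hyps(2,4) simp: s')
  then show ?case by (rule steps_trans)
next
  case (exec_While_False R r c h w)
  then have Qa: "Q ! a = (r + 2, \<lambda>s. (if s = 1 then e else a + 1, s, Move_Stay))"
    by (simp add: embedded_Cons)
  have "tm_step M (cfg a (int h) R w) = cfg e (int h) (R(r := 0)) w"
    by (intro step_counter[OF _ Qa, where d = Move_Stay]) (use exec_While_False in auto)
  moreover have "R(r := 0) = R" using exec_While_False by auto
  ultimately have "tm_step M (cfg a (int h) R w) = cfg e (int h) R w" by simp
  from steps_1[OF this] show ?case using exec_While_False by simp
next
  case (exec_While_True R r c h w t s' t')
  obtain h1 R1 w1 where s': "s' = (h1, R1, w1)" by (metis surj_pair)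
  have Qa: "Q ! a = (r + 2, \<lambda>s. (if s = 1 then e else a + 1, s, Move_Stay))"
    using exec_While_True.prems by (simp add: embedded_Cons)
  have "tm_step M (cfg a (int h) R w) = cfg (a + 1) (int h) (R(r := R r)) w"
    by (intro step_counter[OF _ Qa, where d = Move_Stay]) (use exec_While_True.hyps(1) exec_While_True.prems in auto)
  moreover have "steps t (cfg (a + 1) (int h) R w) (cfg a (int h1) R1 w1)"
    using exec_While_True.prems by (intro exec_While_True.hyps(3)) (auto simp: s' embedded_Cons)
  moreover have "steps t' (cfg a (int h1) R1 w1) (cfg e (int h') R' w')"
    using exec_While_True.prems by (intro exec_While_True.hyps(5)) (auto simp: s')
  ultimately show ?case using steps_Suc steps_trans by (metis fun_upd_triv)
next
  case (exec_If_True R r c h w t d)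
  have Qa: "Q ! a = (r + 2, \<lambda>s. (if s = 1 then a + 1 + code_size c else a + 1, s, Move_Stay))"
    using exec_If_True.prems by (simp add: embedded_Cons)
  have "tm_step M (cfg a (int h) R w) = cfg (a + 1) (int h) (R(r := R r)) w"
    by (intro step_counter[OF _ Qa, where d = Move_Stay]) (use exec_If_True.hyps(1) exec_If_True.prems in auto)
  moreover have "steps t (cfg (a + 1) (int h) R w) (cfg e (int h') R' w')"
    using exec_If_True.prems by (intro exec_If_True.hyps(3)) (auto simp: embedded_Cons embedded_append)
  ultimately show ?case using steps_Suc by simp
next
  case (exec_If_False R r d h w t c)
  have Qa: "Q ! a = (r + 2, \<lambda>s. (if s = 1 then a + 1 + code_size c else a + 1, s, Move_Stay))"
    using exec_If_False.prems by (simp add: embedded_Cons)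
  have "tm_step M (cfg a (int h) R w) = cfg (a + 1 + code_size c) (int h) (R(r := R r)) w"
    by (intro step_counter[OF _ Qa, where d = Move_Stay]) (use exec_If_False.hyps(1) exec_If_False.prems in auto)
  moreover have "steps t (cfg (a + 1 + code_size c) (int h) R w) (cfg e (int h') R' w')"
    using exec_If_False.prems by (intro exec_If_False.hyps(3)) (auto simp: embedded_Cons embedded_append length_compile)
  ultimately show ?case using steps_Suc by simp
next
  case (exec_InLoop_end h c d R w)
  have Qa: "Q ! a = (0, \<lambda>s. (if s = 0 then e else if s = 1 then a + 2 else a + 2 + code_size c, s, Move_Stay))"
    using exec_InLoop_end.prems by (simp add: embedded_Cons)
  have "tm_step M (cfg a (int h) R w) = cfg e (int h + offset Move_Stay) R w"
    by (intro step_input[OF _ Qa]) (use exec_InLoop_end in \<open>auto simp: word_cells_def\<close>)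
  from steps_1[OF this] show ?case using exec_InLoop_end by simp
next
  case (exec_InLoop_step h d c R w t h1 R1 w1 t')
  have Qa: "Q ! a = (0, \<lambda>s. (if s = 0 then e else if s = 1 then a + 2 else a + 2 + code_size c, s, Move_Stay))"
    using exec_InLoop_step.prems by (simp add: embedded_Cons)
  let ?q = "if x ! h then a + 2 + code_size c else a + 2"
  have "tm_step M (cfg a (int h) R w) = cfg ?q (int h + offset Move_Stay) R w"
    by (intro step_input[OF _ Qa])
      (use exec_InLoop_step.hyps(1) exec_InLoop_step.prems in \<open>auto simp: word_cells_def\<close>)
  moreover have "steps t (cfg ?q (int h) R w) (cfg (a + 1) (int h1) R1 w1)"
    using exec_InLoop_step.prems
    by (intro exec_InLoop_step.hyps(3)) (auto simp: embedded_Cons embedded_append length_compile)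
  moreover have "tm_step M (cfg (a + 1) (int h1) R1 w1) = cfg a (int h1 + offset Move_Right) R1 w1"
    using exec_InLoop_step.prems by (intro step_input) (auto simp: embedded_Cons)
  moreover have "steps t' (cfg a (int (Suc h1)) R1 w1) (cfg e (int h') R' w')"
    using exec_InLoop_step.prems by (intro exec_InLoop_step.hyps(5)) auto
  ultimately show ?case
    by (intro steps_Suc steps_trans) (auto simp: add.commute)
next
  case (exec_Rewind h R w)
  have "tm_step M (cfg a (int h) R w) = cfg (a + 1) (int h + offset Move_Left) R w"
    using exec_Rewind by (intro step_input) (auto simp: embedded_Cons)
  moreover have "steps (Suc h) (cfg (a + 1) (int h - 1) R w) (cfg e 0 R w)"
    using exec_Rewind by (intro rewind_steps) (auto simp: embedded_Cons)
  ultimately show ?case using steps_Suc by simp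
qed

end

theorem poly_time_exec:
  assumes "\<And>x. \<exists>t\<le>poly p (length x). \<exists>h R. exec x c (0, (\<lambda>_. 0), []) t (h, R, f x)"
  shows "poly_time f"
proof -
  obtain k where k: "regs c \<subseteq> {..<k}"
    using finite_regs[of c] by (auto simp: finite_nat_set_iff_bounded)
  let ?M = "compiled_tm k c"
  \<comment> \<open>The additional step is the one in which the start state marks the counter
    tapes.\<close>
  have "\<exists>n \<le> poly (p + 1) (length x). halts_with ((tm_step ?M ^^ n) (init_config ?M x)) (f x)" for x
  proof -
    obtain t h R where t: "t \<le> poly p (length x)" "exec x c (0, (\<lambda>_. 0), []) t (h, R, f x)"
      using assms by blast
    interpret compiled_program k x "program c" ?M
      by unfold_locales (simp add: compiled_tm_def)
    have "tm_step ?M (init_config ?M x) = cfg 2 (int 0) (\<lambda>_. 0) []"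
    proof -
      have 1: "map2 act (replicate k (1, Move_Stay)) (replicate k (0, \<lambda>_. 0)) = map (\<lambda>r. (0, counter_cells)) [0..<k]"
        by (rule nth_equalityI) (auto simp: counter_cells_def fun_eq_iff)
      have 2: "(\<lambda>_. 0) = word_cells []" by (simp add: word_cells_def fun_eq_iff)
      show ?thesis
        using 1 by (simp add: init_config_def compiled_tm_def counter_config_def 2 numeral_2_eq_2)
    qed
    moreover have "steps t (cfg 2 (int 0) (\<lambda>_. 0) []) (cfg 1 (int h) R (f x))"
    proof (intro exec_steps[OF t(2)] k)
      show "embedded 2 (compile c 2 1)" unfolding embedded_def by (simp add: program_def)
    qed auto
    ultimately have "steps (Suc t) (init_config ?M x) (cfg 1 (int h) R (f x))"
      by (rule steps_Suc)
    then show ?thesis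
      using t(1) by (intro exI[of _ "Suc t"]) (simp add: steps_def halts_with_def counter_config_def)
  qed
  then show ?thesis
    using wf_compiled_tm[OF k] unfolding poly_time_def by blast
qed

section \<open>Running times of counter programs\<close>

text \<open>Domination by a polynomial instead of equality, so that recursively defined time bounds
  can be used as they are.\<close>

definition poly_bounded :: "(nat \<Rightarrow> nat) \<Rightarrow> bool" where
  "poly_bounded f \<longleftrightarrow> (\<exists>p. \<forall>n. f n \<le> poly p n)"

lemma poly_bounded_const: "poly_bounded (\<lambda>_. c)"
  unfolding poly_bounded_def by (intro exI[of _ "[:c:]"]) simp

lemma poly_bounded_id: "poly_bounded (\<lambda>n. n)"
  unfolding poly_bounded_def by (intro exI[of _ "[:0, 1:]"]) simp

lemma poly_bounded_poly: "poly_bounded (poly p)"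
  unfolding poly_bounded_def by blast

lemma poly_bounded_add: "poly_bounded f \<Longrightarrow> poly_bounded g \<Longrightarrow> poly_bounded (\<lambda>n. f n + g n)"
  unfolding poly_bounded_def by (metis add_mono poly_add)

lemma poly_bounded_mult: "poly_bounded f \<Longrightarrow> poly_bounded g \<Longrightarrow> poly_bounded (\<lambda>n. f n * g n)"
  unfolding poly_bounded_def by (metis mult_le_mono poly_mult)

lemma poly_bounded_Suc: "poly_bounded f \<Longrightarrow> poly_bounded (\<lambda>n. Suc (f n))"
  using poly_bounded_add[OF poly_bounded_const[of 1]] by simp

lemmas poly_bounded_intros = poly_bounded_const poly_bounded_id poly_bounded_poly poly_bounded_add
  poly_bounded_mult poly_bounded_Suc

text \<open>The time is bounded from above only, so that bounds can be simplified before they are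
  combined.\<close>

definition runs :: "bool list \<Rightarrow> com \<Rightarrow> counter_state \<Rightarrow> nat \<Rightarrow> counter_state \<Rightarrow> bool" where
  "runs x c s n s' \<longleftrightarrow> (\<exists>t\<le>n. exec x c s t s')"

lemma runs_mono: "runs x c s n s' \<Longrightarrow> n \<le> m \<Longrightarrow> runs x c s m s'"
  unfolding runs_def using le_trans by blast

lemma runs_eqI: "runs x c s n s' \<Longrightarrow> s = t \<Longrightarrow> s' = t' \<Longrightarrow> n \<le> m \<Longrightarrow> runs x c t m t'"
  using runs_mono by blast

lemma runs_Skip: "runs x Skip s 1 s"
  unfolding runs_def using exec_Skip by blast

lemma runs_Out: "runs x (Out b) (h, R, w) 1 (h, R, w @ [b])"
  unfolding runs_def using exec_Out by blast

lemma runs_Inc: "runs x (Inc r) (h, R, w) 1 (h, R(r := Suc (R r)), w)"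
  unfolding runs_def using exec_Inc by blast

lemma runs_Dec: "R r = Suc m \<Longrightarrow> runs x (Dec r) (h, R, w) 1 (h, R(r := m), w)"
  unfolding runs_def using exec_Dec by blast

lemma runs_Seq: "runs x c s m s' \<Longrightarrow> runs x d s' n s'' \<Longrightarrow> runs x (Seq c d) s (m + n) s''"
  unfolding runs_def using exec_Seq add_mono by meson

lemma runs_If_True: "R r \<noteq> 0 \<Longrightarrow> runs x c (h, R, w) n s' \<Longrightarrow> runs x (If r c d) (h, R, w) (Suc n) s'"
  unfolding runs_def using exec_If_True Suc_le_mono by metis

lemma runs_If_False: "R r = 0 \<Longrightarrow> runs x d (h, R, w) n s' \<Longrightarrow> runs x (If r c d) (h, R, w) (Suc n) s'"
  unfolding runs_def using exec_If_False Suc_le_mono by metis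

lemma runs_While_False: "R r = 0 \<Longrightarrow> runs x (While r c) (h, R, w) 1 (h, R, w)"
  unfolding runs_def using exec_While_False by blast

lemma runs_While_True:
  "R r \<noteq> 0 \<Longrightarrow> runs x c (h, R, w) m s' \<Longrightarrow> runs x (While r c) s' n s'' \<Longrightarrow>
    runs x (While r c) (h, R, w) (Suc (m + n)) s''"
  unfolding runs_def by (meson exec_While_True Suc_le_mono add_mono)

lemma runs_InLoop_end: "h = length x \<Longrightarrow> runs x (InLoop c d) (h, R, w) 1 (h, R, w)"
  unfolding runs_def using exec_InLoop_end by blast

lemma runs_InLoop_step:
  assumes "h < length x" "runs x (if x ! h then d else c) (h, R, w) m (h', R', w')"
    "runs x (InLoop c d) (Suc h', R', w') n s''"
  shows "runs x (InLoop c d) (h, R, w) (m + n + 2) s''"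
proof -
  obtain t t' where t: "t \<le> m" "t' \<le> n" "exec x (if x ! h then d else c) (h, R, w) t (h', R', w')"
    "exec x (InLoop c d) (Suc h', R', w') t' s''"
    using assms unfolding runs_def by blast
  have "Suc (t + Suc t') \<le> m + n + 2" using t by simp
  then show ?thesis
    unfolding runs_def using exec_InLoop_step[OF assms(1) t(3,4)] by blast
qed

lemma runs_Rewind: "h \<le> length x \<Longrightarrow> runs x Rewind (h, R, w) (length x + 2) (0, R, w)"
  unfolding runs_def using exec_Rewind[of h x R w] by (intro exI[of _ "h + 2"]) simp

text \<open>The body sees the counter already decremented, hence the values \<open>n - 1\<close>
  down to 0; the reversed lists in the instance come from this.\<close>

definition drain :: "nat \<Rightarrow> com \<Rightarrow> com" where
  "drain r c = While r (Seq (Dec r) c)"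

text \<open>\<open>H\<close>, \<open>R\<close>, \<open>W\<close> describe the state after
  \<open>i\<close> rounds. The explicit update at \<open>r\<close> separates the loop counter from
  the rest of the invariant. Each round costs two steps besides its body, the test and the
  decrement.\<close>

lemma runs_drain:
  assumes "\<And>i. i < n \<Longrightarrow> runs x c (H i, (R i)(r := n - Suc i), W i) m (H (Suc i), (R (Suc i))(r := n - Suc i), W (Suc i))"
  shows "runs x (drain r c) (H 0, (R 0)(r := n), W 0) (n * (m + 2) + 1) (H n, (R n)(r := 0), W n)"
  using assms
proof (induction n arbitrary: H R W)
  case 0
  show ?case
    unfolding drain_def mult_0 add_0 by (rule runs_While_False) simp
next
  case (Suc n)
  have "runs x (Dec r) (H 0, (R 0)(r := Suc n), W 0) 1 (H 0, (R 0)(r := n), W 0)"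
    by (rule runs_eqI, rule runs_Dec[of "(R 0)(r := Suc n)" r n x "H 0" "W 0"]) (auto simp: fun_eq_iff)
  moreover have "runs x c (H 0, (R 0)(r := n), W 0) m (H 1, (R 1)(r := n), W 1)"
    by (rule runs_eqI, rule Suc.prems[of 0]) (auto simp: fun_eq_iff)
  ultimately have "runs x (Seq (Dec r) c) (H 0, (R 0)(r := Suc n), W 0) (1 + m) (H 1, (R 1)(r := n), W 1)"
    by (rule runs_Seq)
  moreover have "runs x (drain r c) (H (Suc 0), (R (Suc 0))(r := n), W (Suc 0)) (n * (m + 2) + 1)
      (H (Suc n), (R (Suc n))(r := 0), W (Suc n))"
  proof (rule Suc.IH[of "\<lambda>i. H (Suc i)" "\<lambda>i. R (Suc i)" "\<lambda>i. W (Suc i)"])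
    fix i assume "i < n"
    then show "runs x c (H (Suc i), (R (Suc i))(r := n - Suc i), W (Suc i)) m
        (H (Suc (Suc i)), (R (Suc (Suc i)))(r := n - Suc i), W (Suc (Suc i)))"
      by (intro runs_eqI[OF Suc.prems[of "Suc i"]]) auto
  qed
  ultimately have "runs x (drain r c) (H 0, (R 0)(r := Suc n), W 0) (Suc ((1 + m) + (n * (m + 2) + 1)))
      (H (Suc n), (R (Suc n))(r := 0), W (Suc n))"
    unfolding drain_def by (intro runs_While_True) auto
  then show ?case by (rule runs_mono) simp
qed

section \<open>Arithmetic on unary counters\<close>

fun seqs :: "com list \<Rightarrow> com" where
  "seqs [] = Skip"
| "seqs (c # cs) = Seq c (seqs cs)"

lemma count_list_replicate: "count_list (replicate n a) b = (if a = b then n else 0)"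
  by (induction n) auto

definition incs :: "nat list \<Rightarrow> com" where
  "incs rs = seqs (map Inc rs)"

lemma runs_incs: "runs x (incs rs) (h, R, w) (length rs + 1) (h, \<lambda>i. R i + count_list rs i, w)"
  unfolding incs_def
proof (induction rs arbitrary: R)
  case Nil
  then show ?case using runs_Skip by simp
next
  case (Cons r rs)
  have *: "(\<lambda>i. (R(r := Suc (R r))) i + count_list rs i) = (\<lambda>i. R i + count_list (r # rs) i)" by auto
  have "runs x (seqs (map Inc (r # rs))) (h, R, w) (1 + (length rs + 1)) (h, \<lambda>i. (R(r := Suc (R r))) i + count_list rs i, w)"
    unfolding seqs.simps list.map by (rule runs_Seq[OF runs_Inc Cons.IH])
  then show ?case unfolding * by (rule runs_mono) simp
qed

text \<open>Reading a counter empties it, so a copy is made by moving it to two registers and one of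
  them back. Repetitions in \<open>rs\<close> produce multiples.\<close>

definition shift :: "nat \<Rightarrow> nat list \<Rightarrow> com" where
  "shift r rs = drain r (incs rs)"

lemma runs_shift:
  assumes "r \<notin> set rs"
  shows "runs x (shift r rs) (h, R, w) (R r * (length rs + 3) + 1) (h, (\<lambda>i. R i + R r * count_list rs i)(r := 0), w)"
proof -
  have 0: "count_list rs r = 0" using assms by simp
  have "runs x (shift r rs) (h, (\<lambda>i. R i + 0 * count_list rs i)(r := R r), w) (R r * (length rs + 1 + 2) + 1)
      (h, (\<lambda>i. R i + R r * count_list rs i)(r := 0), w)"
    unfolding shift_def
  proof (rule runs_drain[where H = "\<lambda>_. h" and R = "\<lambda>j i. R i + j * count_list rs i" and W = "\<lambda>_. w"])
    fix j assume "j < R r"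
    have "(\<lambda>i. ((\<lambda>i. R i + j * count_list rs i)(r := R r - Suc j)) i + count_list rs i) =
        (\<lambda>i. R i + Suc j * count_list rs i)(r := R r - Suc j)"
      using 0 by auto
    then show "runs x (incs rs) (h, (\<lambda>i. R i + j * count_list rs i)(r := R r - Suc j), w) (length rs + 1)
       (h, (\<lambda>i. R i + Suc j * count_list rs i)(r := R r - Suc j), w)"
      using runs_incs[of x rs h "(\<lambda>i. R i + j * count_list rs i)(r := R r - Suc j)" w] by simp
  qed
  moreover have "(\<lambda>i. R i + 0 * count_list rs i)(r := R r) = R" by auto
  ultimately have "runs x (shift r rs) (h, R, w) (R r * (length rs + 1 + 2) + 1)
      (h, (\<lambda>i. R i + R r * count_list rs i)(r := 0), w)" by simp
  then show ?thesis by (rule runs_mono) (simp add: algebra_simps)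
qed

text \<open>
  Register 0 holds the input length; registers 1 to 4 are scratch and are 0 between commands.
  Registers 5 to 7 all count the clauses written so far.
\<close>

definition clean :: "(nat \<Rightarrow> nat) \<Rightarrow> bool" where
  "clean R \<longleftrightarrow> R 1 = 0 \<and> R 2 = 0 \<and> R 3 = 0 \<and> R 4 = 0"

lemma clean_update: "4 < r \<Longrightarrow> clean R \<Longrightarrow> clean (R(r := v))"
  by (simp add: clean_def)

fun eval_list :: "nat list \<Rightarrow> nat \<Rightarrow> nat" where
  "eval_list [] n = 0"
| "eval_list (a # as) n = a + n * eval_list as n"

lemma eval_list_coeffs: "eval_list (coeffs q) n = poly q n"
proof -
  have "eval_list as n = horner_sum id n as" for as
    by (induction as) auto
  then show ?thesis by (simp add: poly_def)
qed

text \<open>Horner's scheme with multiplication as repeated addition: each unit of the intermediate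
  value in \<open>r\<close> adds register 0 to register 1, with register 4 as the backup of register
  0. Then the product returns to \<open>r\<close> and the coefficient is added.\<close>

fun horner :: "nat list \<Rightarrow> nat \<Rightarrow> com" where
  "horner [] r = Skip"
| "horner (a # as) r = Seq (horner as r)
     (Seq (drain r (Seq (shift 0 [4, 1]) (shift 4 [0]))) (Seq (shift 1 [r]) (incs (replicate a r))))"

fun horner_time :: "nat list \<Rightarrow> nat \<Rightarrow> nat" where
  "horner_time [] n = 1"
| "horner_time (a # as) n = horner_time as n + (eval_list as n * (n * 5 + 1 + (n * 4 + 1) + 2) + 1 +
     (n * eval_list as n * 4 + 1 + (a + 1)))"

lemma poly_bounded_horner_time: "poly_bounded (horner_time as)"
proof -
  have e: "poly_bounded (eval_list as)" for as
    by (induction as) (simp_all add: poly_bounded_intros)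
  show ?thesis
  proof (induction as)
    case Nil
    have "horner_time [] = (\<lambda>_. 1)" by auto
    then show ?case by (simp only: poly_bounded_const)
  next
    case (Cons a as)
    have "horner_time (a # as) = (\<lambda>n. horner_time as n + (eval_list as n * (n * 5 + 1 + (n * 4 + 1) + 2) + 1 +
     (n * eval_list as n * 4 + 1 + (a + 1))))" by auto
    then show ?case by (simp only: Cons e poly_bounded_intros)
  qed
qed

lemma runs_horner:
  assumes "4 < r" "clean R" "R r = 0"
  shows "runs x (horner as r) (h, R, w) (horner_time as (R 0)) (h, R(r := eval_list as (R 0)), w)"
proof (induction as)
  case Nil
  have "R(r := 0) = R" using assms by auto
  then show ?case using runs_Skip[of x "(h, R, w)"] by simp
next
  case (Cons a as)
  let ?n = "R 0" and ?e = "eval_list as (R 0)"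
  have body: "runs x (Seq (shift 0 [4, 1]) (shift 4 [0])) (h, (R(1 := j * ?n))(r := v), w) (?n * 5 + 1 + (?n * 4 + 1))
      (h, (R(1 := Suc j * ?n))(r := v), w)" for j v
  proof -
    let ?R = "(R(1 := j * ?n))(r := v)"
    let ?R' = "(R(1 := Suc j * ?n, 0 := 0, 4 := ?n))(r := v)"
    have 1: "(\<lambda>i. ?R i + ?R 0 * count_list [4, 1] i)(0 := 0) = ?R'"
      using assms by (auto simp: clean_def fun_eq_iff)
    have 2: "(\<lambda>i. ?R' i + ?R' 4 * count_list [0] i)(4 := 0) = (R(1 := Suc j * ?n))(r := v)"
      using assms by (auto simp: clean_def fun_eq_iff)
    have "runs x (shift 0 [4, 1]) (h, ?R, w) (?n * 5 + 1) (h, ?R', w)"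
      using runs_shift[of 0 "[4, 1]" x h ?R w] assms(1) unfolding 1 by simp
    moreover have "runs x (shift 4 [0]) (h, ?R', w) (?n * 4 + 1) (h, (R(1 := Suc j * ?n))(r := v), w)"
      using runs_shift[of 4 "[0]" x h ?R' w] assms(1) unfolding 2 by simp
    ultimately show ?thesis by (rule runs_Seq)
  qed
  have "runs x (drain r (Seq (shift 0 [4, 1]) (shift 4 [0]))) (h, (R(1 := 0 * ?n))(r := ?e), w)
     (?e * (?n * 5 + 1 + (?n * 4 + 1) + 2) + 1) (h, (R(1 := ?e * ?n))(r := 0), w)"
    by (rule runs_drain[where H = "\<lambda>_. h" and W = "\<lambda>_. w" and R = "\<lambda>j. R(1 := j * ?n)"]) (rule body)
  moreover have "(R(1 := 0 * ?n))(r := ?e) = R(r := ?e)" using assms by (auto simp: clean_def)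
  moreover have "(R(1 := ?e * ?n))(r := 0) = R(1 := ?e * ?n)" using assms by auto
  ultimately have 1: "runs x (drain r (Seq (shift 0 [4, 1]) (shift 4 [0]))) (h, R(r := ?e), w)
     (?e * (?n * 5 + 1 + (?n * 4 + 1) + 2) + 1) (h, R(1 := ?e * ?n), w)" by simp
  let ?R = "R(1 := ?e * ?n)"
  have e: "(\<lambda>i. ?R i + ?R 1 * count_list [r] i)(1 := 0) = R(r := ?n * ?e)"
    using assms by (auto simp: clean_def fun_eq_iff)
  have 2: "runs x (shift 1 [r]) (h, ?R, w) (?n * ?e * 4 + 1) (h, R(r := ?n * ?e), w)"
    using runs_shift[of 1 "[r]" x h ?R w] assms(1) unfolding e by (simp add: mult.commute)
  have e: "(\<lambda>i. (R(r := ?n * ?e)) i + count_list (replicate a r) i) = R(r := eval_list (a # as) ?n)"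
    by (auto simp: count_list_replicate fun_eq_iff)
  have 3: "runs x (incs (replicate a r)) (h, R(r := ?n * ?e), w) (a + 1) (h, R(r := eval_list (a # as) ?n), w)"
    using runs_incs[of x "replicate a r" h "R(r := ?n * ?e)" w] unfolding e by simp
  show ?case
    unfolding horner.simps horner_time.simps by (intro runs_Seq[OF Cons.IH] runs_Seq[OF 1] runs_Seq[OF 2] 3)
qed

definition set_poly :: "nat \<Rightarrow> nat poly \<Rightarrow> com" where
  "set_poly r q = horner (coeffs q) r"

lemma runs_set_poly:
  assumes "4 < r" "clean R" "R r = 0"
  shows "runs x (set_poly r q) (h, R, w) (horner_time (coeffs q) (R 0)) (h, R(r := poly q (R 0)), w)"
  using runs_horner[OF assms, of x "coeffs q" h w] by (simp add: set_poly_def eval_list_coeffs)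

definition halve :: com where
  "halve = While 1 (Seq (Dec 1) (If 1 (Seq (Dec 1) (Inc 2)) (Inc 3)))"

lemma runs_halve:
  "runs x halve (h, R(1 := n, 2 := y, 3 := 0), w) (5 * n + 1) (h, R(1 := 0, 2 := y + n div 2, 3 := n mod 2), w)"
proof (induction n arbitrary: y rule: induct_nat_012)
  case 0
  show ?case
    unfolding halve_def div_0 mod_0 add_0_right mult_0_right add_0 by (rule runs_While_False) simp
next
  case 1
  let ?R = "\<lambda>n b. R(1 := n, 2 := y, 3 := b)"
  have "runs x (Dec 1) (h, ?R 1 0, w) 1 (h, ?R 0 0, w)"
    by (rule runs_eqI, rule runs_Dec[of "?R 1 0" 1 0 x h w]) (auto simp: fun_eq_iff)
  moreover have "runs x (Inc 3) (h, ?R 0 0, w) 1 (h, ?R 0 1, w)"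
    by (rule runs_eqI, rule runs_Inc[of x 3 h "?R 0 0" w]) (auto simp: fun_eq_iff)
  then have "runs x (If 1 (Seq (Dec 1) (Inc 2)) (Inc 3)) (h, ?R 0 0, w) (Suc 1) (h, ?R 0 1, w)"
    by (intro runs_If_False) auto
  ultimately have "runs x (Seq (Dec 1) (If 1 (Seq (Dec 1) (Inc 2)) (Inc 3))) (h, ?R 1 0, w) (1 + Suc 1) (h, ?R 0 1, w)"
    by (rule runs_Seq)
  moreover have "runs x halve (h, ?R 0 1, w) 1 (h, ?R 0 1, w)"
    unfolding halve_def by (rule runs_While_False) simp
  ultimately have "runs x halve (h, ?R 1 0, w) (Suc (1 + Suc 1 + 1)) (h, ?R 0 1, w)"
    unfolding halve_def by (intro runs_While_True) auto
  then show ?case by (rule runs_eqI) (auto simp: fun_eq_iff)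
next
  case (ge2 n)
  let ?R = "\<lambda>n y b. R(1 := n, 2 := y, 3 := b)"
  have "runs x (Dec 1) (h, ?R (Suc (Suc n)) y 0, w) 1 (h, ?R (Suc n) y 0, w)"
    by (rule runs_eqI, rule runs_Dec[of "?R (Suc (Suc n)) y 0" 1 "Suc n" x h w]) (auto simp: fun_eq_iff)
  moreover have "runs x (Seq (Dec 1) (Inc 2)) (h, ?R (Suc n) y 0, w) (1 + 1) (h, ?R n (Suc y) 0, w)"
  proof (rule runs_Seq)
    show "runs x (Dec 1) (h, ?R (Suc n) y 0, w) 1 (h, ?R n y 0, w)"
      by (rule runs_eqI, rule runs_Dec[of "?R (Suc n) y 0" 1 n x h w]) (auto simp: fun_eq_iff)
    show "runs x (Inc 2) (h, ?R n y 0, w) 1 (h, ?R n (Suc y) 0, w)"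
      by (rule runs_eqI, rule runs_Inc[of x 2 h "?R n y 0" w]) (auto simp: fun_eq_iff)
  qed
  then have "runs x (If 1 (Seq (Dec 1) (Inc 2)) (Inc 3)) (h, ?R (Suc n) y 0, w) (Suc (1 + 1)) (h, ?R n (Suc y) 0, w)"
    by (intro runs_If_True) auto
  ultimately have "runs x (Seq (Dec 1) (If 1 (Seq (Dec 1) (Inc 2)) (Inc 3))) (h, ?R (Suc (Suc n)) y 0, w)
      (1 + Suc (1 + 1)) (h, ?R n (Suc y) 0, w)"
    by (rule runs_Seq)
  moreover have "runs x halve (h, ?R n (Suc y) 0, w) (5 * n + 1) (h, ?R 0 (Suc y + n div 2) (n mod 2), w)"
    by (rule runs_eqI[OF ge2(1)[of "Suc y"]]) (auto simp: fun_eq_iff)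
  ultimately have "runs x halve (h, ?R (Suc (Suc n)) y 0, w) (Suc (1 + Suc (1 + 1) + (5 * n + 1)))
      (h, ?R 0 (Suc y + n div 2) (n mod 2), w)"
    unfolding halve_def by (intro runs_While_True) auto
  then show ?case by (rule runs_eqI) (auto simp: fun_eq_iff)
qed

definition out_bits :: com where
  "out_bits = While 1 (Seq (Out True) (Seq halve (Seq (If 3 (Seq (Dec 3) (Out True)) (Out False)) (shift 2 [1]))))"

text \<open>Counters are unary, so a bound polynomial in \<open>n\<close> itself, not in the number
  of its bits, is the appropriate one, and a crude recursion from \<open>n div 2\<close> to
  \<open>n\<close> suffices.\<close>

lemma runs_out_bits:
  "runs x out_bits (h, R(1 := n, 2 := 0, 3 := 0), w) (n * (10 * n + 12) + 1)
     (h, R(1 := 0, 2 := 0, 3 := 0), w @ concat (map (\<lambda>b. [True, b]) (bits n)))"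
proof (induction n arbitrary: w rule: less_induct)
  case (less n)
  let ?R = "\<lambda>n y b. R(1 := n, 2 := y, 3 := b)"
  show ?case
  proof (cases "n = 0")
    case True
    have "bits 0 = []" by (simp add: bits.simps)
    then show ?thesis
      unfolding True out_bits_def mult_0 add_0 by (simp only: list.map concat.simps append_Nil2) (rule runs_While_False, simp)
  next
    case False
    let ?w = "w @ [True]" and ?w' = "w @ [True] @ [odd n]"
    have 1: "runs x (Out True) (h, ?R n 0 0, w) 1 (h, ?R n 0 0, ?w)" by (rule runs_Out)
    have 2: "runs x halve (h, ?R n 0 0, ?w) (5 * n + 1) (h, ?R 0 (n div 2) (n mod 2), ?w)"
      using runs_halve[of x h R n 0 ?w] by simp
    have 3: "runs x (If 3 (Seq (Dec 3) (Out True)) (Out False)) (h, ?R 0 (n div 2) (n mod 2), ?w) (Suc 2)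
        (h, ?R 0 (n div 2) 0, ?w')"
    proof (cases "odd n")
      case True
      then have n: "n mod 2 = 1" by presburger
      have "runs x (Dec 3) (h, ?R 0 (n div 2) 1, ?w) 1 (h, ?R 0 (n div 2) 0, ?w)"
        by (rule runs_eqI, rule runs_Dec[of "?R 0 (n div 2) 1" 3 0 x h ?w]) (auto simp: fun_eq_iff)
      moreover have "runs x (Out True) (h, ?R 0 (n div 2) 0, ?w) 1 (h, ?R 0 (n div 2) 0, ?w')"
        using runs_Out[of x True h "?R 0 (n div 2) 0" ?w] True by simp
      ultimately have "runs x (Seq (Dec 3) (Out True)) (h, ?R 0 (n div 2) 1, ?w) (1 + 1) (h, ?R 0 (n div 2) 0, ?w')"
        by (rule runs_Seq)
      then show ?thesis unfolding n by (intro runs_If_True) (auto simp: numeral_2_eq_2)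
    next
      case False
      then have n: "n mod 2 = 0" by presburger
      have "runs x (Out False) (h, ?R 0 (n div 2) 0, ?w) 1 (h, ?R 0 (n div 2) 0, ?w')"
        using runs_Out[of x False h "?R 0 (n div 2) 0" ?w] False by simp
      then have "runs x (Out False) (h, ?R 0 (n div 2) 0, ?w) 2 (h, ?R 0 (n div 2) 0, ?w')"
        by (rule runs_mono) simp
      then show ?thesis unfolding n by (intro runs_If_False) auto
    qed
    have e: "(\<lambda>i. ?R 0 (n div 2) 0 i + ?R 0 (n div 2) 0 2 * count_list [1] i)(2 := 0) = ?R (n div 2) 0 0"
      by (auto simp: fun_eq_iff)
    have 4: "runs x (shift 2 [1]) (h, ?R 0 (n div 2) 0, ?w') (n div 2 * 4 + 1) (h, ?R (n div 2) 0 0, ?w')"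
      using runs_shift[of 2 "[1]" x h "?R 0 (n div 2) 0" ?w'] unfolding e by simp
    have body: "runs x (Seq (Out True) (Seq halve (Seq (If 3 (Seq (Dec 3) (Out True)) (Out False)) (shift 2 [1]))))
      (h, ?R n 0 0, w) (1 + (5 * n + 1 + (Suc 2 + (n div 2 * 4 + 1)))) (h, ?R (n div 2) 0 0, ?w')"
      by (intro runs_Seq[OF 1] runs_Seq[OF 2] runs_Seq[OF 3] 4)
    have "runs x out_bits (h, ?R (n div 2) 0 0, ?w') ((n div 2) * (10 * (n div 2) + 12) + 1)
       (h, ?R 0 0 0, ?w' @ concat (map (\<lambda>b. [True, b]) (bits (n div 2))))"
      by (rule less.IH) (use False in auto)
    with body have A: "runs x out_bits (h, ?R n 0 0, w)
      (Suc (1 + (5 * n + 1 + (Suc 2 + (n div 2 * 4 + 1))) + ((n div 2) * (10 * (n div 2) + 12) + 1)))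
       (h, ?R 0 0 0, ?w' @ concat (map (\<lambda>b. [True, b]) (bits (n div 2))))"
      using False unfolding out_bits_def by (intro runs_While_True) auto
    have le: "Suc (1 + (5 * n + 1 + (Suc 2 + (n div 2 * 4 + 1))) + ((n div 2) * (10 * (n div 2) + 12) + 1))
      \<le> n * (10 * n + 12) + 1"
    proof -
      \<comment> \<open>Replacing half of \<open>n\<close> by \<open>n - 1\<close> saves one summand
        \<open>10 * n + 12\<close>, which pays for the current round.\<close>
      have "n div 2 \<le> n - 1" using False by auto
      then have "(n div 2) * (10 * (n div 2) + 12) \<le> (n - 1) * (10 * n + 12)"
        by (intro mult_le_mono) auto
      moreover have "n * (10 * n + 12) = (10 * n + 12) + (n - 1) * (10 * n + 12)"
        using False by (cases n) simp_all
      moreover have "n div 2 * 4 \<le> 2 * n" by auto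
      ultimately show ?thesis using False by linarith
    qed
    have eqw: "?w' @ concat (map (\<lambda>b. [True, b]) (bits (n div 2))) = w @ concat (map (\<lambda>b. [True, b]) (bits n))"
      using False by (subst (2) bits.simps) simp
    show ?thesis using runs_mono[OF A le] unfolding eqw .
  qed
qed

text \<open>Register 4 takes the copy from which \<open>r\<close> is restored, register 1 the
  multiple that is consumed by writing its bits.\<close>

definition out_num :: "nat \<Rightarrow> nat \<Rightarrow> nat \<Rightarrow> com" where
  "out_num r m d = Seq (shift r (4 # replicate m 1)) (Seq (shift 4 [r]) (Seq (incs (replicate d 1)) (Seq out_bits (Out False))))"

definition out_num_time :: "nat \<Rightarrow> nat \<Rightarrow> nat \<Rightarrow> nat" where
  "out_num_time m d v = v * (Suc m + 3) + 1 + (v * 4 + 1 + (d + 1 + ((m * v + d) * (10 * (m * v + d) + 12) + 1 + 1)))"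

lemma out_num_time_mono: "v \<le> v' \<Longrightarrow> out_num_time m d v \<le> out_num_time m d v'"
  unfolding out_num_time_def by (intro add_mono mult_le_mono) auto

lemma runs_out_num:
  assumes "r = 0 \<or> 4 < r" "clean R"
  shows "runs x (out_num r m d) (h, R, w) (out_num_time m d (R r)) (h, R, w @ enc_nat (m * R r + d))"
proof -
  let ?v = "R r"
  let ?R1 = "R(4 := ?v, 1 := m * ?v, r := 0)"
  have e: "(\<lambda>i. R i + R r * count_list (4 # replicate m 1) i)(r := 0) = ?R1"
    using assms by (auto simp: clean_def count_list_replicate fun_eq_iff mult.commute)
  have 1: "runs x (shift r (4 # replicate m 1)) (h, R, w) (?v * (Suc m + 3) + 1) (h, ?R1, w)"
    using runs_shift[of r "4 # replicate m 1" x h R w] assms(1) unfolding e by auto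
  let ?R2 = "R(1 := m * ?v)"
  have e: "(\<lambda>i. ?R1 i + ?R1 4 * count_list [r] i)(4 := 0) = ?R2"
    using assms by (auto simp: clean_def fun_eq_iff)
  have 2: "runs x (shift 4 [r]) (h, ?R1, w) (?v * 4 + 1) (h, ?R2, w)"
    using runs_shift[of 4 "[r]" x h ?R1 w] assms(1) unfolding e by auto
  let ?R3 = "R(1 := m * ?v + d, 2 := 0, 3 := 0)"
  have e: "(\<lambda>i. ?R2 i + count_list (replicate d 1) i) = ?R3"
    using assms by (auto simp: clean_def count_list_replicate fun_eq_iff)
  have 3: "runs x (incs (replicate d 1)) (h, ?R2, w) (d + 1) (h, ?R3, w)"
    using runs_incs[of x "replicate d 1" h ?R2 w] unfolding e by simp
  have e: "R(1 := 0, 2 := 0, 3 := 0) = R" using assms by (auto simp: clean_def)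
  have 4: "runs x out_bits (h, ?R3, w) ((m * ?v + d) * (10 * (m * ?v + d) + 12) + 1)
     (h, R, w @ concat (map (\<lambda>b. [True, b]) (bits (m * ?v + d))))"
    using runs_out_bits[of x h R "m * ?v + d" w] unfolding e .
  have 5: "runs x (Out False) (h, R, w @ concat (map (\<lambda>b. [True, b]) (bits (m * ?v + d)))) 1 (h, R, w @ enc_nat (m * ?v + d))"
    using runs_Out[of x False h R "w @ concat (map (\<lambda>b. [True, b]) (bits (m * ?v + d)))"]
    by (simp add: enc_nat_def enc_list_def)
  show ?thesis
    unfolding out_num_def out_num_time_def by (intro runs_Seq[OF 1] runs_Seq[OF 2] runs_Seq[OF 3] runs_Seq[OF 4] 5)
qed

text \<open>\<open>Num r m d\<close> stands for the code of \<open>m * R r + d\<close>. All numbers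
  that vary within the instance have this form, so a whole gadget is a fixed list of tokens.\<close>

datatype token = Bit bool | Num nat nat nat

fun token_com :: "token \<Rightarrow> com" where
  "token_com (Bit b) = Out b"
| "token_com (Num r m d) = out_num r m d"

fun token_word :: "(nat \<Rightarrow> nat) \<Rightarrow> token \<Rightarrow> bool list" where
  "token_word R (Bit b) = [b]"
| "token_word R (Num r m d) = enc_nat (m * R r + d)"

fun token_time :: "nat \<Rightarrow> token \<Rightarrow> nat" where
  "token_time Z (Bit b) = 1"
| "token_time Z (Num r m d) = out_num_time m d Z"

fun token_ok :: "nat \<Rightarrow> (nat \<Rightarrow> nat) \<Rightarrow> token \<Rightarrow> bool" where
  "token_ok Z R (Bit b) = True"
| "token_ok Z R (Num r m d) = ((r = 0 \<or> 4 < r) \<and> R r \<le> Z)"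

definition out_tokens :: "token list \<Rightarrow> com" where
  "out_tokens ts = seqs (map token_com ts)"

fun tokens_time :: "token list \<Rightarrow> nat \<Rightarrow> nat" where
  "tokens_time [] Z = 1"
| "tokens_time (t # ts) Z = token_time Z t + tokens_time ts Z"

lemma poly_bounded_tokens_time:
  assumes "poly_bounded Z"
  shows "poly_bounded (\<lambda>n. tokens_time ts (Z n))"
proof (induction ts)
  case Nil
  then show ?case by (simp add: poly_bounded_const)
next
  case (Cons t ts)
  have "poly_bounded (\<lambda>n. token_time (Z n) t)"
    using assms by (cases t) (simp_all add: out_num_time_def poly_bounded_intros)
  then show ?case using Cons by (simp add: poly_bounded_add)
qed

lemma runs_out_tokens:
  assumes "clean R" "\<forall>t\<in>set ts. token_ok Z R t"
  shows "runs x (out_tokens ts) (h, R, w) (tokens_time ts Z) (h, R, w @ concat (map (token_word R) ts))"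
  using assms(2) unfolding out_tokens_def
proof (induction ts arbitrary: w)
  case Nil
  then show ?case using runs_Skip by simp
next
  case (Cons t ts)
  have "runs x (token_com t) (h, R, w) (token_time Z t) (h, R, w @ token_word R t)"
  proof (cases t)
    case (Bit b)
    then show ?thesis by (simp add: runs_Out[unfolded One_nat_def])
  next
    case (Num r m d)
    then show ?thesis
      using Cons.prems runs_out_num[OF _ assms(1), of r x m d h w] out_num_time_mono[of "R r" Z m d] runs_mono by auto
  qed
  then have "runs x (seqs (map token_com (t # ts))) (h, R, w) (token_time Z t + tokens_time ts Z)
      (h, R, (w @ token_word R t) @ concat (map (token_word R) ts))"
    unfolding list.map seqs.simps by (rule runs_Seq) (rule Cons.IH, use Cons.prems in simp)
  then show ?case by simp
qed

section \<open>Computations as tableaux of 3-clauses\<close>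

text \<open>Horn clauses cannot infer anything from the absence of a head, so
  \<open>HeadLeft\<close> and \<open>HeadRight\<close> state positively on which side it is.
  \<open>Read\<close> carries the scanned symbol to all columns, which makes the next action known
  locally.\<close>

datatype kind = Cell nat nat | Head nat | HeadLeft nat | HeadRight nat | Read nat nat | Comb nat "nat list"

text \<open>
  A reference names a fact relative to a row and the left neighbour of a column: the row offset
  (0 or 1), the column offset (0, 1 or 2) and the kind of fact. \<open>Comb q ss\<close> says that the state is
  \<open>q\<close> and the first tapes read \<open>ss\<close>; it is known in every column.
\<close>

type_synonym ref = "nat \<times> nat \<times> kind"
type_synonym ref_clause = "(bool \<times> ref) \<times> (bool \<times> ref) \<times> (bool \<times> ref)"

definition unit_clause :: "ref \<Rightarrow> ref_clause" where
  "unit_clause r = ((True, r), (True, r), (True, r))"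

definition horn_clause :: "ref \<Rightarrow> ref \<Rightarrow> ref \<Rightarrow> ref_clause" where
  "horn_clause p q c = ((False, p), (False, q), (True, c))"

definition read_symbols :: "tape list \<Rightarrow> nat list" where
  "read_symbols ts = map (\<lambda>(h, t). t h) ts"

fun fact :: "config \<Rightarrow> int \<Rightarrow> kind \<Rightarrow> bool" where
  "fact (q, ts) i (Cell j s) = (snd (ts ! j) i = s)"
| "fact (q, ts) i (Head j) = (fst (ts ! j) = i)"
| "fact (q, ts) i (HeadLeft j) = (fst (ts ! j) < i)"
| "fact (q, ts) i (HeadRight j) = (i < fst (ts ! j))"
| "fact (q, ts) i (Read j s) = (read_symbols ts ! j = s)"
| "fact (q, ts) i (Comb q' ss) = (q' = q \<and> ss = take (length ss) (read_symbols ts))"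

locale machine =
  fixes M :: tm
  assumes wf_M: "wf_tm M"
begin

text \<open>A halted machine repeats its configuration, so all runs can be given the common length
  \<open>T\<close>.\<close>

definition next_action :: "nat \<Rightarrow> nat list \<Rightarrow> nat \<times> (nat \<times> move) list" where
  "next_action q ss = (if q = 1 then (1, map (\<lambda>s. (s, Move_Stay)) ss) else delta M q ss)"

definition kinds :: "kind set" where
  "kinds = (\<lambda>(j, s). Cell j s) ` ({..<tapes M} \<times> {..<symbols M}) \<union> Head ` {..<tapes M} \<union>
     HeadLeft ` {..<tapes M} \<union> HeadRight ` {..<tapes M} \<union>
     (\<lambda>(j, s). Read j s) ` ({..<tapes M} \<times> {..<symbols M}) \<union>
     (\<lambda>(q, ss). Comb q ss) ` ({..<states M} \<times> {ss. set ss \<subseteq> {..<symbols M} \<and> length ss \<le> tapes M})"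

lemma finite_kinds: "finite kinds"
  unfolding kinds_def by (intro finite_UnI finite_imageI finite_cartesian_product finite_lists_length_le) auto

lemma kinds_iff:
  "Cell j s \<in> kinds \<longleftrightarrow> j < tapes M \<and> s < symbols M"
  "Head j \<in> kinds \<longleftrightarrow> j < tapes M" "HeadLeft j \<in> kinds \<longleftrightarrow> j < tapes M" "HeadRight j \<in> kinds \<longleftrightarrow> j < tapes M"
  "Read j s \<in> kinds \<longleftrightarrow> j < tapes M \<and> s < symbols M"
  "Comb q ss \<in> kinds \<longleftrightarrow> q < states M \<and> set ss \<subseteq> {..<symbols M} \<and> length ss \<le> tapes M"
  unfolding kinds_def by auto

lemma tapes_ge: "2 \<le> tapes M" and symbols_ge: "3 \<le> symbols M" and states_ge: "2 \<le> states M"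
  using wf_M by (simp_all add: wf_tm_def)

lemma next_action_valid:
  assumes "q < states M" "set ss \<subseteq> {..<symbols M}" "length ss = tapes M"
  shows "fst (next_action q ss) < states M" "length (snd (next_action q ss)) = tapes M"
    "fst ` set (snd (next_action q ss)) \<subseteq> {..<symbols M}"
proof -
  have "fst (next_action q ss) < states M \<and> length (snd (next_action q ss)) = tapes M \<and>
    fst ` set (snd (next_action q ss)) \<subseteq> {..<symbols M}"
  proof (cases "q = 1")
    case True
    then show ?thesis using assms states_ge by (auto simp: next_action_def)
  next
    case False
    have "case delta M q ss of (q', as) \<Rightarrow>
           q' < states M \<and> length as = tapes M \<and> fst ` set as \<subseteq> {..<symbols M}"
      using wf_M assms by (simp add: wf_tm_def)
    then show ?thesis using False by (simp add: next_action_def split_beta)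
  qed
  then show "fst (next_action q ss) < states M" "length (snd (next_action q ss)) = tapes M"
    "fst ` set (snd (next_action q ss)) \<subseteq> {..<symbols M}" by blast+
qed

text \<open>Column offset 1 is the cell itself, 0 and 2 are its neighbours. With two premises per
  rule the scanned symbols have to be appended to \<open>Comb\<close> one tape at a time; a rule
  with one premise repeats it.\<close>

inductive step_rule :: "ref \<Rightarrow> ref \<Rightarrow> ref \<Rightarrow> bool" where
  rule_read: "j < tapes M \<Longrightarrow> s < symbols M \<Longrightarrow> step_rule (0, 1, Cell j s) (0, 1, Head j) (0, 1, Read j s)"
| rule_read_left: "j < tapes M \<Longrightarrow> s < symbols M \<Longrightarrow> step_rule (0, 1, Read j s) (0, 1, Read j s) (0, 0, Read j s)"
| rule_read_right: "j < tapes M \<Longrightarrow> s < symbols M \<Longrightarrow> step_rule (0, 1, Read j s) (0, 1, Read j s) (0, 2, Read j s)"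
| rule_comb: "q < states M \<Longrightarrow> set ss \<subseteq> {..<symbols M} \<Longrightarrow> length ss < tapes M \<Longrightarrow> s < symbols M \<Longrightarrow>
    step_rule (0, 1, Comb q ss) (0, 1, Read (length ss) s) (0, 1, Comb q (ss @ [s]))"
| rule_state: "q < states M \<Longrightarrow> set ss \<subseteq> {..<symbols M} \<Longrightarrow> length ss = tapes M \<Longrightarrow>
    step_rule (0, 1, Comb q ss) (0, 1, Comb q ss) (1, 1, Comb (fst (next_action q ss)) [])"
| rule_write: "q < states M \<Longrightarrow> set ss \<subseteq> {..<symbols M} \<Longrightarrow> length ss = tapes M \<Longrightarrow> j < tapes M \<Longrightarrow>
    step_rule (0, 1, Comb q ss) (0, 1, Head j) (1, 1, Cell j (fst (snd (next_action q ss) ! j)))"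
| rule_move: "q < states M \<Longrightarrow> set ss \<subseteq> {..<symbols M} \<Longrightarrow> length ss = tapes M \<Longrightarrow> j < tapes M \<Longrightarrow>
    step_rule (0, 1, Comb q ss) (0, 1, Head j) (1, nat (1 + offset (snd (snd (next_action q ss) ! j))), Head j)"
| rule_left: "j < tapes M \<Longrightarrow> step_rule (0, 1, Head j) (0, 1, Head j) (0, 2, HeadLeft j)"
| rule_left_right: "j < tapes M \<Longrightarrow> step_rule (0, 1, HeadLeft j) (0, 1, HeadLeft j) (0, 2, HeadLeft j)"
| rule_right: "j < tapes M \<Longrightarrow> step_rule (0, 1, Head j) (0, 1, Head j) (0, 0, HeadRight j)"
| rule_right_left: "j < tapes M \<Longrightarrow> step_rule (0, 1, HeadRight j) (0, 1, HeadRight j) (0, 0, HeadRight j)"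
| rule_keep_left: "j < tapes M \<Longrightarrow> s < symbols M \<Longrightarrow> step_rule (0, 1, HeadLeft j) (0, 1, Cell j s) (1, 1, Cell j s)"
| rule_keep_right: "j < tapes M \<Longrightarrow> s < symbols M \<Longrightarrow> step_rule (0, 1, HeadRight j) (0, 1, Cell j s) (1, 1, Cell j s)"

definition refs :: "ref set" where
  "refs = {0, 1} \<times> {0, 1, 2} \<times> kinds"

lemma step_rule_refs: "step_rule p q c \<Longrightarrow> p \<in> refs \<and> q \<in> refs \<and> c \<in> refs"
proof -
  assume "step_rule p q c"
  then show ?thesis
  proof (cases rule: step_rule.cases)
    case (rule_state q ss)
    then show ?thesis using next_action_valid[of q ss] tapes_ge by (auto simp: refs_def kinds_iff)
  next
    case (rule_write q ss j)
    then have "fst (snd (next_action q ss) ! j) < symbols M"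
      using next_action_valid[of q ss] nth_mem[of j "snd (next_action q ss)"] by (metis image_subset_iff lessThan_iff)
    then show ?thesis using rule_write by (auto simp: refs_def kinds_iff)
  next
    case (rule_move q ss j)
    have "nat (1 + offset d) \<in> {0, 1, 2}" for d by (cases d) auto
    then show ?thesis using rule_move by (auto simp: refs_def kinds_iff)
  qed (auto simp: refs_def kinds_iff)
qed

lemma finite_refs: "finite refs"
  unfolding refs_def using finite_kinds by auto

definition base_facts :: "ref set" where
  "base_facts = insert (0, 1, Comb 0 []) ((\<lambda>j. (0, 1, Cell j 0)) ` {1..<tapes M})"

definition symbol_clauses :: "nat \<Rightarrow> ref_clause set" where
  "symbol_clauses s = unit_clause ` insert (0, 1, Cell 0 s) base_facts"

text \<open>The positive clause offers a blank and the two bits. The Horn clause passes a blank on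
  to the right, so that a certificate may be shorter than the guessed area. Nothing prevents a cell
  from having several symbols.\<close>

definition guess_clauses :: "ref_clause set" where
  "guess_clauses = unit_clause ` base_facts \<union>
     {((True, (0, 1, Cell 0 0)), (True, (0, 1, Cell 0 1)), (True, (0, 1, Cell 0 2))),
      horn_clause (0, 1, Cell 0 0) (0, 1, Cell 0 0) (0, 2, Cell 0 0)}"

definition head_clauses :: "ref_clause set" where
  "head_clauses = unit_clause ` (\<lambda>j. (0, 1, Head j)) ` {..<tapes M}"

definition rule_clauses :: "ref_clause set" where
  "rule_clauses = {horn_clause p q c | p q c. step_rule p q c}"

text \<open>Symbol 1 stands for the bit 0, so this forbids a negative answer in cell 0 of the output
  tape. It is the only clause without a positive literal.\<close>

definition final_clause :: ref_clause where
  "final_clause = ((False, (0, 1, Cell 1 1)), (False, (0, 1, Cell 1 1)), (False, (0, 1, Cell 1 1)))"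

definition ref_clauses :: "ref_clause set" where
  "ref_clauses = (UNIV \<times> refs) \<times> (UNIV \<times> refs) \<times> (UNIV \<times> refs)"

lemma finite_ref_clauses: "finite ref_clauses"
  unfolding ref_clauses_def using finite_refs by auto

lemma base_facts_refs: "base_facts \<subseteq> refs"
  using tapes_ge symbols_ge states_ge by (auto simp: base_facts_def refs_def kinds_iff)

lemma clauses_refs:
  "s < symbols M \<Longrightarrow> symbol_clauses s \<subseteq> ref_clauses" "guess_clauses \<subseteq> ref_clauses"
  "head_clauses \<subseteq> ref_clauses" "rule_clauses \<subseteq> ref_clauses" "{final_clause} \<subseteq> ref_clauses"
proof -
  have cell: "(0, 1, Cell j s) \<in> refs" "(0, 2, Cell j s) \<in> refs" if "j < tapes M" "s < symbols M" for j s
    using that by (auto simp: refs_def kinds_iff)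
  show "symbol_clauses s \<subseteq> ref_clauses" if "s < symbols M"
    using that base_facts_refs cell[of 0 s] tapes_ge
    by (auto simp: symbol_clauses_def ref_clauses_def unit_clause_def)
  show "guess_clauses \<subseteq> ref_clauses"
    using base_facts_refs cell[of 0] tapes_ge symbols_ge
    by (auto simp: guess_clauses_def ref_clauses_def unit_clause_def horn_clause_def)
  show "head_clauses \<subseteq> ref_clauses"
    by (auto simp: head_clauses_def ref_clauses_def unit_clause_def refs_def kinds_iff)
  show "rule_clauses \<subseteq> ref_clauses"
    using step_rule_refs by (auto simp: rule_clauses_def ref_clauses_def horn_clause_def)
  show "{final_clause} \<subseteq> ref_clauses"
    using cell[of 1 1] tapes_ge symbols_ge by (auto simp: final_clause_def ref_clauses_def)
qed

definition valid_config :: "nat \<Rightarrow> config \<Rightarrow> bool" where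
  "valid_config n c \<longleftrightarrow> fst c < states M \<and> length (snd c) = tapes M \<and>
     (\<forall>j<tapes M. \<bar>fst (snd c ! j)\<bar> \<le> int n \<and> (\<forall>i. snd (snd c ! j) i < symbols M))"

lemma valid_read_symbols:
  assumes "valid_config n (q, ts)"
  shows "length (read_symbols ts) = tapes M" "set (read_symbols ts) \<subseteq> {..<symbols M}" "q < states M"
proof -
  show "length (read_symbols ts) = tapes M" "q < states M"
    using assms by (simp_all add: valid_config_def read_symbols_def)
  show "set (read_symbols ts) \<subseteq> {..<symbols M}"
  proof
    fix s assume "s \<in> set (read_symbols ts)"
    then obtain j where "j < tapes M" "s = snd (ts ! j) (fst (ts ! j))"
      using assms by (auto simp: valid_config_def read_symbols_def in_set_conv_nth split_beta)
    then show "s \<in> {..<symbols M}" using assms by (simp add: valid_config_def)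
  qed
qed

lemma tm_step_next_action:
  assumes "length ts = tapes M" "length (snd (next_action q (read_symbols ts))) = tapes M"
  shows "tm_step M (q, ts) = (fst (next_action q (read_symbols ts)), map2 act (snd (next_action q (read_symbols ts))) ts)"
proof (cases "q = 1")
  case True
  have "map2 act (map (\<lambda>s. (s, Move_Stay)) (read_symbols ts)) ts = ts"
  proof (rule nth_equalityI)
    fix i assume "i < length (map2 act (map (\<lambda>s. (s, Move_Stay)) (read_symbols ts)) ts)"
    then show "map2 act (map (\<lambda>s. (s, Move_Stay)) (read_symbols ts)) ts ! i = ts ! i"
      by (cases "ts ! i") (auto simp: read_symbols_def)
  qed (simp add: read_symbols_def)
  then show ?thesis using True by (simp add: next_action_def)
next
  case False
  then show ?thesis by (simp add: next_action_def read_symbols_def split_beta)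
qed

lemma tm_step_tape:
  assumes "valid_config n (q, ts)" "j < tapes M"
  shows "snd (tm_step M (q, ts)) ! j = act (snd (next_action q (read_symbols ts)) ! j) (ts ! j)"
    "fst (tm_step M (q, ts)) = fst (next_action q (read_symbols ts))"
  using assms valid_read_symbols[OF assms(1)] next_action_valid[of q "read_symbols ts"] tm_step_next_action[of ts q]
  by (auto simp: valid_config_def)

lemma act_simps: "fst (act a tp) = fst tp + offset (snd a)" "snd (act a tp) = (snd tp)(fst tp := fst a)"
  by (cases a; cases tp; simp)+

lemma valid_step:
  assumes "valid_config n c"
  shows "valid_config (Suc n) (tm_step M c)"
proof -
  obtain q ts where c: "c = (q, ts)" by fastforce
  note v = valid_read_symbols[OF assms[unfolded c]]
  note t = next_action_valid[OF v(3,2,1)]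
  have "length (snd (tm_step M (q, ts))) = tapes M"
    using tm_step_next_action[of ts q] assms t(2) by (simp add: c valid_config_def)
  moreover have "\<bar>offset d\<bar> \<le> 1" for d by (cases d) auto
  then have "\<bar>fst (snd (tm_step M (q, ts)) ! j)\<bar> \<le> int (Suc n)" if "j < tapes M" for j
    using tm_step_tape(1)[OF assms[unfolded c] that] assms that
    by (simp add: c valid_config_def act_simps) (smt (verit, best))
  moreover have "snd (snd (tm_step M (q, ts)) ! j) i < symbols M" if "j < tapes M" for i j
  proof -
    have "fst (snd (next_action q (read_symbols ts)) ! j) < symbols M"
      using t(2,3) that nth_mem[of j "snd (next_action q (read_symbols ts))"] by (metis image_subset_iff lessThan_iff)
    then show ?thesis
      using tm_step_tape(1)[OF assms[unfolded c] that] assms that by (simp add: c valid_config_def act_simps)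
  qed
  ultimately show ?thesis
    using t(1) tm_step_tape(2)[OF assms[unfolded c], of 0] tapes_ge by (simp add: c valid_config_def)
qed

lemma valid_init: "valid_config 0 (init_config M y)"
proof -
  have "word_cells y i < symbols M" for i using symbols_ge by (auto simp: word_cells_def)
  then show ?thesis
    using tapes_ge states_ge symbols_ge by (auto simp: valid_config_def init_config_def nth_Cons split: nat.splits)
qed

lemma valid_run: "valid_config t ((tm_step M ^^ t) (init_config M y))"
  by (induction t) (simp_all add: valid_init valid_step del: tm_step.simps)

text \<open>The true facts of a real run are closed under the rules at every position of the tape;
  this makes the run a model of the Horn clauses.\<close>

lemma step_rule_sound:
  assumes r: "step_rule p q c" and v: "valid_config n (st, ts)"
    and p: "fact ((tm_step M ^^ fst p) (st, ts)) (i + int (fst (snd p))) (snd (snd p))"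
    and q: "fact ((tm_step M ^^ fst q) (st, ts)) (i + int (fst (snd q))) (snd (snd q))"
  shows "fact ((tm_step M ^^ fst c) (st, ts)) (i + int (fst (snd c))) (snd (snd c))"
proof -
  note v' = valid_read_symbols[OF v]
  have len: "length ts = tapes M" using v by (simp add: valid_config_def)
  obtain st' ts' where s: "tm_step M (st, ts) = (st', ts')" by fastforce
  have st': "st' = fst (next_action st (read_symbols ts))"
    using tm_step_tape(2)[OF v, of 0] tapes_ge s by simp
  have ts': "ts' ! j = act (snd (next_action st (read_symbols ts)) ! j) (ts ! j)" if "j < tapes M" for j
    using tm_step_tape(1)[OF v that] s by simp
  show ?thesis
    using r
  proof (cases rule: step_rule.cases)
    case (rule_read j s)
    then show ?thesis using p q len by (auto simp: read_symbols_def split_beta)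
  next
    case (rule_comb q ss s)
    then have ss: "ss = take (length ss) (read_symbols ts)" "read_symbols ts ! length ss = s" "q = st"
      using p q by auto
    then have "ss @ [s] = take (Suc (length ss)) (read_symbols ts)"
      using rule_comb v'(1) by (metis take_Suc_conv_app_nth)
    then show ?thesis using rule_comb ss v'(1) by simp
  next
    case (rule_state q ss)
    then have "ss = read_symbols ts" "q = st" using p v'(1) by auto
    then show ?thesis using rule_state s st' by (simp del: tm_step.simps)
  next
    case (rule_write q' ss j)
    then have "ss = read_symbols ts" "q' = st" "fst (ts ! j) = i + 1" using p q v'(1) by auto
    then show ?thesis using rule_write s ts' by (simp add: act_simps del: tm_step.simps)
  next
    case (rule_move q' ss j)
    \<comment> \<open>Offset 1 of the cell plus a move is again 0, 1 or 2, so \<open>nat\<close>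
      loses nothing.\<close>
    have off: "int (nat (1 + offset d)) = 1 + offset d" for d by (cases d) auto
    have nonneg: "0 \<le> 1 + offset d" for d by (cases d) auto
    have "ss = read_symbols ts" "q' = st" "fst (ts ! j) = i + 1" using rule_move p q v'(1) by auto
    then show ?thesis using rule_move s ts' by (simp add: act_simps off nonneg del: tm_step.simps)
  next
    case (rule_keep_left j s)
    then show ?thesis using p q s ts' by (auto simp: act_simps simp del: tm_step.simps)
  next
    case (rule_keep_right j s)
    then show ?thesis using p q s ts' by (auto simp: act_simps simp del: tm_step.simps)
  qed (use p q in auto)
qed

end

lemma length_pair_word: "length (pair_word x u) = 2 * length x + 2 + length u"
  by (induction x) (simp_all add: pair_word_def)

lemma nth_pair_word:
  "i < 2 * length x \<Longrightarrow> pair_word x u ! i = x ! (i div 2)"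
  "pair_word x u ! (2 * length x) = False" "pair_word x u ! Suc (2 * length x) = True"
  "i < length u \<Longrightarrow> pair_word x u ! (2 * length x + 2 + i) = u ! i"
proof -
  have len: "length (concat (map (\<lambda>b. [b, b]) x)) = 2 * length x" by (induction x) simp_all
  have "pair_word x u ! i = x ! (i div 2)" if i: "i < 2 * length x"
  proof -
    have "pair_word x u ! i = concat (map (\<lambda>b. [b, b]) x) ! i"
      using i len by (simp add: pair_word_def nth_append)
    also have "\<dots> = map (\<lambda>b. [b, b]) x ! (i div 2) ! (i mod 2)"
      using i by (intro nth_concat_blocks) auto
    also have "\<dots> = x ! (i div 2)"
    proof -
      have "i div 2 < length x" "i mod 2 = 0 \<or> i mod 2 = 1" using i by auto
      then show ?thesis by auto
    qed
    finally show ?thesis .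
  qed
  then show "i < 2 * length x \<Longrightarrow> pair_word x u ! i = x ! (i div 2)" .
  show "pair_word x u ! (2 * length x) = False" "pair_word x u ! Suc (2 * length x) = True"
    "i < length u \<Longrightarrow> pair_word x u ! (2 * length x + 2 + i) = u ! i"
    using len by (simp_all add: pair_word_def nth_append)
qed

text \<open>\<open>Q\<close> bounds the running time. The other summands of \<open>T\<close> make
  the paired word fit: it starts in the middle of the row and has at most
  \<open>2 * length x + 2 + P\<close> cells, and \<open>T + 1\<close> cells are available from there
  on. Kinds are numbered from 1 since variable 0 is reserved.\<close>

locale tableau = machine M for M +
  fixes x :: "bool list" and T P Q C :: nat and e :: "kind \<Rightarrow> nat"
  assumes inj_e: "inj_on e kinds" and e_range: "e ` kinds \<subseteq> {1..<C}"
    and T_eq: "T = 2 * length x + 1 + P + Q"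
begin

text \<open>The \<open>2 * T + 1\<close> cells that a head can visit, and a border column on either
  side that serves as a neighbour.\<close>

definition width :: nat where
  "width = 2 * T + 3"

text \<open>For a fixed kind this is affine in the cell number \<open>width * t + i\<close>, which a
  single counter can hold.\<close>

definition var :: "nat \<Rightarrow> nat \<Rightarrow> kind \<Rightarrow> nat" where
  "var t i \<kappa> = C * (width * t + i) + e \<kappa>"

fun lit_at :: "nat \<Rightarrow> nat \<Rightarrow> bool \<times> ref \<Rightarrow> literal" where
  "lit_at t i (s, dt, di, \<kappa>) = (s, var (t + dt) (i + di) \<kappa>)"

fun clause_at :: "nat \<Rightarrow> nat \<Rightarrow> ref_clause \<Rightarrow> clause3" where
  "clause_at t i (l1, l2, l3) = (lit_at t i l1, lit_at t i l2, lit_at t i l3)"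

text \<open>Cell \<open>a\<close> has tape position \<open>a - T\<close>, and the cases follow
  \<open>pair_word\<close>: doubled bits of \<open>x\<close>, the separator, then room for the
  certificate.\<close>

definition cell_clauses :: "nat \<Rightarrow> ref_clause set" where
  "cell_clauses a = (if a < T then symbol_clauses 0
     else if a < T + 2 * length x then symbol_clauses (if x ! ((a - T) div 2) then 2 else 1)
     else if a = T + 2 * length x then symbol_clauses 1
     else if a = T + 2 * length x + 1 then symbol_clauses 2
     else if a < T + 2 * length x + 2 + P then guess_clauses
     else symbol_clauses 0)"

definition tableau_clauses :: "clause3 set" where
  "tableau_clauses = (\<Union>a<2 * T + 1. clause_at 0 a ` cell_clauses a) \<union> clause_at 0 T ` head_clauses \<union>
     (\<Union>t<T. \<Union>a<2 * T + 1. clause_at t a ` rule_clauses) \<union> {clause_at T T final_clause}"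

lemma e_bounds: "\<kappa> \<in> kinds \<Longrightarrow> 0 < e \<kappa>" "\<kappa> \<in> kinds \<Longrightarrow> e \<kappa> < C"
  using e_range by fastforce+

lemma var_inject:
  assumes "\<kappa> \<in> kinds" "\<kappa>' \<in> kinds" "i < width" "i' < width" "var t i \<kappa> = var t' i' \<kappa>'"
  shows "t = t' \<and> i = i' \<and> \<kappa> = \<kappa>'"
proof -
  have "var t i \<kappa> div C = width * t + i" "var t i \<kappa> mod C = e \<kappa>"
    "var t' i' \<kappa>' div C = width * t' + i'" "var t' i' \<kappa>' mod C = e \<kappa>'"
    using e_bounds(2)[OF assms(1)] e_bounds(2)[OF assms(2)] by (simp_all add: var_def)
  then have *: "width * t + i = width * t' + i'" "e \<kappa> = e \<kappa>'" using assms(5) by simp_all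
  have "(width * t + i) div width = t" "(width * t + i) mod width = i"
    "(width * t' + i') div width = t'" "(width * t' + i') mod width = i'"
    using assms(3,4) by simp_all
  then show ?thesis using * inj_onD[OF inj_e _ assms(1,2)] by simp
qed

lemma clause_at_vars:
  assumes "cl \<in> ref_clauses" "t < T \<or> t = T \<and> (\<forall>l\<in>{fst cl, fst (snd cl), snd (snd cl)}. fst (snd l) = 0)" "a < 2 * T + 1"
  shows "clause_vars (clause_at t a cl) \<subseteq> {1..<C * (width * (T + 1))}"
proof -
  have *: "snd (lit_at t a l) \<in> {1..<C * (width * (T + 1))}"
    if l: "l \<in> UNIV \<times> refs" "t + fst (snd l) \<le> T" for l
  proof -
    obtain s dt di \<kappa> where eq: "l = (s, dt, di, \<kappa>)" by (metis surj_pair)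
    then have \<kappa>: "\<kappa> \<in> kinds" "di \<le> 2" "t + dt \<le> T" using l by (auto simp: refs_def)
    have "width * (t + dt) + (a + di) < width * (t + dt) + width"
      using assms(3) \<kappa>(2) by (simp add: width_def)
    also have "\<dots> = width * (t + dt + 1)" by simp
    also have "\<dots> \<le> width * (T + 1)" using \<kappa>(3) by (intro mult_le_mono) auto
    finally have "C * (width * (t + dt) + (a + di) + 1) \<le> C * (width * (T + 1))"
      by (intro mult_le_mono) auto
    then show ?thesis using e_bounds[OF \<kappa>(1)] by (simp add: eq var_def)
  qed
  obtain l1 l2 l3 where cl: "cl = (l1, l2, l3)" by (metis surj_pair)
  have "fst (snd l) \<le> 1" if "l \<in> UNIV \<times> refs" for l using that by (auto simp: refs_def)
  then have "t + fst (snd l) \<le> T" if "l \<in> {l1, l2, l3}" for l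
    using that assms(1,2) unfolding cl ref_clauses_def by fastforce
  then show ?thesis
    using assms(1) *[of l1] *[of l2] *[of l3] unfolding cl ref_clauses_def by simp
qed

lemma cell_clauses_refs: "cell_clauses a \<subseteq> ref_clauses"
  using clauses_refs symbols_ge by (simp add: cell_clauses_def)

lemma tableau_clauses_vars: "cl \<in> tableau_clauses \<Longrightarrow> clause_vars cl \<subseteq> {1..<C * (width * (T + 1))}"
proof -
  have T: "0 < T" using T_eq by simp
  assume "cl \<in> tableau_clauses"
  then consider (cell) a d where "a < 2 * T + 1" "d \<in> cell_clauses a" "cl = clause_at 0 a d"
    | (head) d where "d \<in> head_clauses" "cl = clause_at 0 T d"
    | (rule) t a d where "t < T" "a < 2 * T + 1" "d \<in> rule_clauses" "cl = clause_at t a d"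
    | (final) "cl = clause_at T T final_clause"
    unfolding tableau_clauses_def by blast
  then show ?thesis
  proof cases
    case cell
    then show ?thesis using clause_at_vars[of d 0 a] cell_clauses_refs T by blast
  next
    case head
    then show ?thesis using clause_at_vars[of d 0 T] clauses_refs T by auto
  next
    case rule
    then show ?thesis using clause_at_vars[of d t a] clauses_refs by blast
  next
    case final
    then show ?thesis using clause_at_vars[of final_clause T T] clauses_refs by (simp add: final_clause_def)
  qed
qed

definition content :: "bool list \<Rightarrow> nat \<Rightarrow> nat" where
  "content u a = word_cells (pair_word x u) (int a - int T)"

lemma content_eq:
  "content u a = (if a < T then 0
     else if a < T + 2 * length x then (if x ! ((a - T) div 2) then 2 else 1)
     else if a = T + 2 * length x then 1
     else if a = T + 2 * length x + 1 then 2
     else if a < T + 2 * length x + 2 + length u then (if u ! (a - (T + 2 * length x + 2)) then 2 else 1)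
     else 0)"
proof (cases "a < T")
  case True
  then show ?thesis by (simp add: content_def word_cells_def)
next
  case False
  then obtain b where b: "a = T + b" by (metis le_add_diff_inverse not_less)
  have "content u a = (if b < 2 * length x + 2 + length u then (if pair_word x u ! b then 2 else 1) else 0)"
    by (simp add: content_def word_cells_def b length_pair_word)
  moreover have "b = 2 * length x + 2 + (b - (2 * length x + 2))" if "\<not> b < 2 * length x" "b \<noteq> 2 * length x" "b \<noteq> 2 * length x + 1"
    using that by simp
  then have "pair_word x u ! b = u ! (b - (2 * length x + 2))"
    if "\<not> b < 2 * length x" "b \<noteq> 2 * length x" "b \<noteq> 2 * length x + 1" "b < 2 * length x + 2 + length u"
    using that nth_pair_word(4)[of "b - (2 * length x + 2)" u x] by simp
  ultimately show ?thesis
    using False nth_pair_word(1)[of b x u] nth_pair_word(2,3)[of x u] by (auto simp: b)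
qed

definition conf :: "bool list \<Rightarrow> nat \<Rightarrow> config" where
  "conf u t = (tm_step M ^^ t) (init_config M (pair_word x u))"

definition pos :: "nat \<Rightarrow> int" where
  "pos i = int i - int T - 1"

lemma conf_Suc: "conf u (Suc t) = tm_step M (conf u t)"
  by (simp add: conf_def)

lemma valid_conf: "valid_config t (conf u t)"
  unfolding conf_def by (rule valid_run)

lemma conf_0:
  "fst (conf u 0) = 0" "j < tapes M \<Longrightarrow> fst (snd (conf u 0) ! j) = 0"
  "snd (snd (conf u 0) ! 0) = word_cells (pair_word x u)"
  "1 \<le> j \<Longrightarrow> j < tapes M \<Longrightarrow> snd (snd (conf u 0) ! j) = (\<lambda>_. 0)"
  by (auto simp: conf_def init_config_def nth_Cons split: nat.splits)

lemma fact_base: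
  assumes "r \<in> base_facts"
  shows "fst r = 0 \<and> fact (conf u 0) i (snd (snd r))"
  using assms conf_0(1)[of u] conf_0(4)[of _ u] unfolding base_facts_def
  by (cases "conf u 0") auto

lemma fact_Cell: "fact c i (Cell j s) \<longleftrightarrow> snd (snd c ! j) i = s"
  and fact_Head: "fact c i (Head j) \<longleftrightarrow> fst (snd c ! j) = i"
  by (cases c; simp)+

text \<open>Inside the tableau the assignment makes exactly the true facts of the run true. The
  rules are sound for them, and the guess clauses hold because the tape has one of three symbols in
  each guessed cell and only blanks behind the word.\<close>

lemma run_satisfies:
  assumes u: "length u \<le> P" and acc: "snd (snd (conf u T) ! 1) 0 \<noteq> 1"
  shows "\<exists>\<nu>. \<forall>cl\<in>tableau_clauses. clause_true \<nu> cl"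
proof -
  define \<nu> where "\<nu> v = (\<exists>t i \<kappa>. \<kappa> \<in> kinds \<and> i < width \<and> v = var t i \<kappa> \<and> fact (conf u t) (pos i) \<kappa>)" for v
  have \<nu>: "\<nu> (var t i \<kappa>) \<longleftrightarrow> fact (conf u t) (pos i) \<kappa>" if "\<kappa> \<in> kinds" "i < width" for t i \<kappa>
    using that var_inject unfolding \<nu>_def by blast
  have lit: "lit_true \<nu> (lit_at t a (s, dt, di, \<kappa>)) \<longleftrightarrow> fact (conf u (t + dt)) (pos (a + di)) \<kappa> = s"
    if "(dt, di, \<kappa>) \<in> refs" "a < 2 * T + 1" for t a s dt di \<kappa>
    using that \<nu>[of \<kappa> "a + di" "t + dt"] by (auto simp: refs_def width_def)
  have unit: "clause_true \<nu> (clause_at t a (unit_clause (dt, di, \<kappa>)))"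
    if "(dt, di, \<kappa>) \<in> refs" "a < 2 * T + 1" "fact (conf u (t + dt)) (pos (a + di)) \<kappa>" for t a dt di \<kappa>
    using that lit[OF that(1,2), of t True] unfolding unit_clause_def clause_at.simps clause_true.simps by blast
  have base: "clause_true \<nu> (clause_at 0 a (unit_clause r))" if "r \<in> base_facts" "a < 2 * T + 1" for a r
  proof -
    obtain dt di \<kappa> where r: "r = (dt, di, \<kappa>)" by (metis surj_pair)
    show ?thesis
      using fact_base[OF that(1), of u "pos (a + di)"] base_facts_refs that unfolding r by (intro unit) auto
  qed
  have pos1: "pos (a + 1) = int a - int T" for a by (simp add: pos_def)
  have Cell0: "(0, 1, Cell 0 s) \<in> refs" "(0, 2, Cell 0 s) \<in> refs" if "s \<le> 2" for s
    using that symbols_ge tapes_ge by (auto simp: refs_def kinds_iff)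
  have fact0: "fact (conf u 0) (pos (a + 1)) (Cell 0 s) \<longleftrightarrow> content u a = s" for a s
    unfolding fact_Cell conf_0(3) pos1 content_def ..
  have symb: "clause_true \<nu> cl" if "cl \<in> clause_at 0 a ` symbol_clauses (content u a)" "a < 2 * T + 1" for a cl
  proof -
    have "content u a \<le> 2" by (simp add: content_def word_cells_def)
    then have "clause_true \<nu> (clause_at 0 a (unit_clause (0, 1, Cell 0 (content u a))))"
      using Cell0 fact0 that by (intro unit) auto
    then show ?thesis using that base[OF _ that(2)] unfolding symbol_clauses_def by blast
  qed
  have guess: "clause_true \<nu> cl"
    if "cl \<in> clause_at 0 a ` guess_clauses" "a < 2 * T + 1" "T + 2 * length x + 2 \<le> a" for a cl
  proof -
    have c: "content u a = 0 \<or> content u a = 1 \<or> content u a = 2" by (simp add: content_def word_cells_def)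
    have "pos (a + 2) = pos (Suc a + 1)" by simp
    then have next_cell: "fact (conf u 0) (pos (a + 2)) (Cell 0 0) \<longleftrightarrow> content u (Suc a) = 0" using fact0 by metis
    \<comment> \<open>Behind the separator the first blank ends the word.\<close>
    have "content u (Suc a) = 0" if "content u a = 0" using that \<open>T + 2 * length x + 2 \<le> a\<close> by (simp add: content_eq split: if_splits)
    moreover have l1: "lit_true \<nu> (lit_at 0 a (False, 0, 1, Cell 0 0)) \<longleftrightarrow> content u a \<noteq> 0"
      using lit[OF Cell0(1)[of 0] that(2), of 0 False] fact0[of a 0] by (simp del: lit_at.simps)
    moreover have l2: "lit_true \<nu> (lit_at 0 a (True, 0, 2, Cell 0 0)) \<longleftrightarrow> content u (Suc a) = 0"
      using lit[OF Cell0(2)[of 0] that(2), of 0 True] next_cell by (simp del: lit_at.simps)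
    ultimately have "clause_true \<nu> (clause_at 0 a (horn_clause (0, 1, Cell 0 0) (0, 1, Cell 0 0) (0, 2, Cell 0 0)))"
      unfolding horn_clause_def clause_at.simps clause_true.simps by blast
    moreover have "clause_true \<nu> (clause_at 0 a ((True, (0, 1, Cell 0 0)), (True, (0, 1, Cell 0 1)), (True, (0, 1, Cell 0 2))))"
      using lit[OF Cell0(1)[of 0] that(2), of 0 True] lit[OF Cell0(1)[of 1] that(2), of 0 True]
        lit[OF Cell0(1)[of 2] that(2), of 0 True] fact0[of a] c
      unfolding clause_at.simps clause_true.simps by simp
    ultimately show ?thesis using that base[OF _ that(2)] unfolding guess_clauses_def by blast
  qed
  have "clause_true \<nu> cl" if "cl \<in> tableau_clauses" for cl
  proof -
    consider (cell) a where "a < 2 * T + 1" "cl \<in> clause_at 0 a ` cell_clauses a"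
      | (head) j where "j < tapes M" "cl = clause_at 0 T (unit_clause (0, 1, Head j))"
      | (rule) t a p q c where "t < T" "a < 2 * T + 1" "step_rule p q c" "cl = clause_at t a (horn_clause p q c)"
      | (final) "cl = clause_at T T final_clause"
      using \<open>cl \<in> tableau_clauses\<close> unfolding tableau_clauses_def head_clauses_def rule_clauses_def by blast
    then show ?thesis
    proof cases
      case cell
      \<comment> \<open>Outside the guessed cells the prescribed symbol agrees with the paired word,
        because \<open>u\<close> has at most \<open>P\<close> bits.\<close>
      consider "T + 2 * length x + 2 \<le> a" "cell_clauses a = guess_clauses" | "cell_clauses a = symbol_clauses (content u a)"
      proof (cases "T + 2 * length x + 2 \<le> a \<and> a < T + 2 * length x + 2 + P")
        case True
        then show ?thesis using that(1) by (simp add: cell_clauses_def)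
      next
        case False
        then have "cell_clauses a = symbol_clauses (content u a)"
          using u unfolding cell_clauses_def content_eq by auto
        then show ?thesis by (rule that(2))
      qed
      then show ?thesis using symb guess cell by cases auto
    next
      case head
      have "(0, 1, Head j) \<in> refs" using head by (simp add: refs_def kinds_iff)
      moreover have "fact (conf u (0 + 0)) (pos (T + 1)) (Head j)"
        using head conf_0(2)[of j u] by (simp add: fact_Head pos_def)
      ultimately show ?thesis unfolding head(2) by (intro unit) auto
    next
      case rule
      obtain pt pd pk qt qi qk ct ci ck where pqc: "p = (pt, pd, pk)" "q = (qt, qi, qk)" "c = (ct, ci, ck)"
        by (metis surj_pair)
      have posa: "pos (a + d) = pos a + int d" for d by (simp add: pos_def)
      obtain st ts where c: "conf u t = (st, ts)" by fastforce
      have it: "conf u (t + d) = (tm_step M ^^ d) (st, ts)" for d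
        unfolding c[symmetric] conf_def by (simp add: funpow_add add.commute[of t])
      have "fact (conf u (t + pt)) (pos (a + pd)) pk \<Longrightarrow> fact (conf u (t + qt)) (pos (a + qi)) qk \<Longrightarrow>
          fact (conf u (t + ct)) (pos (a + ci)) ck"
        using step_rule_sound[OF rule(3), of t st ts "pos a"] valid_conf[of t u] unfolding it posa by (simp add: c pqc)
      moreover have "p \<in> refs" "q \<in> refs" "c \<in> refs" using step_rule_refs[OF rule(3)] by auto
      ultimately show ?thesis
        using lit[of pt pd pk a t False] lit[of qt qi qk a t False] lit[of ct ci ck a t True] rule(2)
        unfolding rule(4) pqc horn_clause_def clause_at.simps clause_true.simps by blast
    next
      case final
      have "(0, 1, Cell 1 1) \<in> refs" using tapes_ge symbols_ge by (simp add: refs_def kinds_iff)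
      moreover have "\<not> fact (conf u (T + 0)) (pos (T + 1)) (Cell 1 1)" using acc by (simp add: fact_Cell pos_def)
      ultimately show ?thesis
        using lit[of 0 1 "Cell 1 1" T T False] unfolding final final_clause_def clause_at.simps clause_true.simps by auto
    qed
  qed
  then show ?thesis by blast
qed

section \<open>From a satisfying assignment to a run that does not reject\<close>

lemma spread_right:
  assumes "\<And>a. a < 2 * T + 1 \<Longrightarrow> D (Suc a) \<Longrightarrow> D (a + 2)" "D i0" "1 \<le> i0" "i0 \<le> i" "i \<le> 2 * T + 2"
  shows "D i"
  using assms(4,5)
proof (induction i rule: dec_induct)
  case (step i)
  then obtain a where "i = Suc a" using assms(3) by (cases i) auto
  then show ?case using step assms(1)[of a] by simp
qed (rule assms(2))

lemma spread_left:
  assumes "\<And>a. a < 2 * T + 1 \<Longrightarrow> D (Suc a) \<Longrightarrow> D a" "D i0" "i0 \<le> 2 * T + 1" "i \<le> i0"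
  shows "D i"
  using assms(4)
proof (induction i rule: inc_induct)
  case (step i)
  then show ?case using assms(1)[of i] assms(3) by simp
qed (rule assms(2))

definition head_column :: "config \<Rightarrow> nat \<Rightarrow> nat" where
  "head_column c j = nat (fst (snd c ! j) + int T + 1)"

text \<open>Only one direction is claimed: the facts of the run hold under \<open>\<nu>\<close>, but
  others may hold too. The border columns are left out, as no clause is centred there.\<close>

definition derived_row :: "(nat \<Rightarrow> bool) \<Rightarrow> nat \<Rightarrow> config \<Rightarrow> bool" where
  "derived_row \<nu> t c \<longleftrightarrow>
     (\<forall>a<2 * T + 1. \<nu> (var t (Suc a) (Comb (fst c) [])) \<and>
        (\<forall>j<tapes M. \<nu> (var t (Suc a) (Cell j (snd (snd c ! j) (pos (Suc a))))))) \<and>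
     (\<forall>j<tapes M. \<nu> (var t (head_column c j) (Head j)))"

context
  fixes \<nu> :: "nat \<Rightarrow> bool"
  assumes sat: "\<And>cl. cl \<in> tableau_clauses \<Longrightarrow> clause_true \<nu> cl"
begin

lemma apply_rule:
  assumes "step_rule (pt, pd, pk) (qt, qi, qk) (ct, ci, ck)" "t < T" "a < 2 * T + 1"
    "\<nu> (var (t + pt) (a + pd) pk)" "\<nu> (var (t + qt) (a + qi) qk)"
  shows "\<nu> (var (t + ct) (a + ci) ck)"
proof -
  have "horn_clause (pt, pd, pk) (qt, qi, qk) (ct, ci, ck) \<in> rule_clauses"
    using assms(1) unfolding rule_clauses_def by blast
  then have "clause_at t a (horn_clause (pt, pd, pk) (qt, qi, qk) (ct, ci, ck)) \<in> tableau_clauses"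
    using assms(2,3) unfolding tableau_clauses_def by blast
  from sat[OF this] show ?thesis using assms(4,5) by (simp add: horn_clause_def)
qed

text \<open>Within row \<open>t\<close> the scanned symbols are derived at the heads, spread over
  the row and collected, and the sides of the heads are spread likewise. Then a single rule gives
  each fact of the next row.\<close>

lemma derived_row_step:
  assumes t: "t < T" and d: "derived_row \<nu> t c" and v: "valid_config t c"
  shows "derived_row \<nu> (Suc t) (tm_step M c)"
proof -
  obtain q ts where c: "c = (q, ts)" by fastforce
  define rs where "rs = read_symbols ts"
  note v' = valid_read_symbols[OF v[unfolded c], folded rs_def]
  have len: "length ts = tapes M" using v by (simp add: c valid_config_def)
  note act = next_action_valid[OF v'(3,2,1)]
  \<comment> \<open>Since \<open>t < T\<close>, each head is in an interior column, on which clauses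
    are centred.\<close>
  have heads: "\<exists>a. a < 2 * T + 1 \<and> head_column c j = Suc a \<and> fst (ts ! j) = pos (Suc a)" if "j < tapes M" for j
  proof -
    have "\<bar>fst (ts ! j)\<bar> \<le> int t" using v that by (simp add: c valid_config_def)
    then show ?thesis
      using t by (intro exI[of _ "nat (fst (ts ! j) + int T)"]) (auto simp: head_column_def c pos_def)
  qed
  have comb0: "\<nu> (var t (Suc a) (Comb q []))" if "a < 2 * T + 1" for a
    using d that by (simp add: derived_row_def c)
  have cell: "\<nu> (var t (Suc a) (Cell j (snd (ts ! j) (pos (Suc a)))))" if "a < 2 * T + 1" "j < tapes M" for a j
    using d that by (simp add: derived_row_def c)
  have head: "\<nu> (var t (head_column c j) (Head j))" if "j < tapes M" for j
    using d that by (simp add: derived_row_def)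
  have symb: "snd (ts ! j) i < symbols M" if "j < tapes M" for i j
    using v that by (simp add: c valid_config_def)
  have rs: "rs ! j < symbols M" "rs ! j = snd (ts ! j) (fst (ts ! j))" if "j < tapes M" for j
    using symb[OF that] that len by (simp_all add: rs_def read_symbols_def split_beta)
  have read: "\<nu> (var t i (Read j (rs ! j)))" if j: "j < tapes M" and i: "i \<le> 2 * T + 2" for i j
  proof -
    obtain h where h: "h < 2 * T + 1" "head_column c j = Suc h" "fst (ts ! j) = pos (Suc h)" using heads[OF j] by blast
    have start: "\<nu> (var t (Suc h) (Read j (rs ! j)))"
      using apply_rule[OF rule_read[OF j rs(1)[OF j]] t h(1)] cell[OF h(1) j] head[OF j] h rs(2)[OF j] by simp
    have spread: "\<nu> (var t (Suc a) (Read j (rs ! j))) \<Longrightarrow> \<nu> (var t (a + 2) (Read j (rs ! j)))"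
      "\<nu> (var t (Suc a) (Read j (rs ! j))) \<Longrightarrow> \<nu> (var t a (Read j (rs ! j)))" if "a < 2 * T + 1" for a
      using apply_rule[OF rule_read_right[OF j rs(1)[OF j]] t that] apply_rule[OF rule_read_left[OF j rs(1)[OF j]] t that]
      by simp_all
    show ?thesis
    proof (cases "i \<le> Suc h")
      case True
      show ?thesis
        by (rule spread_left[where D = "\<lambda>i. \<nu> (var t i (Read j (rs ! j)))", OF spread(2) start]) (use h True in auto)
    next
      case False
      show ?thesis
        by (rule spread_right[where D = "\<lambda>i. \<nu> (var t i (Read j (rs ! j)))", OF spread(1) start]) (use i False in auto)
    qed
  qed
  have comb: "\<nu> (var t (Suc a) (Comb q (take l rs)))" if "a < 2 * T + 1" "l \<le> tapes M" for a l
    using that(2)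
  proof (induction l)
    case 0
    then show ?case using comb0[OF that(1)] by simp
  next
    case (Suc l)
    have "set (take l rs) \<subseteq> {..<symbols M}" using v'(2) set_take_subset[of l rs] by blast
    then have "\<nu> (var t (Suc a) (Comb q (take l rs @ [rs ! l])))"
      using apply_rule[OF rule_comb[of q "take l rs" "rs ! l"] t that(1)] Suc v' rs(1)[of l] read[of l "Suc a"] that(1) by simp
    then show ?case using Suc.prems v'(1) by (simp add: take_Suc_conv_app_nth)
  qed
  have full: "\<nu> (var t (Suc a) (Comb q rs))" if "a < 2 * T + 1" for a
    using comb[OF that, of "tapes M"] v'(1) by simp
  have left: "\<nu> (var t i (HeadLeft j))" if j: "j < tapes M" and i: "head_column c j < i" "i \<le> 2 * T + 2" for i j
  proof -
    obtain h where h: "h < 2 * T + 1" "head_column c j = Suc h" using heads[OF j] by blast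
    have start: "\<nu> (var t (h + 2) (HeadLeft j))"
      using apply_rule[OF rule_left[OF j] t h(1)] head[OF j] h by simp
    have spread: "\<nu> (var t (Suc a) (HeadLeft j)) \<Longrightarrow> \<nu> (var t (a + 2) (HeadLeft j))" if "a < 2 * T + 1" for a
      using apply_rule[OF rule_left_right[OF j] t that] by simp
    show ?thesis
      by (rule spread_right[where D = "\<lambda>i. \<nu> (var t i (HeadLeft j))", OF spread start]) (use h i in auto)
  qed
  have right: "\<nu> (var t i (HeadRight j))" if j: "j < tapes M" and i: "i < head_column c j" for i j
  proof -
    obtain h where h: "h < 2 * T + 1" "head_column c j = Suc h" using heads[OF j] by blast
    have start: "\<nu> (var t h (HeadRight j))"
      using apply_rule[OF rule_right[OF j] t h(1)] head[OF j] h by simp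
    have spread: "\<nu> (var t (Suc a) (HeadRight j)) \<Longrightarrow> \<nu> (var t a (HeadRight j))" if "a < 2 * T + 1" for a
      using apply_rule[OF rule_right_left[OF j] t that] by simp
    show ?thesis
      by (rule spread_left[where D = "\<lambda>i. \<nu> (var t i (HeadRight j))", OF spread start]) (use h i in auto)
  qed
  have step: "snd (tm_step M c) ! j = act (snd (next_action q rs) ! j) (ts ! j)" if "j < tapes M" for j
    using tm_step_tape(1)[OF v[unfolded c] that] by (simp add: c rs_def del: tm_step.simps)
  have state: "fst (tm_step M c) = fst (next_action q rs)"
    using tm_step_tape(2)[OF v[unfolded c], of 0] tapes_ge by (simp add: c rs_def del: tm_step.simps)
  show ?thesis
    unfolding derived_row_def
  proof (intro conjI allI impI)
    fix a assume a: "a < 2 * T + 1"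
    show "\<nu> (var (Suc t) (Suc a) (Comb (fst (tm_step M c)) []))"
      using apply_rule[OF rule_state[OF v'(3,2,1)] t a] full[OF a] by (simp add: state del: tm_step.simps)
    fix j assume j: "j < tapes M"
    obtain h where h: "h < 2 * T + 1" "head_column c j = Suc h" "fst (ts ! j) = pos (Suc h)" using heads[OF j] by blast
    show "\<nu> (var (Suc t) (Suc a) (Cell j (snd (snd (tm_step M c) ! j) (pos (Suc a)))))"
    proof (cases "a = h")
      case True
      then show ?thesis
        using apply_rule[OF rule_write[OF v'(3,2,1) j] t a] full[OF a] head[OF j] h
        by (simp add: step[OF j] act_simps del: tm_step.simps)
    next
      case False
      then have "snd (snd (tm_step M c) ! j) (pos (Suc a)) = snd (ts ! j) (pos (Suc a))"
        using h(3) by (simp add: step[OF j] act_simps pos_def del: tm_step.simps)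
      moreover have "\<nu> (var (Suc t) (Suc a) (Cell j (snd (ts ! j) (pos (Suc a)))))"
      proof (cases "h < a")
        case True
        then show ?thesis
          using apply_rule[OF rule_keep_left[OF j symb[OF j]] t a] left[OF j, of "Suc a"] cell[OF a j] h a by simp
      next
        case False
        then show ?thesis
          using apply_rule[OF rule_keep_right[OF j symb[OF j]] t a] right[OF j, of "Suc a"] cell[OF a j] h a \<open>a \<noteq> h\<close> by simp
      qed
      ultimately show ?thesis by simp
    qed
  next
    fix j assume j: "j < tapes M"
    obtain h where h: "h < 2 * T + 1" "head_column c j = Suc h" "fst (ts ! j) = pos (Suc h)" using heads[OF j] by blast
    let ?d = "snd (snd (next_action q rs) ! j)"
    have "0 \<le> 1 + offset ?d" by (cases ?d) auto
    then have "head_column (tm_step M c) j = h + nat (1 + offset ?d)"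
      using h(3) by (simp add: head_column_def step[OF j] act_simps pos_def del: tm_step.simps)
    then show "\<nu> (var (Suc t) (head_column (tm_step M c) j) (Head j))"
      using apply_rule[OF rule_move[OF v'(3,2,1) j] t h(1)] full[OF h(1)] head[OF j] h(2)
      by (simp del: tm_step.simps)
  qed
qed

lemma derived_row_0:
  assumes cells: "\<And>a. a < 2 * T + 1 \<Longrightarrow> \<nu> (var 0 (Suc a) (Cell 0 (content u a)))"
  shows "derived_row \<nu> 0 (conf u 0)"
proof -
  have "clause_true \<nu> (clause_at 0 a (unit_clause r))" if "a < 2 * T + 1" "r \<in> base_facts" for a r
  proof -
    have "unit_clause r \<in> cell_clauses a"
      using that by (auto simp: cell_clauses_def symbol_clauses_def guess_clauses_def)
    then show ?thesis using that(1) by (intro sat) (auto simp: tableau_clauses_def)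
  qed
  then have base: "\<nu> (var dt (a + di) \<kappa>)" if "a < 2 * T + 1" "(dt, di, \<kappa>) \<in> base_facts" for a dt di \<kappa>
    using that by (fastforce simp: unit_clause_def)
  have "clause_at 0 T (unit_clause (0, 1, Head j)) \<in> tableau_clauses" if "j < tapes M" for j
    using that unfolding tableau_clauses_def head_clauses_def by blast
  then have head: "\<nu> (var 0 (Suc T) (Head j))" if "j < tapes M" for j
    using sat that by (fastforce simp: unit_clause_def)
  show ?thesis
    unfolding derived_row_def
  proof (intro conjI allI impI)
    fix a assume a: "a < 2 * T + 1"
    show "\<nu> (var 0 (Suc a) (Comb (fst (conf u 0)) []))"
      using base[OF a, of 0 1 "Comb 0 []"] by (simp add: conf_0 base_facts_def)
    fix j assume j: "j < tapes M"
    show "\<nu> (var 0 (Suc a) (Cell j (snd (snd (conf u 0) ! j) (pos (Suc a)))))"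
    proof (cases "j = 0")
      case True
      then show ?thesis using cells[OF a] by (simp add: conf_0(3) content_def pos_def)
    next
      case False
      then show ?thesis using base[OF a, of 0 1 "Cell j 0"] j conf_0(4)[of j u] by (simp add: base_facts_def)
    qed
  next
    fix j assume "j < tapes M"
    then show "\<nu> (var 0 (head_column (conf u 0) j) (Head j))"
      using head[of j] conf_0(2)[of j u] by (simp add: head_column_def nat_add_distrib)
  qed
qed

text \<open>The certificate is read off the guessed cells up to the first true blank. Cells with
  several true symbols do no harm: it is enough that the symbols chosen for \<open>u\<close> are
  true, as the rules then force the facts of the run on \<open>u\<close>.\<close>

lemma satisfying_run: "\<exists>u. length u \<le> P \<and> snd (snd (conf u T) ! 1) 0 \<noteq> 1"
proof -
  let ?b = "T + 2 * length x + 2"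
  have cell_sat: "clause_true \<nu> (clause_at 0 a cl)" if "a < 2 * T + 1" "cl \<in> cell_clauses a" for a cl
    using that by (intro sat) (auto simp: tableau_clauses_def)
  have guess: "\<nu> (var 0 (Suc (?b + i)) (Cell 0 0)) \<or> \<nu> (var 0 (Suc (?b + i)) (Cell 0 1)) \<or> \<nu> (var 0 (Suc (?b + i)) (Cell 0 2))"
    "\<nu> (var 0 (Suc (?b + i)) (Cell 0 0)) \<Longrightarrow> \<nu> (var 0 (Suc (?b + Suc i)) (Cell 0 0))" if "i < P" for i
  proof -
    have c: "cell_clauses (?b + i) = guess_clauses" using that by (simp add: cell_clauses_def)
    have b: "?b + i < 2 * T + 1" using that T_eq by simp
    show "\<nu> (var 0 (Suc (?b + i)) (Cell 0 0)) \<or> \<nu> (var 0 (Suc (?b + i)) (Cell 0 1)) \<or> \<nu> (var 0 (Suc (?b + i)) (Cell 0 2))"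
      using cell_sat[OF b, of "((True, (0, 1, Cell 0 0)), (True, (0, 1, Cell 0 1)), (True, (0, 1, Cell 0 2)))"]
      unfolding c guess_clauses_def by simp
    show "\<nu> (var 0 (Suc (?b + Suc i)) (Cell 0 0))" if "\<nu> (var 0 (Suc (?b + i)) (Cell 0 0))"
      using cell_sat[OF b, of "horn_clause (0, 1, Cell 0 0) (0, 1, Cell 0 0) (0, 2, Cell 0 0)"] that
      unfolding c guess_clauses_def by (simp add: horn_clause_def)
  qed
  \<comment> \<open>The alternative \<open>i = P\<close> covers a certificate that fills all guessed
    cells.\<close>
  define l where "l = (LEAST i. i = P \<or> \<nu> (var 0 (Suc (?b + i)) (Cell 0 0)))"
  have l: "l \<le> P" unfolding l_def by (rule Least_le) simp
  have l_end: "l = P \<or> \<nu> (var 0 (Suc (?b + l)) (Cell 0 0))"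
    unfolding l_def by (rule LeastI[of _ P]) simp
  have before: "\<not> \<nu> (var 0 (Suc (?b + i)) (Cell 0 0))" if "i < l" for i
    using not_less_Least[OF that[unfolded l_def]] by blast
  have after: "\<nu> (var 0 (Suc (?b + i)) (Cell 0 0))" if "l \<le> i" "i < P" for i
    using that
  proof (induction i rule: dec_induct)
    case base
    then show ?case using l_end by auto
  next
    case (step i)
    then show ?case using guess(2)[of i] by simp
  qed
  \<comment> \<open>Where symbol 2 is false, symbol 1 must be true, because the blank is false
    before \<open>l\<close>.\<close>
  define u where "u = map (\<lambda>i. \<nu> (var 0 (Suc (?b + i)) (Cell 0 2))) [0..<l]"
  have len: "length u = l" by (simp add: u_def)
  have "derived_row \<nu> 0 (conf u 0)"
  proof (rule derived_row_0)
    fix a assume a: "a < 2 * T + 1"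
    show "\<nu> (var 0 (Suc a) (Cell 0 (content u a)))"
    proof (cases "?b \<le> a \<and> a < ?b + P")
      case True
      then obtain i where i: "a = ?b + i" "i < P" by (metis add_less_cancel_left le_add_diff_inverse)
      show ?thesis
      proof (cases "i < l")
        case True
        then show ?thesis using guess(1)[OF i(2)] before[OF True] i by (auto simp: content_eq len) (auto simp: u_def)
      next
        case False
        then show ?thesis using after[of i] i by (simp add: content_eq len)
      qed
    next
      case False
      then have "cell_clauses a = symbol_clauses (content u a)"
        using l unfolding cell_clauses_def content_eq len by auto
      then show ?thesis
        using cell_sat[OF a, of "unit_clause (0, 1, Cell 0 (content u a))"] by (simp add: symbol_clauses_def unit_clause_def)
    qed
  qed
  then have row: "derived_row \<nu> t (conf u t)" if "t \<le> T" for t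
    using that
  proof (induction t)
    case (Suc t)
    then show ?case using derived_row_step[OF _ _ valid_conf, of t u] unfolding conf_Suc by simp
  qed
  have "clause_true \<nu> (clause_at T T final_clause)" by (intro sat) (simp add: tableau_clauses_def)
  then have "\<not> \<nu> (var T (Suc T) (Cell 1 1))" by (simp add: final_clause_def)
  moreover have "\<nu> (var T (Suc T) (Cell 1 (snd (snd (conf u T) ! 1) (pos (Suc T)))))"
    using row[of T] tapes_ge by (simp add: derived_row_def)
  ultimately have "snd (snd (conf u T) ! 1) (pos (Suc T)) \<noteq> 1" by metis
  then show ?thesis using l len by (intro exI[of _ u]) (simp add: pos_def)
qed

end

theorem tableau_satisfiable_iff:
  "(\<exists>\<nu>. \<forall>cl\<in>tableau_clauses. clause_true \<nu> cl) \<longleftrightarrow> (\<exists>u. length u \<le> P \<and> snd (snd (conf u T) ! 1) 0 \<noteq> 1)"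
  using run_satisfies satisfying_run by blast

end

section \<open>Programs that write instances\<close>

text \<open>The leading \<open>True\<close> belongs to the enclosing list of people, so these words
  can be written one after the other.\<close>

definition pref_word :: "pref_list \<Rightarrow> bool list" where
  "pref_word l = True # enc_list (enc_list enc_nat) l"

definition triples_word :: "(nat \<times> nat \<times> nat \<times> nat \<times> nat) list \<Rightarrow> bool list" where
  "triples_word ts = concat (map pref_word (concat (map triple_prefs ts)))"

lemma triples_word_append: "triples_word (ts @ ts') = triples_word ts @ triples_word ts'"
  by (simp add: triples_word_def)

definition clauses_word :: "clause3 list \<Rightarrow> bool list" where
  "clauses_word cls = triples_word (concat (map (\<lambda>c. clause_triples c (cls ! c)) [0..<length cls]))"

text \<open>The gadget of a clause depends on the clause and its index only, so appending a clause
  leaves the text before it unchanged.\<close>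

lemma clauses_word_snoc: "clauses_word (cls @ [cl]) = clauses_word cls @ triples_word (clause_triples (length cls) cl)"
proof -
  have *: "map (\<lambda>c. clause_triples c ((cls @ [cl]) ! c)) [0..<length cls] = map (\<lambda>c. clause_triples c (cls ! c)) [0..<length cls]"
    by (intro map_cong) (auto simp: nth_append)
  have "[0..<length (cls @ [cl])] = [0..<length cls] @ [length cls]" by simp
  then show ?thesis
    unfolding clauses_word_def triples_word_append[symmetric] by (simp only: map_append concat_append * list.map concat.simps) simp
qed

definition tokens_word :: "(nat \<Rightarrow> nat) \<Rightarrow> token list \<Rightarrow> bool list" where
  "tokens_word R ts = concat (map (token_word R) ts)"

lemma tokens_word_append: "tokens_word R (ts @ ts') = tokens_word R ts @ tokens_word R ts'"
  by (simp add: tokens_word_def)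

definition owner_tokens :: "token \<Rightarrow> token list" where
  "owner_tokens a = [Bit True, Bit True, Bit True, a, Bit False, Bit False]"

lemma owner_tokens_word: "token_word R a = enc_nat v \<Longrightarrow> tokens_word R (owner_tokens a) = pref_word [[v]]"
  by (simp add: owner_tokens_def tokens_word_def pref_word_def enc_list_def)

definition person_tokens :: "token \<Rightarrow> token \<Rightarrow> token \<Rightarrow> token list" where
  "person_tokens a b c = [Bit True, Bit True, Bit True, a, Bit False, Bit True, Bit True, b, Bit False,
     Bit True, Bit True, c, Bit False, Bit False]"

lemma person_tokens_word:
  "token_word R a = enc_nat u \<Longrightarrow> token_word R b = enc_nat v \<Longrightarrow> token_word R c = enc_nat w \<Longrightarrow>
    tokens_word R (person_tokens a b c) = pref_word [[u], [v], [w]]"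
  by (simp add: person_tokens_def tokens_word_def pref_word_def enc_list_def)

definition triple_tokens :: "token \<Rightarrow> token \<Rightarrow> token \<Rightarrow> token \<Rightarrow> token \<Rightarrow> token list" where
  "triple_tokens f z x y w = person_tokens f x z @ person_tokens f y z @ person_tokens f w z"

lemma triple_tokens_word:
  assumes "token_word R f = enc_nat f'" "token_word R z = enc_nat z'" "token_word R x = enc_nat x'"
    "token_word R y = enc_nat y'" "token_word R w = enc_nat w'"
  shows "tokens_word R (triple_tokens f z x y w) = triples_word [(f', z', x', y', w')]"
  using assms by (simp add: triple_tokens_def tokens_word_append person_tokens_word triples_word_def)

lemma set_triple_tokens: "set (triple_tokens f z x y w) = {Bit True, Bit False, f, z, x, y, w}"
  by (auto simp: triple_tokens_def person_tokens_def)

text \<open>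
  A template literal is a sign, a register and an offset; it stands for the variable
  \<open>C * R r + d\<close>.
\<close>

type_synonym template_literal = "bool \<times> nat \<times> nat"
type_synonym template_clause = "template_literal \<times> template_literal \<times> template_literal"

fun lit_of :: "nat \<Rightarrow> (nat \<Rightarrow> nat) \<Rightarrow> template_literal \<Rightarrow> literal" where
  "lit_of C R (s, r, d) = (s, C * R r + d)"

fun clause_of :: "nat \<Rightarrow> (nat \<Rightarrow> nat) \<Rightarrow> template_clause \<Rightarrow> clause3" where
  "clause_of C R (l1, l2, l3) = (lit_of C R l1, lit_of C R l2, lit_of C R l3)"

fun lit_token :: "nat \<Rightarrow> template_literal \<Rightarrow> token" where
  "lit_token C (s, r, d) = Num r (12 * C) (12 * d + (if s then 0 else 1))"

lemma lit_token_word: "token_word R (lit_token C l) = enc_nat (lit_item (lit_of C R l))"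
  by (cases l) (simp add: algebra_simps)

text \<open>Register 5 holds the index of the clause; \<open>Num 5 0 0\<close> writes the constant
  item 0.\<close>

fun clause_tokens :: "nat \<Rightarrow> template_clause \<Rightarrow> token list" where
  "clause_tokens C (l1, l2, l3) =
     triple_tokens (Num 5 12 6) (Num 5 12 7) (lit_token C l1) (lit_token C l2) (Num 5 12 2) @
     triple_tokens (Num 5 12 8) (Num 5 12 9) (Num 5 12 3) (lit_token C l3) (Num 5 0 0) @
     triple_tokens (Num 5 12 10) (Num 5 12 11) (Num 5 12 2) (Num 5 12 2) (Num 5 12 3)"

lemma clause_tokens_word:
  "tokens_word R (clause_tokens C cl) = triples_word (clause_triples (R 5) (clause_of C R cl))"
proof -
  obtain l1 l2 l3 where cl: "cl = (l1, l2, l3)" by (metis surj_pair)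
  have e: "triples_word [s, t, u] = triples_word [s] @ triples_word [t] @ triples_word [u]" for s t u
    by (simp add: triples_word_def)
  show ?thesis
    unfolding cl clause_tokens.simps tokens_word_append clause_of.simps clause_triples.simps e
    by (intro arg_cong2[where f = "(@)"] triple_tokens_word) (simp_all add: lit_token_word)
qed

fun template_regs :: "template_clause \<Rightarrow> nat set" where
  "template_regs (l1, l2, l3) = {fst (snd l1), fst (snd l2), fst (snd l3)}"

definition emit_clause :: "nat \<Rightarrow> template_clause \<Rightarrow> com" where
  "emit_clause C cl = Seq (out_tokens (clause_tokens C cl)) (incs [5, 6, 7])"

text \<open>Three copies of the count are kept because the end of the program empties one each for
  the auxiliary owners, the costs and the budget.\<close>

definition counted :: "(nat \<Rightarrow> nat) \<Rightarrow> nat \<Rightarrow> nat \<Rightarrow> nat" where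
  "counted R n = R(5 := n, 6 := n, 7 := n)"

lemma counted_simps: "counted R n 5 = n" "counted R n 6 = n" "counted R n 7 = n"
  "7 < r \<Longrightarrow> counted R n r = R r" "r < 5 \<Longrightarrow> counted R n r = R r"
  "7 < r \<Longrightarrow> (counted R n)(r := v) = counted (R(r := v)) n"
  "clean (counted R n) = clean R"
  by (auto simp: counted_def clean_def fun_eq_iff)

text \<open>
  \<open>Z\<close> bounds the registers, so that it bounds the time for writing a number.
\<close>

definition emits :: "bool list \<Rightarrow> nat \<Rightarrow> com \<Rightarrow> nat \<Rightarrow> (nat \<Rightarrow> nat) \<Rightarrow> nat \<Rightarrow> nat \<Rightarrow> (nat \<Rightarrow> nat) \<Rightarrow> clause3 list \<Rightarrow> bool" where
  "emits x Z c h R n h' R' cls' \<longleftrightarrow> (\<forall>cls. length cls + length cls' \<le> Z \<longrightarrow>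
     runs x c (h, counted R (length cls), clauses_word cls) n
       (h', counted R' (length (cls @ cls')), clauses_word (cls @ cls')))"

lemma emits_runs:
  assumes "\<And>n w. runs x c (h, counted R n, w) m (h', counted R' n, w)"
  shows "emits x Z c h R m h' R' []"
  using assms by (simp add: emits_def)

lemma emits_mono: "emits x Z c h R n h' R' cls \<Longrightarrow> n \<le> m \<Longrightarrow> emits x Z c h R m h' R' cls"
  unfolding emits_def using runs_mono by blast

lemma emits_Seq:
  assumes "emits x Z c h R m h' R' cls" "emits x Z d h' R' n h'' R'' cls'"
  shows "emits x Z (Seq c d) h R (m + n) h'' R'' (cls @ cls')"
  unfolding emits_def
proof (intro allI impI)
  fix cls0 :: "clause3 list" assume len: "length cls0 + length (cls @ cls') \<le> Z"
  have "runs x c (h, counted R (length cls0), clauses_word cls0) m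
      (h', counted R' (length (cls0 @ cls)), clauses_word (cls0 @ cls))"
    "runs x d (h', counted R' (length (cls0 @ cls)), clauses_word (cls0 @ cls)) n
      (h'', counted R'' (length ((cls0 @ cls) @ cls')), clauses_word ((cls0 @ cls) @ cls'))"
    using assms(1)[unfolded emits_def, rule_format, of cls0] assms(2)[unfolded emits_def, rule_format, of "cls0 @ cls"] len
    by simp_all
  then show "runs x (Seq c d) (h, counted R (length cls0), clauses_word cls0) (m + n)
      (h'', counted R'' (length (cls0 @ cls @ cls')), clauses_word (cls0 @ cls @ cls'))"
    using runs_Seq by simp
qed

lemma emits_Inc: "7 < r \<Longrightarrow> emits x Z (Inc r) h R 1 h (R(r := Suc (R r))) []"
  by (rule emits_runs) (rule runs_eqI[OF runs_Inc], auto simp: counted_simps)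

lemma emits_set_poly:
  assumes "7 < r" "clean R" "R r = 0"
  shows "emits x Z (set_poly r q) h R (horner_time (coeffs q) (R 0)) h (R(r := poly q (R 0))) []"
proof (rule emits_runs)
  fix n w
  have "runs x (set_poly r q) (h, counted R n, w) (horner_time (coeffs q) (counted R n 0))
     (h, (counted R n)(r := poly q (counted R n 0)), w)"
    using assms by (intro runs_set_poly) (simp_all add: counted_simps)
  then show "runs x (set_poly r q) (h, counted R n, w) (horner_time (coeffs q) (R 0))
     (h, counted (R(r := poly q (R 0))) n, w)"
    using assms by (simp add: counted_simps)
qed

lemma emits_clause:
  assumes "clean R" "\<forall>r\<in>template_regs cl. 7 < r \<and> R r \<le> Z"
  shows "emits x Z (emit_clause C cl) h R (tokens_time (clause_tokens C cl) Z + 4) h R [clause_of C R cl]"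
  unfolding emits_def emit_clause_def
proof (intro allI impI)
  fix cls :: "clause3 list" assume len: "length cls + length [clause_of C R cl] \<le> Z"
  obtain l1 l2 l3 where cl: "cl = (l1, l2, l3)" by (metis surj_pair)
  have lit: "token_ok Z (counted R (length cls)) (lit_token C l)" if "l \<in> {l1, l2, l3}" for l
    using assms(2) that cl by (cases l) (auto simp: counted_simps)
  have co: "clause_of C (counted R (length cls)) cl = clause_of C R cl"
    using assms(2) unfolding cl by (cases l1; cases l2; cases l3) (auto simp: counted_simps)
  have "runs x (out_tokens (clause_tokens C cl)) (h, counted R (length cls), clauses_word cls)
      (tokens_time (clause_tokens C cl) Z)
      (h, counted R (length cls), clauses_word cls @ concat (map (token_word (counted R (length cls))) (clause_tokens C cl)))"
    using assms(1) lit len unfolding cl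
    by (intro runs_out_tokens) (auto simp: counted_simps set_triple_tokens)
  also have "concat (map (token_word (counted R (length cls))) (clause_tokens C cl)) =
      triples_word (clause_triples (length cls) (clause_of C R cl))"
    using clause_tokens_word[of "counted R (length cls)" C cl] by (simp add: tokens_word_def counted_simps co)
  finally have 1: "runs x (out_tokens (clause_tokens C cl)) (h, counted R (length cls), clauses_word cls)
      (tokens_time (clause_tokens C cl) Z) (h, counted R (length cls), clauses_word (cls @ [clause_of C R cl]))"
    unfolding clauses_word_snoc .
  have 2: "runs x (incs [5, 6, 7]) (h, counted R (length cls), clauses_word (cls @ [clause_of C R cl])) 4
      (h, counted R (length (cls @ [clause_of C R cl])), clauses_word (cls @ [clause_of C R cl]))"
    by (rule runs_eqI[OF runs_incs[of x "[5, 6, 7]" h "counted R (length cls)"]]) (auto simp: counted_def fun_eq_iff)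
  show "runs x (Seq (out_tokens (clause_tokens C cl)) (incs [5, 6, 7])) (h, counted R (length cls), clauses_word cls)
      (tokens_time (clause_tokens C cl) Z + 4)
      (h, counted R (length (cls @ [clause_of C R cl])), clauses_word (cls @ [clause_of C R cl]))"
    by (rule runs_Seq[OF 1 2])
qed

definition emit_template :: "nat \<Rightarrow> template_clause list \<Rightarrow> com" where
  "emit_template C tm = seqs (map (emit_clause C) tm)"

fun template_time :: "nat \<Rightarrow> template_clause list \<Rightarrow> nat \<Rightarrow> nat" where
  "template_time C [] Z = 1"
| "template_time C (cl # tm) Z = tokens_time (clause_tokens C cl) Z + 4 + template_time C tm Z"

lemma poly_bounded_template_time:
  assumes "poly_bounded Z"
  shows "poly_bounded (\<lambda>n. template_time C tm (Z n))"
  by (induction tm) (simp_all add: poly_bounded_intros poly_bounded_tokens_time[OF assms])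

lemma emits_template:
  assumes "clean R" "\<forall>cl\<in>set tm. \<forall>r\<in>template_regs cl. 7 < r \<and> R r \<le> Z"
  shows "emits x Z (emit_template C tm) h R (template_time C tm Z) h R (map (clause_of C R) tm)"
  using assms(2)
proof (induction tm)
  case Nil
  show ?case unfolding emit_template_def list.map seqs.simps template_time.simps
    by (rule emits_runs) (rule runs_Skip)
next
  case (Cons cl tm)
  have "emits x Z (Seq (emit_clause C cl) (emit_template C tm)) h R
     (tokens_time (clause_tokens C cl) Z + 4 + template_time C tm Z) h R ([clause_of C R cl] @ map (clause_of C R) tm)"
    using Cons by (intro emits_Seq[OF emits_clause] Cons.IH assms(1)) auto
  then show ?case by (simp add: emit_template_def)
qed

lemma emits_drain:
  assumes r: "7 < r"
    and step: "\<And>i. i < n \<Longrightarrow> emits x Z c h ((R i)(r := n - Suc i)) m h ((R (Suc i))(r := n - Suc i)) (f i)"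
  shows "emits x Z (drain r c) h ((R 0)(r := n)) (n * (m + 2) + 1) h ((R n)(r := 0)) (concat (map f [0..<n]))"
  unfolding emits_def
proof (intro allI impI)
  fix cls :: "clause3 list" assume len: "length cls + length (concat (map f [0..<n])) \<le> Z"
  let ?cls = "\<lambda>i. cls @ concat (map f [0..<i])"
  have cnt: "counted (R'(r := v)) k = (counted R' k)(r := v)" for R' v k
    using r by (simp add: counted_simps)
  have "runs x (drain r c) (h, (counted (R 0) (length (?cls 0)))(r := n), clauses_word (?cls 0)) (n * (m + 2) + 1)
     (h, (counted (R n) (length (?cls n)))(r := 0), clauses_word (?cls n))"
  proof (rule runs_drain[where H = "\<lambda>_. h" and R = "\<lambda>i. counted (R i) (length (?cls i))" and W = "\<lambda>i. clauses_word (?cls i)"])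
    fix i assume i: "i < n"
    have "[0..<n] = [0..<Suc i] @ [Suc i..<n]" using i by (metis Suc_leI le0 upt_add_eq_append le_add_diff_inverse)
    then have "length (concat (map f [0..<n])) = length (concat (map f [0..<Suc i])) + length (concat (map f [Suc i..<n]))"
      by (metis concat_append length_append map_append)
    then have "length (?cls i) + length (f i) \<le> Z" using len by simp
    then have "runs x c (h, counted ((R i)(r := n - Suc i)) (length (?cls i)), clauses_word (?cls i)) m
       (h, counted ((R (Suc i))(r := n - Suc i)) (length (?cls i @ f i)), clauses_word (?cls i @ f i))"
      using step[OF i] unfolding emits_def by blast
    moreover have "?cls (Suc i) = ?cls i @ f i" by simp
    ultimately show "runs x c (h, (counted (R i) (length (?cls i)))(r := n - Suc i), clauses_word (?cls i)) m
       (h, (counted (R (Suc i)) (length (?cls (Suc i))))(r := n - Suc i), clauses_word (?cls (Suc i)))"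
      unfolding cnt by metis
  qed
  then show "runs x (drain r c) (h, counted ((R 0)(r := n)) (length cls), clauses_word cls) (n * (m + 2) + 1)
     (h, counted ((R n)(r := 0)) (length (?cls n)), clauses_word (?cls n))"
    unfolding cnt by simp
qed

definition loop :: "nat \<Rightarrow> nat poly \<Rightarrow> com \<Rightarrow> com" where
  "loop r q c = Seq (set_poly r q) (drain r c)"

lemma emits_loop:
  assumes "7 < r" "clean (R 0)" "R 0 r = 0" "R n r = 0" "n = poly q (R 0 0)"
    and "\<And>i. i < n \<Longrightarrow> emits x Z c h ((R i)(r := n - Suc i)) m h ((R (Suc i))(r := n - Suc i)) (f i)"
  shows "emits x Z (loop r q c) h (R 0) (horner_time (coeffs q) (R 0 0) + (n * (m + 2) + 1)) h (R n) (concat (map f [0..<n]))"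
proof -
  have "(R n)(r := 0) = R n" using assms(4) by auto
  then have "emits x Z (drain r c) h ((R 0)(r := poly q (R 0 0))) (n * (m + 2) + 1) h (R n) (concat (map f [0..<n]))"
    using emits_drain[of r n x Z c h R m f] assms(1,5,6) by simp
  then show ?thesis
    unfolding loop_def using emits_Seq[OF emits_set_poly[OF assms(1,2,3)]] by fastforce
qed

lemma emits_InLoop:
  assumes "\<And>i. i < length x \<Longrightarrow> emits x Z (if x ! i then d else c) i (R i) m i (R (Suc i)) (f i)"
  shows "emits x Z (InLoop c d) 0 (R 0) (length x * (m + 2) + 1) (length x) (R (length x)) (concat (map f [0..<length x]))"
proof -
  have "emits x Z (InLoop c d) i (R i) ((length x - i) * (m + 2) + 1) (length x) (R (length x)) (concat (map f [i..<length x]))"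
    if "i \<le> length x" for i
    using that
  proof (induction i rule: inc_induct)
    case base
    show ?case using runs_InLoop_end by (auto intro!: emits_runs)
  next
    case (step i)
    show ?case
      unfolding emits_def
    proof (intro allI impI)
      fix cls :: "clause3 list" assume len: "length cls + length (concat (map f [i..<length x])) \<le> Z"
      have upt: "[i..<length x] = i # [Suc i..<length x]" using step by (simp add: upt_conv_Cons)
      let ?R = "\<lambda>i k. counted (R i) k"
      have "runs x (if x ! i then d else c) (i, ?R i (length cls), clauses_word cls) m
          (i, ?R (Suc i) (length (cls @ f i)), clauses_word (cls @ f i))"
        using assms[of i] step len unfolding emits_def upt by simp
      moreover have "runs x (InLoop c d) (Suc i, ?R (Suc i) (length (cls @ f i)), clauses_word (cls @ f i))
          ((length x - Suc i) * (m + 2) + 1) (length x, ?R (length x) (length ((cls @ f i) @ concat (map f [Suc i..<length x]))),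
            clauses_word ((cls @ f i) @ concat (map f [Suc i..<length x])))"
        using step.IH[unfolded emits_def, rule_format, of "cls @ f i"] len unfolding upt by simp
      ultimately have "runs x (InLoop c d) (i, ?R i (length cls), clauses_word cls)
          (m + ((length x - Suc i) * (m + 2) + 1) + 2)
          (length x, ?R (length x) (length ((cls @ f i) @ concat (map f [Suc i..<length x]))),
            clauses_word ((cls @ f i) @ concat (map f [Suc i..<length x])))"
        using step by (intro runs_InLoop_step) auto
      then show "runs x (InLoop c d) (i, ?R i (length cls), clauses_word cls) ((length x - i) * (m + 2) + 1)
          (length x, ?R (length x) (length (cls @ concat (map f [i..<length x]))), clauses_word (cls @ concat (map f [i..<length x])))"
      proof (rule runs_eqI)
        have "length x - i = Suc (length x - Suc i)" using step by simp
        then show "m + ((length x - Suc i) * (m + 2) + 1) + 2 \<le> (length x - i) * (m + 2) + 1" by simp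
      qed (simp_all add: upt)
    qed
  qed
  from this[of 0] show ?thesis by simp
qed

lemma rev_upt_minus: "map (\<lambda>i. n - Suc i) [0..<n] = rev [0..<n]"
  by (rule nth_equalityI) (auto simp: rev_nth)

lemma runs_drain_out:
  assumes r: "4 < r" and clean: "clean R" and ok: "\<And>v. v < n \<Longrightarrow> \<forall>t\<in>set ts. token_ok Z (R(r := v)) t"
  shows "runs x (drain r (out_tokens ts)) (h, R(r := n), w) (n * (tokens_time ts Z + 2) + 1)
    (h, R(r := 0), w @ concat (map (\<lambda>v. tokens_word (R(r := v)) ts) (rev [0..<n])))"
proof -
  let ?W = "\<lambda>i. w @ concat (map (\<lambda>i. tokens_word (R(r := n - Suc i)) ts) [0..<i])"
  have "runs x (drain r (out_tokens ts)) (h, R(r := n), ?W 0) (n * (tokens_time ts Z + 2) + 1) (h, R(r := 0), ?W n)"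
  proof (rule runs_drain[where H = "\<lambda>_. h" and R = "\<lambda>_. R" and W = ?W])
    fix i assume "i < n"
    then have "runs x (out_tokens ts) (h, R(r := n - Suc i), ?W i) (tokens_time ts Z)
      (h, R(r := n - Suc i), ?W i @ concat (map (token_word (R(r := n - Suc i))) ts))"
      using ok clean_update[OF r clean] by (intro runs_out_tokens) auto
    then show "runs x (out_tokens ts) (h, R(r := n - Suc i), ?W i) (tokens_time ts Z) (h, R(r := n - Suc i), ?W (Suc i))"
      by (simp add: tokens_word_def)
  qed
  moreover have "map (\<lambda>i. tokens_word (R(r := n - Suc i)) ts) [0..<n] = map (\<lambda>v. tokens_word (R(r := v)) ts) (rev [0..<n])"
    unfolding rev_upt_minus[symmetric] by simp
  ultimately show ?thesis by simp
qed

section \<open>The part of the instance behind the clause gadgets\<close>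

definition cost_tokens :: "token list" where
  "cost_tokens = map Bit (concat (map (\<lambda>r. True # enc_rat r) cost_block))"

lemma tokens_word_Bits: "tokens_word R (map Bit w) = w"
  by (induction w) (simp_all add: tokens_word_def)

lemma enc_rat_of_nat: "enc_rat (of_nat k) = enc_nat k @ enc_nat 1"
  by (simp add: enc_rat_def quotient_of_int[of "int k", simplified])

fun token_only :: "nat \<Rightarrow> token \<Rightarrow> bool" where
  "token_only r (Bit b) = True"
| "token_only r (Num r' m d) = (r' = r)"

lemma runs_drain_tokens:
  assumes r: "4 < r" and clean: "clean R" and only: "\<forall>t\<in>set ts. token_only r t" and Z: "R r \<le> Z"
    and word: "\<And>v. tokens_word (R(r := v)) ts = f v"
  shows "runs x (drain r (out_tokens ts)) (h, R, w) (Z * (tokens_time ts Z + 2) + 1)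
    (h, R(r := 0), w @ concat (map f (rev [0..<R r])))"
proof -
  have "token_ok Z (R(r := v)) t" if "v < R r" "t \<in> set ts" for v t
    using that only Z r by (cases t) auto
  then have "runs x (drain r (out_tokens ts)) (h, R(r := R r), w) (R r * (tokens_time ts Z + 2) + 1)
    (h, R(r := 0), w @ concat (map f (rev [0..<R r])))"
    using runs_drain_out[of r R "R r" ts Z x h w] r clean unfolding word by blast
  then have "runs x (drain r (out_tokens ts)) (h, R, w) (R r * (tokens_time ts Z + 2) + 1)
    (h, R(r := 0), w @ concat (map f (rev [0..<R r])))" by simp
  then show ?thesis by (rule runs_mono) (intro add_mono mult_le_mono Z order_refl)
qed

definition var_triple_tokens :: "token list" where
  "var_triple_tokens = triple_tokens (Num 14 12 4) (Num 14 12 5) (Num 14 12 0) (Num 14 12 0) (Num 14 12 1)"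

definition var_owner_tokens :: "token list" where
  "var_owner_tokens = owner_tokens (Num 14 12 0) @ owner_tokens (Num 14 12 1)"

definition aux_owner_tokens :: "token list" where
  "aux_owner_tokens = owner_tokens (Num 5 12 2) @ owner_tokens (Num 5 12 3)"

definition budget_tokens :: "token list" where
  "budget_tokens = Num 14 1 0 # map Bit (enc_nat 1)"

text \<open>What remains depends on the clauses only through their number. Register 14 is recomputed
  each time, since writing a block per variable empties it; the final \<open>shift\<close> turns it
  into the budget.\<close>

definition tail_com :: "nat poly \<Rightarrow> com" where
  "tail_com q =
     Seq (set_poly 14 q) (Seq (drain 14 (out_tokens var_triple_tokens))
     (Seq (set_poly 14 q) (Seq (drain 14 (out_tokens var_owner_tokens))
     (Seq (drain 5 (out_tokens aux_owner_tokens)) (Seq (Out False)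
     (Seq (set_poly 14 q) (Seq (drain 14 (out_tokens cost_tokens))
     (Seq (drain 6 (out_tokens cost_tokens)) (Seq (Out False)
     (Seq (set_poly 14 q) (Seq (shift 7 [14, 14, 14]) (out_tokens budget_tokens))))))))))))"

definition tail_time :: "nat poly \<Rightarrow> nat \<Rightarrow> nat \<Rightarrow> nat" where
  "tail_time q n Z = horner_time (coeffs q) n + ((Z * (tokens_time var_triple_tokens Z + 2) + 1) +
     (horner_time (coeffs q) n + ((Z * (tokens_time var_owner_tokens Z + 2) + 1) +
     ((Z * (tokens_time aux_owner_tokens Z + 2) + 1) + (1 +
     (horner_time (coeffs q) n + ((Z * (tokens_time cost_tokens Z + 2) + 1) +
     ((Z * (tokens_time cost_tokens Z + 2) + 1) + (1 +
     (horner_time (coeffs q) n + ((Z * 6 + 1) + tokens_time budget_tokens (4 * Z))))))))))))"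

lemma poly_bounded_tail_time:
  assumes "poly_bounded Z"
  shows "poly_bounded (\<lambda>n. tail_time q n (Z n))"
  unfolding tail_time_def
  by (intro poly_bounded_intros poly_bounded_tokens_time assms poly_bounded_horner_time)

lemma enc_prefs: "enc_list (enc_list (enc_list enc_nat)) ls = concat (map pref_word ls) @ [False]"
  unfolding enc_list_def[of "enc_list (enc_list enc_nat)"] pref_word_def[abs_def] ..

lemma concat_map_pairs:
  "concat (map h (concat (map (\<lambda>v. [f v, g v]) vs))) = concat (map (\<lambda>v. h (f v) @ h (g v)) vs)"
  by (induction vs) simp_all

lemma concat_map_concat: "concat (map f (concat xss)) = concat (map (\<lambda>xs. concat (map f xs)) xss)"
  by (induction xss) simp_all

lemma runs_tail:
  assumes clean: "clean R" and R14: "R 14 = 0" and V: "V = poly q (R 0)" "V \<le> Z" and cls: "length cls \<le> Z"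
  shows "\<exists>R'. runs x (tail_com q) (h, counted R (length cls), clauses_word cls) (tail_time q (R 0) Z)
    (h, R', enc_input (sat_instance V cls) (of_nat (V + 3 * length cls)))"
proof -
  define m where "m = length cls"
  define R0 where "R0 = counted R m"
  define R1 where "R1 = R0(5 := 0)"
  define R2 where "R2 = R1(6 := 0)"
  have R0: "clean R0" "R0 14 = 0" "R0 0 = R 0" "R0 5 = m" "R0 6 = m" "R0 7 = m"
    using clean R14 by (simp_all add: R0_def counted_simps)
  have R1: "clean R1" "R1 14 = 0" "R1 0 = R 0" "R1 6 = m" "R1 7 = m"
    using R0 by (simp_all add: R1_def clean_def)
  have R2: "clean R2" "R2 14 = 0" "R2 0 = R 0" "R2 7 = m"
    using R1 by (simp_all add: R2_def clean_def)
  have set14: "runs x (set_poly 14 q) (h, R', w) (horner_time (coeffs q) (R 0)) (h, R'(14 := V), w)"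
    if "clean R'" "R' 14 = 0" "R' 0 = R 0" for R' w
    using runs_set_poly[of 14 R' x q h w] that V by simp
  have drain14: "runs x (drain 14 (out_tokens ts)) (h, R'(14 := V), w) (Z * (tokens_time ts Z + 2) + 1)
      (h, R', w @ concat (map f (rev [0..<V])))"
    if "clean R'" "R' 14 = 0" "\<forall>t\<in>set ts. token_only 14 t" "\<And>v. tokens_word (R'(14 := v)) ts = f v" for R' w ts f
  proof -
    have "runs x (drain 14 (out_tokens ts)) (h, R'(14 := V), w) (Z * (tokens_time ts Z + 2) + 1)
      (h, R'(14 := V, 14 := 0), w @ concat (map f (rev [0..<(R'(14 := V)) 14])))"
      using that V(2) by (intro runs_drain_tokens) (auto simp: clean_def)
    moreover have "R'(14 := V, 14 := 0) = R'" using that(2) by auto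
    ultimately show ?thesis by simp
  qed
  let ?w0 = "clauses_word cls"
  let ?w1 = "?w0 @ concat (map (\<lambda>v. triples_word [var_triple v]) (rev [0..<V]))"
  let ?w2 = "?w1 @ concat (map (\<lambda>v. pref_word [[12 * v]] @ pref_word [[12 * v + 1]]) (rev [0..<V]))"
  let ?w3 = "?w2 @ concat (map (\<lambda>c. pref_word [[12 * c + 2]] @ pref_word [[12 * c + 3]]) (rev [0..<m]))"
  let ?w4 = "?w3 @ [False]"
  let ?c = "concat (map (\<lambda>r. True # enc_rat r) cost_block)"
  let ?w5 = "?w4 @ concat (map (\<lambda>_. ?c) (rev [0..<V]))"
  let ?w6 = "?w5 @ concat (map (\<lambda>_. ?c) (rev [0..<m]))"
  let ?w7 = "?w6 @ [False]"
  let ?w8 = "?w7 @ enc_nat (V + 3 * m) @ enc_nat 1"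
  have 1: "runs x (drain 14 (out_tokens var_triple_tokens)) (h, R0(14 := V), ?w0)
      (Z * (tokens_time var_triple_tokens Z + 2) + 1) (h, R0, ?w1)"
  proof (rule drain14[OF R0(1,2)])
    fix v
    show "tokens_word (R0(14 := v)) var_triple_tokens = triples_word [var_triple v]"
      unfolding var_triple_tokens_def var_triple_def by (rule triple_tokens_word) simp_all
  qed (simp add: var_triple_tokens_def set_triple_tokens)
  have 2: "runs x (drain 14 (out_tokens var_owner_tokens)) (h, R0(14 := V), ?w1)
      (Z * (tokens_time var_owner_tokens Z + 2) + 1) (h, R0, ?w2)"
  proof (rule drain14[OF R0(1,2)])
    fix v
    show "tokens_word (R0(14 := v)) var_owner_tokens = pref_word [[12 * v]] @ pref_word [[12 * v + 1]]"
      unfolding var_owner_tokens_def tokens_word_append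
      by (intro arg_cong2[where f = "(@)"] owner_tokens_word) simp_all
  qed (simp add: var_owner_tokens_def owner_tokens_def)
  have 3: "runs x (drain 5 (out_tokens aux_owner_tokens)) (h, R0, ?w2)
      (Z * (tokens_time aux_owner_tokens Z + 2) + 1) (h, R1, ?w3)"
  proof -
    have "runs x (drain 5 (out_tokens aux_owner_tokens)) (h, R0, ?w2) (Z * (tokens_time aux_owner_tokens Z + 2) + 1)
      (h, R0(5 := 0), ?w2 @ concat (map (\<lambda>c. pref_word [[12 * c + 2]] @ pref_word [[12 * c + 3]]) (rev [0..<R0 5])))"
    proof (rule runs_drain_tokens)
      fix v
      show "tokens_word (R0(5 := v)) aux_owner_tokens = pref_word [[12 * v + 2]] @ pref_word [[12 * v + 3]]"
        unfolding aux_owner_tokens_def tokens_word_append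
        by (intro arg_cong2[where f = "(@)"] owner_tokens_word) simp_all
    qed (use R0 cls in \<open>simp_all add: aux_owner_tokens_def owner_tokens_def m_def\<close>)
    then show ?thesis unfolding R0(4) R1_def .
  qed
  have cost: "\<forall>t\<in>set cost_tokens. token_only r t" "tokens_word R' cost_tokens = ?c" for r R'
    by (auto simp: cost_tokens_def) (simp add: tokens_word_Bits)
  have 5: "runs x (drain 14 (out_tokens cost_tokens)) (h, R1(14 := V), ?w4)
      (Z * (tokens_time cost_tokens Z + 2) + 1) (h, R1, ?w5)"
    by (rule drain14[OF R1(1,2) cost])
  have 6: "runs x (drain 6 (out_tokens cost_tokens)) (h, R1, ?w5) (Z * (tokens_time cost_tokens Z + 2) + 1) (h, R2, ?w6)"
  proof -
    have "runs x (drain 6 (out_tokens cost_tokens)) (h, R1, ?w5) (Z * (tokens_time cost_tokens Z + 2) + 1)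
      (h, R1(6 := 0), ?w5 @ concat (map (\<lambda>_. ?c) (rev [0..<R1 6])))"
      by (rule runs_drain_tokens) (use R1 cls cost in \<open>simp_all add: m_def\<close>)
    then show ?thesis unfolding R1(4) R2_def .
  qed
  have 7: "runs x (shift 7 [14, 14, 14]) (h, R2(14 := V), ?w7) (Z * 6 + 1) (h, R2(14 := V + 3 * m, 7 := 0), ?w7)"
    by (rule runs_eqI[OF runs_shift[of 7 "[14, 14, 14]" x h "R2(14 := V)" ?w7]])
      (use R2 cls in \<open>auto simp: m_def fun_eq_iff\<close>)
  \<comment> \<open>The budget \<open>V + 3 * m\<close> is at most \<open>4 * Z\<close>, as both
    \<open>V\<close> and \<open>m\<close> are at most \<open>Z\<close>.\<close>
  have 8: "runs x (out_tokens budget_tokens) (h, R2(14 := V + 3 * m, 7 := 0), ?w7) (tokens_time budget_tokens (4 * Z))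
     (h, R2(14 := V + 3 * m, 7 := 0), ?w8)"
  proof -
    have "runs x (out_tokens budget_tokens) (h, R2(14 := V + 3 * m, 7 := 0), ?w7) (tokens_time budget_tokens (4 * Z))
     (h, R2(14 := V + 3 * m, 7 := 0), ?w7 @ concat (map (token_word (R2(14 := V + 3 * m, 7 := 0))) budget_tokens))"
      using R2 V cls by (intro runs_out_tokens) (auto simp: clean_def budget_tokens_def m_def)
    moreover have "concat (map (token_word (R2(14 := V + 3 * m, 7 := 0))) budget_tokens) = enc_nat (V + 3 * m) @ enc_nat 1"
      using tokens_word_Bits[of _ "enc_nat 1"] by (simp add: budget_tokens_def tokens_word_def)
    ultimately show ?thesis by simp
  qed
  have "runs x (tail_com q) (h, R0, ?w0) (tail_time q (R 0) Z) (h, R2(14 := V + 3 * m, 7 := 0), ?w8)"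
    unfolding tail_com_def tail_time_def
    by (intro runs_Seq[OF set14[OF R0(1,2,3)]] runs_Seq[OF 1] runs_Seq[OF 2] runs_Seq[OF 3] runs_Seq[OF runs_Out]
        runs_Seq[OF set14[OF R1(1,2,3)]] runs_Seq[OF 5] runs_Seq[OF 6] runs_Seq[OF set14[OF R2(1,2,3)]] runs_Seq[OF 7] 8)
  moreover have "?w8 = enc_input (sat_instance V cls) (of_nat (V + 3 * length cls))"
  proof -
    have t: "concat (map (\<lambda>v. triples_word [var_triple v]) vs) = triples_word (map var_triple vs)" for vs
      by (induction vs) (simp_all add: triples_word_def)
    have "?w1 = triples_word (sat_triples V cls)"
      unfolding t clauses_word_def sat_triples_def triples_word_append ..
    moreover have "concat (map pref_word (map (\<lambda>x. [[x]]) (sat_owners V cls))) =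
        concat (map (\<lambda>v. pref_word [[12 * v]] @ pref_word [[12 * v + 1]]) (rev [0..<V])) @
        concat (map (\<lambda>c. pref_word [[12 * c + 2]] @ pref_word [[12 * c + 3]]) (rev [0..<m]))"
      unfolding sat_owners_def m_def map_map o_def map_append concat_append concat_map_pairs ..
    ultimately have prefs: "?w4 = enc_list (enc_list (enc_list enc_nat)) (prefs (sat_instance V cls))"
      unfolding enc_prefs by (simp add: sat_instance_def triples_word_def)
    have const: "concat (map (\<lambda>_. ?c) (rev [0..<k])) = concat (map (\<lambda>r. True # enc_rat r) (concat (replicate k cost_block)))" for k
    proof -
      have "map (\<lambda>_. ?c) (rev [0..<k]) = replicate k ?c" by (simp add: map_replicate_const)
      then show ?thesis by (simp add: concat_map_concat)
    qed
    have "concat (map (\<lambda>_. ?c) (rev [0..<V])) @ concat (map (\<lambda>_. ?c) (rev [0..<m])) @ [False] =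
        enc_list enc_rat (costs (sat_instance V cls))"
      unfolding const by (simp add: sat_instance_def enc_list_def replicate_add m_def)
    then have "?w8 = ?w4 @ enc_list enc_rat (costs (sat_instance V cls)) @ enc_nat (V + 3 * m) @ enc_nat 1"
      by (simp only: append_assoc)
    then show ?thesis
      unfolding enc_input_def enc_rat_of_nat m_def[symmetric] prefs[symmetric] .
  qed
  ultimately show ?thesis unfolding R0_def m_def by metis
qed

section \<open>The reduction as a counter program\<close>

text \<open>The row offset selects register \<open>r\<close> or its successor, which points to the
  same column of the next row; column offset and kind only change the constant.\<close>

fun template_lit :: "nat \<Rightarrow> (kind \<Rightarrow> nat) \<Rightarrow> nat \<Rightarrow> bool \<times> ref \<Rightarrow> template_literal" where
  "template_lit C e r (s, dt, di, \<kappa>) = (s, r + dt, C * di + e \<kappa>)"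

fun template :: "nat \<Rightarrow> (kind \<Rightarrow> nat) \<Rightarrow> nat \<Rightarrow> ref_clause \<Rightarrow> template_clause" where
  "template C e r (l1, l2, l3) = (template_lit C e r l1, template_lit C e r l2, template_lit C e r l3)"

fun row_offsets :: "ref_clause \<Rightarrow> nat set" where
  "row_offsets (l1, l2, l3) = {fst (snd l1), fst (snd l2), fst (snd l3)}"

lemma template_regs_template: "template_regs (template C e r cl) = (\<lambda>dt. r + dt) ` row_offsets cl"
proof -
  have "fst (snd (template_lit C e r l)) = r + fst (snd l)" for l
    by (cases "(C, e, r, l)" rule: template_lit.cases) simp
  then show ?thesis by (cases cl rule: row_offsets.cases) simp
qed

text \<open>
  Registers: 8 points to the left neighbour of the current cell of row 0, 9 and 10 to the left
  neighbours of a cell and of the one above it, and 11 to the cell of the verdict.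
\<close>

definition emit_at :: "nat \<Rightarrow> (kind \<Rightarrow> nat) \<Rightarrow> nat \<Rightarrow> ref_clause list \<Rightarrow> com" where
  "emit_at C e r L = emit_template C (map (template C e r) L)"

definition emit_time :: "nat \<Rightarrow> (kind \<Rightarrow> nat) \<Rightarrow> nat \<Rightarrow> ref_clause list \<Rightarrow> nat \<Rightarrow> nat" where
  "emit_time C e r L Z = template_time C (map (template C e r) L) Z"

lemma poly_bounded_emit_time: "poly_bounded Z \<Longrightarrow> poly_bounded (\<lambda>n. emit_time C e r L (Z n))"
  unfolding emit_time_def by (rule poly_bounded_template_time)

section \<open>The program for the tableau clauses\<close>

definition emit_cell :: "nat \<Rightarrow> (kind \<Rightarrow> nat) \<Rightarrow> ref_clause list \<Rightarrow> com" where
  "emit_cell C e L = Seq (emit_at C e 8 L) (Inc 8)"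

definition steps_poly :: "nat poly \<Rightarrow> nat poly \<Rightarrow> nat poly" where
  "steps_poly qP qQ = [:1, 2:] + qP + qQ"

definition columns_poly :: "nat poly \<Rightarrow> nat poly" where
  "columns_poly qT = [:1:] + qT + qT"

definition width_poly :: "nat poly \<Rightarrow> nat poly" where
  "width_poly qT = [:3:] + qT + qT"

definition vars_poly :: "nat \<Rightarrow> nat poly \<Rightarrow> nat poly" where
  "vars_poly C qT = [:C:] * (width_poly qT * (qT + [:1:]))"

definition input_com :: com where
  "input_com = Seq (InLoop (Inc 0) (Inc 0)) Rewind"

text \<open>Each input bit fills two cells of the row, and the two cells after the loop are the
  separator. The head clauses are written after \<open>T\<close> cells, when register 8 points to
  the left neighbour of tape position 0.\<close>

definition row_com where
  "row_com C e S0 S1 S2 G H qT qP qQ =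
     Seq (loop 12 qT (emit_cell C e S0)) (Seq (emit_at C e 8 H)
     (Seq (InLoop (Seq (emit_cell C e S1) (emit_cell C e S1)) (Seq (emit_cell C e S2) (emit_cell C e S2)))
     (Seq (emit_cell C e S1) (Seq (emit_cell C e S2)
     (Seq (loop 12 qP (emit_cell C e G)) (loop 12 qQ (emit_cell C e S0)))))))"

text \<open>Registers 9 and 10 start one row apart, at 0 and \<open>width\<close>. After the
  \<open>2 * T + 1\<close> columns on which clauses are centred, two further increments complete the
  width and bring both registers to the next row.\<close>

definition rules_com where
  "rules_com C e Ru qT =
     Seq (set_poly 10 (width_poly qT)) (loop 12 qT
       (Seq (loop 13 (columns_poly qT) (Seq (emit_at C e 9 Ru) (Seq (Inc 9) (Inc 10))))
            (Seq (Seq (Inc 9) (Inc 10)) (Seq (Inc 9) (Inc 10)))))"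

definition verdict_com where
  "verdict_com C e F qT = Seq (set_poly 11 (width_poly qT * qT + qT)) (emit_at C e 11 F)"

definition clauses_com where
  "clauses_com C e S0 S1 S2 G H Ru F qT qP qQ =
     Seq input_com (Seq (row_com C e S0 S1 S2 G H qT qP qQ) (Seq (rules_com C e Ru qT) (verdict_com C e F qT)))"

definition cell_time where
  "cell_time C e S0 S1 S2 G Z = emit_time C e 8 S0 Z + emit_time C e 8 S1 Z + emit_time C e 8 S2 Z + emit_time C e 8 G Z + 1"

definition row_time where
  "row_time ct ht qT qP qQ n =
     (horner_time (coeffs qT) n + (poly qT n * (ct + 2) + 1)) + (ht + ((n * ((ct + ct) + 2) + 1) + (ct + (ct +
     ((horner_time (coeffs qP) n + (poly qP n * (ct + 2) + 1)) + (horner_time (coeffs qQ) n + (poly qQ n * (ct + 2) + 1)))))))"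

definition rules_time where
  "rules_time rt qT n = horner_time (coeffs (width_poly qT)) n + (horner_time (coeffs qT) n +
     (poly qT n * (((horner_time (coeffs (columns_poly qT)) n +
        (poly (columns_poly qT) n * ((rt + (1 + 1)) + 2) + 1)) + ((1 + 1) + (1 + 1))) + 2) + 1))"

definition clauses_time where
  "clauses_time C e S0 S1 S2 G H Ru F qT qP qQ n Z =
     ((n * (1 + 2) + 1) + (n + 2)) + (row_time (cell_time C e S0 S1 S2 G Z) (emit_time C e 8 H Z) qT qP qQ n +
     (rules_time (emit_time C e 9 Ru Z) qT n + (horner_time (coeffs (width_poly qT * qT + qT)) n + emit_time C e 11 F Z)))"

lemma poly_bounded_clauses_time:
  assumes "poly_bounded Z"
  shows "poly_bounded (\<lambda>n. clauses_time C e S0 S1 S2 G H Ru F qT qP qQ n (Z n))"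
  unfolding clauses_time_def row_time_def rules_time_def cell_time_def
  by (intro poly_bounded_intros poly_bounded_emit_time assms poly_bounded_horner_time)

text \<open>The lists enumerate finite clause sets that depend on the machine only, so they can be
  part of the program text. \<open>Z\<close> is large enough for all cell numbers used in
  templates.\<close>

locale reduction = tableau M x T P Q C e for M x T P Q C e +
  fixes S0 S1 S2 G H Ru :: "ref_clause list" and qT qP qQ :: "nat poly" and Z :: nat
  assumes sets: "set S0 = symbol_clauses 0" "set S1 = symbol_clauses 1" "set S2 = symbol_clauses 2"
      "set G = guess_clauses" "set H = head_clauses" "set Ru = rule_clauses"
    and polys: "qT = steps_poly qP qQ" "P = poly qP (length x)" "Q = poly qQ (length x)"
    and Z: "width * (T + 1) \<le> Z"
begin

abbreviation F :: "ref_clause list" where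
  "F \<equiv> [final_clause]"

lemma T_poly: "poly qT (length x) = T"
  using T_eq polys by (simp add: steps_poly_def)

lemma width_poly: "width = poly (width_poly qT) (length x)"
  by (simp add: width_def width_poly_def T_poly)

lemma row_0_offsets:
  "cl \<in> symbol_clauses s \<union> guess_clauses \<union> head_clauses \<union> {final_clause} \<Longrightarrow> row_offsets cl = {0}"
  by (auto simp: symbol_clauses_def guess_clauses_def head_clauses_def final_clause_def base_facts_def
      unit_clause_def horn_clause_def)

lemma template_at:
  assumes "\<And>dt. dt \<in> row_offsets cl \<Longrightarrow> R (r + dt) = width * (t + dt) + a"
  shows "clause_of C R (template C e r cl) = clause_at t a cl"
proof -
  have "lit_of C R (template_lit C e r l) = lit_at t a l" if "R (r + fst (snd l)) = width * (t + fst (snd l)) + a" for l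
  proof -
    obtain s dt di \<kappa> where "l = (s, dt, di, \<kappa>)" by (metis surj_pair)
    then show ?thesis using that by (simp add: var_def algebra_simps)
  qed
  then show ?thesis using assms by (cases cl rule: row_offsets.cases) simp
qed

lemma emits_at:
  assumes "clean R" "7 < r"
    and "\<And>cl dt. cl \<in> set L \<Longrightarrow> dt \<in> row_offsets cl \<Longrightarrow> R (r + dt) = width * (t + dt) + a \<and> width * (t + dt) + a \<le> Z"
  shows "emits x Z (emit_at C e r L) h R (emit_time C e r L Z) h R (map (clause_at t a) L)"
proof -
  have eq: "map (clause_of C R) (map (template C e r) L) = map (clause_at t a) L"
    using assms(3) template_at[of _ R r t a] by simp
  have "emits x Z (emit_template C (map (template C e r) L)) h R (template_time C (map (template C e r) L) Z) h R
      (map (clause_of C R) (map (template C e r) L))"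
    using assms by (intro emits_template) (auto simp: template_regs_template)
  then show ?thesis unfolding emit_at_def emit_time_def eq .
qed

lemma row_le_Z: "a \<le> 2 * T + 2 \<Longrightarrow> t \<le> T \<Longrightarrow> width * t + a \<le> Z"
proof -
  assume a: "a \<le> 2 * T + 2" "t \<le> T"
  have "width * t + a \<le> width * t + width" using a(1) by (simp add: width_def)
  also have "\<dots> = width * (t + 1)" by simp
  also have "\<dots> \<le> width * (T + 1)" using a(2) by (intro mult_le_mono) auto
  finally show ?thesis using Z by simp
qed

definition cell_list :: "nat \<Rightarrow> ref_clause list" where
  "cell_list a = (if a < T then S0
     else if a < T + 2 * length x then (if x ! ((a - T) div 2) then S2 else S1)
     else if a = T + 2 * length x then S1
     else if a = T + 2 * length x + 1 then S2
     else if a < T + 2 * length x + 2 + P then G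
     else S0)"

lemma set_cell_list: "set (cell_list a) = cell_clauses a"
  by (simp add: cell_list_def cell_clauses_def sets)

definition cell_output :: "nat \<Rightarrow> clause3 list" where
  "cell_output a = map (clause_at 0 a) (cell_list a)"

abbreviation ct :: nat where
  "ct \<equiv> cell_time C e S0 S1 S2 G Z"

lemma emits_cell:
  assumes "clean R" "R 8 = a" "a \<le> 2 * T" "cell_list a = L" "R' = R(8 := Suc a)"
  shows "emits x Z (emit_cell C e L) h R ct h R' (cell_output a)"
proof -
  have "row_offsets cl = {0}" if "cl \<in> set L" for cl
    using that set_cell_list[of a] assms(4) row_0_offsets[of cl] unfolding cell_clauses_def by (auto split: if_splits)
  then have at: "emits x Z (emit_at C e 8 L) h R (emit_time C e 8 L Z) h R (cell_output a)"
    unfolding cell_output_def assms(4) using row_le_Z[of a 0] assms(1-3) by (intro emits_at) auto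
  have "emits x Z (emit_cell C e L) h R (emit_time C e 8 L Z + 1) h (R(8 := Suc (R 8))) (cell_output a @ [])"
    unfolding emit_cell_def by (rule emits_Seq[OF at emits_Inc]) simp
  then have "emits x Z (emit_cell C e L) h R (emit_time C e 8 L Z + 1) h R' (cell_output a)"
    using assms(2,5) by simp
  moreover have "L \<in> {S0, S1, S2, G}" using assms(4) by (auto simp: cell_list_def split: if_splits)
  then have "emit_time C e 8 L Z + 1 \<le> ct" by (auto simp: cell_time_def)
  ultimately show ?thesis by (rule emits_mono)
qed

definition row_regs :: "nat \<Rightarrow> nat \<Rightarrow> nat" where
  "row_regs a = (\<lambda>_. 0)(0 := length x, 8 := a)"

lemma clean_row_regs: "clean (row_regs a)" "clean ((row_regs a)(12 := v))"
  by (simp_all add: clean_def row_regs_def)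

lemma emits_row_segment:
  assumes "\<And>a. a0 \<le> a \<Longrightarrow> a < a1 \<Longrightarrow> cell_list a = L" "a0 \<le> a1" "a1 \<le> 2 * T + 1" "a1 - a0 = poly q (length x)"
  shows "emits x Z (loop 12 q (emit_cell C e L)) h (row_regs a0)
    (horner_time (coeffs q) (length x) + (poly q (length x) * (ct + 2) + 1)) h (row_regs a1)
    (concat (map cell_output [a0..<a1]))"
proof -
  let ?n = "a1 - a0"
  have n: "row_regs a0 0 = length x" by (simp add: row_regs_def)
  have A: "emits x Z (loop 12 q (emit_cell C e L)) h (row_regs (a0 + 0)) (horner_time (coeffs q) (row_regs (a0 + 0) 0) + (?n * (ct + 2) + 1))
      h (row_regs (a0 + ?n)) (concat (map (\<lambda>i. cell_output (a0 + i)) [0..<?n]))"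
  proof (rule emits_loop)
    fix i assume i: "i < ?n"
    show "emits x Z (emit_cell C e L) h ((row_regs (a0 + i))(12 := ?n - Suc i)) ct h ((row_regs (a0 + Suc i))(12 := ?n - Suc i))
        (cell_output (a0 + i))"
      using i assms by (intro emits_cell) (auto simp: clean_def row_regs_def fun_eq_iff)
  qed (use assms(4) in \<open>simp_all add: row_regs_def clean_def\<close>)
  have eq: "concat (map (\<lambda>i. cell_output (a0 + i)) [0..<?n]) = concat (map cell_output [a0..<a1])"
  proof -
    have "map (\<lambda>i. cell_output (a0 + i)) [0..<?n] = map cell_output [a0..<a1]"
      by (rule nth_equalityI) simp_all
    then show ?thesis by (rule arg_cong)
  qed
  have a1: "a0 + ?n = a1" using assms(2) by simp
  show ?thesis using A[unfolded add_0_right n a1 eq] unfolding assms(4) .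
qed

lemma concat_pairs_upt: "concat (map (\<lambda>i. f (a + 2 * i) @ f (Suc (a + 2 * i))) [0..<n]) = concat (map f [a..<a + 2 * n])"
  by (induction n) simp_all

lemma emits_input_cells:
  "emits x Z (InLoop (Seq (emit_cell C e S1) (emit_cell C e S1)) (Seq (emit_cell C e S2) (emit_cell C e S2)))
     0 (row_regs T) (length x * ((ct + ct) + 2) + 1) (length x) (row_regs (T + 2 * length x))
     (concat (map cell_output [T..<T + 2 * length x]))"
proof -
  have "emits x Z (InLoop (Seq (emit_cell C e S1) (emit_cell C e S1)) (Seq (emit_cell C e S2) (emit_cell C e S2)))
     0 (row_regs (T + 2 * 0)) (length x * ((ct + ct) + 2) + 1) (length x) (row_regs (T + 2 * length x))
     (concat (map (\<lambda>i. cell_output (T + 2 * i) @ cell_output (Suc (T + 2 * i))) [0..<length x]))"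
  proof (rule emits_InLoop)
    fix i assume i: "i < length x"
    have S: "cell_list (T + 2 * i) = (if x ! i then S2 else S1)" "cell_list (Suc (T + 2 * i)) = (if x ! i then S2 else S1)"
      using i by (auto simp: cell_list_def)
    have T: "Suc (T + 2 * i) \<le> 2 * T" using i T_eq by simp
    have "emits x Z (Seq (emit_cell C e L) (emit_cell C e L)) i (row_regs (T + 2 * i)) (ct + ct) i (row_regs (T + 2 * Suc i))
      (cell_output (T + 2 * i) @ cell_output (Suc (T + 2 * i)))" if "L = (if x ! i then S2 else S1)" for L
      by (rule emits_Seq[where R' = "row_regs (Suc (T + 2 * i))"]; rule emits_cell)
        (use S T that in \<open>auto simp: clean_def row_regs_def fun_eq_iff\<close>)
    from this[OF refl] show "emits x Z (if x ! i then Seq (emit_cell C e S2) (emit_cell C e S2) else Seq (emit_cell C e S1) (emit_cell C e S1))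
      i (row_regs (T + 2 * i)) (ct + ct) i (row_regs (T + 2 * Suc i)) (cell_output (T + 2 * i) @ cell_output (Suc (T + 2 * i)))"
      by (cases "x ! i") simp_all
  qed
  then show ?thesis unfolding concat_pairs_upt by simp
qed

definition row_output :: "clause3 list" where
  "row_output = concat (map cell_output [0..<T]) @ map (clause_at 0 T) H @
     concat (map cell_output [T..<T + 2 * length x]) @ cell_output (T + 2 * length x) @ cell_output (T + 2 * length x + 1) @
     concat (map cell_output [T + 2 * length x + 2..<T + 2 * length x + 2 + P]) @
     concat (map cell_output [T + 2 * length x + 2 + P..<2 * T + 1])"

lemma emits_row:
  "emits x Z (row_com C e S0 S1 S2 G H qT qP qQ) 0 (row_regs 0)
     (row_time ct (emit_time C e 8 H Z) qT qP qQ (length x)) (length x) (row_regs (2 * T + 1)) row_output"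
proof -
  let ?b = "T + 2 * length x"
  have T: "?b + 1 \<le> 2 * T" "?b + 2 + P \<le> 2 * T + 1" "2 * T + 1 - (?b + 2 + P) = Q" using T_eq by simp_all
  have 1: "emits x Z (loop 12 qT (emit_cell C e S0)) 0 (row_regs 0)
     (horner_time (coeffs qT) (length x) + (poly qT (length x) * (ct + 2) + 1)) 0 (row_regs T) (concat (map cell_output [0..<T]))"
    by (intro emits_row_segment) (auto simp: cell_list_def T_poly)
  have 2: "emits x Z (emit_at C e 8 H) 0 (row_regs T) (emit_time C e 8 H Z) 0 (row_regs T) (map (clause_at 0 T) H)"
    using row_0_offsets sets(5) row_le_Z[of T 0] by (intro emits_at clean_row_regs) (auto simp: row_regs_def)
  have 3: "emits x Z (emit_cell C e S1) (length x) (row_regs ?b) ct (length x) (row_regs (?b + 1)) (cell_output ?b)"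
    using T(1) by (intro emits_cell clean_row_regs) (auto simp: cell_list_def row_regs_def)
  have 4: "emits x Z (emit_cell C e S2) (length x) (row_regs (?b + 1)) ct (length x) (row_regs (?b + 2)) (cell_output (?b + 1))"
    using T(1) by (intro emits_cell clean_row_regs) (auto simp: cell_list_def row_regs_def)
  have 5: "emits x Z (loop 12 qP (emit_cell C e G)) (length x) (row_regs (?b + 2))
     (horner_time (coeffs qP) (length x) + (poly qP (length x) * (ct + 2) + 1)) (length x) (row_regs (?b + 2 + P))
     (concat (map cell_output [?b + 2..<?b + 2 + P]))"
    using T(2) by (intro emits_row_segment) (auto simp: cell_list_def polys(2)[symmetric])
  have 6: "emits x Z (loop 12 qQ (emit_cell C e S0)) (length x) (row_regs (?b + 2 + P))
     (horner_time (coeffs qQ) (length x) + (poly qQ (length x) * (ct + 2) + 1)) (length x) (row_regs (2 * T + 1))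
     (concat (map cell_output [?b + 2 + P..<2 * T + 1]))"
    using T(2,3) by (intro emits_row_segment) (auto simp: cell_list_def polys(3)[symmetric])
  show ?thesis
    unfolding row_com_def row_time_def row_output_def
    by (intro emits_Seq[OF 1] emits_Seq[OF 2] emits_Seq[OF emits_input_cells] emits_Seq[OF 3] emits_Seq[OF 4] emits_Seq[OF 5] 6)
qed

lemma set_row_output: "set row_output = (\<Union>a<2 * T + 1. clause_at 0 a ` cell_clauses a) \<union> clause_at 0 T ` head_clauses"
proof -
  let ?b = "T + 2 * length x"
  have T: "2 * T + 1 = ?b + 2 + P + Q" using T_eq by simp
  have split: "{..<2 * T + 1} = {0..<T} \<union> {T..<?b} \<union> {?b} \<union> {?b + 1} \<union> {?b + 2..<?b + 2 + P} \<union> {?b + 2 + P..<2 * T + 1}"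
    unfolding T by auto
  have out: "set (cell_output a) = clause_at 0 a ` cell_clauses a" for a
    by (simp add: cell_output_def set_cell_list)
  show ?thesis
    unfolding split UN_Un row_output_def set_append set_concat set_map set_upt image_image out sets(5) by auto
qed

definition rule_regs :: "nat \<Rightarrow> nat \<Rightarrow> nat \<Rightarrow> nat" where
  "rule_regs t a = (row_regs (2 * T + 1))(9 := width * t + a, 10 := width * (t + 1) + a)"

lemma rule_regs_simps:
  "rule_regs t a 0 = length x" "rule_regs t a 9 = width * t + a" "rule_regs t a 10 = width * (t + 1) + a"
  "10 < r \<Longrightarrow> rule_regs t a r = 0" "clean (rule_regs t a)"
  by (auto simp: rule_regs_def row_regs_def clean_def)

lemma emits_next_cell:
  "emits x Z (Seq (Inc 9) (Inc 10)) h ((rule_regs t a)(12 := v, 13 := v')) (1 + 1) h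
     ((rule_regs t (Suc a))(12 := v, 13 := v')) []"
proof -
  let ?R = "(rule_regs t a)(12 := v, 13 := v')"
  have "emits x Z (Seq (Inc 9) (Inc 10)) h ?R (1 + 1) h (?R(9 := Suc (?R 9), 10 := Suc ((?R(9 := Suc (?R 9))) 10))) ([] @ [])"
    by (rule emits_Seq[OF emits_Inc emits_Inc]) simp_all
  moreover have "?R(9 := Suc (?R 9), 10 := Suc ((?R(9 := Suc (?R 9))) 10)) = (rule_regs t (Suc a))(12 := v, 13 := v')"
    by (auto simp: rule_regs_def fun_eq_iff)
  ultimately show ?thesis by simp
qed

lemma emits_rule_row:
  assumes t: "t < T"
  shows "emits x Z (loop 13 (columns_poly qT) (Seq (emit_at C e 9 Ru) (Seq (Inc 9) (Inc 10)))) h ((rule_regs t 0)(12 := v))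
    (horner_time (coeffs (columns_poly qT)) (length x) +
      (poly (columns_poly qT) (length x) * ((emit_time C e 9 Ru Z + (1 + 1)) + 2) + 1))
    h ((rule_regs t (2 * T + 1))(12 := v)) (concat (map (\<lambda>a. map (clause_at t a) Ru) [0..<2 * T + 1]))"
proof -
  have n: "2 * T + 1 = poly (columns_poly qT) (length x)" by (simp add: columns_poly_def T_poly)
  have "emits x Z (loop 13 (columns_poly qT) (Seq (emit_at C e 9 Ru) (Seq (Inc 9) (Inc 10)))) h ((rule_regs t 0)(12 := v))
    (horner_time (coeffs (columns_poly qT)) (((rule_regs t 0)(12 := v)) 0) +
      ((2 * T + 1) * ((emit_time C e 9 Ru Z + (1 + 1)) + 2) + 1))
    h ((rule_regs t (2 * T + 1))(12 := v)) (concat (map (\<lambda>a. map (clause_at t a) Ru) [0..<2 * T + 1]))"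
  proof (rule emits_loop[where R = "\<lambda>a. (rule_regs t a)(12 := v)"])
    fix a assume a: "a < 2 * T + 1"
    let ?R = "(rule_regs t a)(12 := v, 13 := 2 * T + 1 - Suc a)"
    have offsets: "row_offsets cl \<subseteq> {0, 1}" if "cl \<in> set Ru" for cl
    proof -
      have "cl \<in> ref_clauses" using that sets(6) clauses_refs(4) by auto
      moreover obtain l1 l2 l3 where cl: "cl = (l1, l2, l3)" by (metis surj_pair)
      ultimately have "snd l1 \<in> refs" "snd l2 \<in> refs" "snd l3 \<in> refs"
        by (simp_all add: ref_clauses_def mem_Times_iff)
      then have "fst (snd l1) \<in> {0, 1}" "fst (snd l2) \<in> {0, 1}" "fst (snd l3) \<in> {0, 1}"
        by (simp_all only: refs_def mem_Times_iff)
      then show ?thesis unfolding cl row_offsets.simps by (simp only: insert_subset empty_subsetI simp_thms)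
    qed
    have at: "emits x Z (emit_at C e 9 Ru) h ?R (emit_time C e 9 Ru Z) h ?R (map (clause_at t a) Ru)"
    proof (rule emits_at)
      show "clean ?R" by (simp add: rule_regs_simps clean_update)
      fix cl dt assume "cl \<in> set Ru" "dt \<in> row_offsets cl"
      then have "dt = 0 \<or> dt = 1" using offsets by blast
      then show "?R (9 + dt) = width * (t + dt) + a \<and> width * (t + dt) + a \<le> Z"
        using row_le_Z[of a t] row_le_Z[of a "t + 1"] a t by (elim disjE) (simp_all add: rule_regs_simps)
    qed simp
    from emits_Seq[OF at emits_next_cell[of h t a v]]
    show "emits x Z (Seq (emit_at C e 9 Ru) (Seq (Inc 9) (Inc 10))) h ?R (emit_time C e 9 Ru Z + (1 + 1)) h
       ((rule_regs t (Suc a))(12 := v, 13 := 2 * T + 1 - Suc a)) (map (clause_at t a) Ru)" by simp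
  qed (use n in \<open>simp_all add: rule_regs_simps clean_update\<close>)
  moreover have "((rule_regs t 0)(12 := v)) 0 = length x" by (simp add: rule_regs_simps)
  ultimately show ?thesis unfolding n[symmetric] by (simp only:)
qed

definition rules_output :: "clause3 list" where
  "rules_output = concat (map (\<lambda>t. concat (map (\<lambda>a. map (clause_at t a) Ru) [0..<2 * T + 1])) [0..<T])"

text \<open>\<open>2 * T + 3\<close> is the width, so running off row \<open>t\<close> is the same
  as entering row \<open>Suc t\<close>.\<close>

lemma rule_regs_wrap: "rule_regs t (2 * T + 3) = rule_regs (Suc t) 0"
proof -
  have "width * t + (2 * T + 3) = width * Suc t + 0" "width * (t + 1) + (2 * T + 3) = width * (Suc t + 1) + 0"
    by (simp_all add: width_def)
  then show ?thesis unfolding rule_regs_def by presburger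
qed

lemma emits_rules:
  "emits x Z (rules_com C e Ru qT) h (row_regs (2 * T + 1)) (rules_time (emit_time C e 9 Ru Z) qT (length x)) h (rule_regs T 0) rules_output"
proof -
  have 1: "emits x Z (set_poly 10 (width_poly qT)) h (row_regs (2 * T + 1)) (horner_time (coeffs (width_poly qT)) (length x)) h (rule_regs 0 0) []"
  proof -
    have "emits x Z (set_poly 10 (width_poly qT)) h (row_regs (2 * T + 1))
       (horner_time (coeffs (width_poly qT)) (row_regs (2 * T + 1) 0)) h
       ((row_regs (2 * T + 1))(10 := poly (width_poly qT) (row_regs (2 * T + 1) 0))) []"
      by (intro emits_set_poly clean_row_regs) (simp_all add: row_regs_def)
    moreover have "(row_regs (2 * T + 1))(10 := poly (width_poly qT) (row_regs (2 * T + 1) 0)) = rule_regs 0 0"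
      by (auto simp: rule_regs_def row_regs_def width_poly fun_eq_iff)
    ultimately show ?thesis by (simp add: row_regs_def)
  qed
  let ?time = "(horner_time (coeffs (columns_poly qT)) (length x) +
     (poly (columns_poly qT) (length x) * ((emit_time C e 9 Ru Z + (1 + 1)) + 2) + 1)) + ((1 + 1) + (1 + 1))"
  have 2: "emits x Z (loop 12 qT (Seq (loop 13 (columns_poly qT) (Seq (emit_at C e 9 Ru) (Seq (Inc 9) (Inc 10))))
            (Seq (Seq (Inc 9) (Inc 10)) (Seq (Inc 9) (Inc 10))))) h (rule_regs 0 0)
     (horner_time (coeffs qT) (rule_regs 0 0 0) + (T * (?time + 2) + 1)) h (rule_regs T 0) rules_output"
    unfolding rules_output_def
  proof (rule emits_loop[where R = "\<lambda>t. rule_regs t 0"])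
    fix t assume t: "t < T"
    let ?v = "T - Suc t"
    have skip: "emits x Z (Seq (Seq (Inc 9) (Inc 10)) (Seq (Inc 9) (Inc 10))) h ((rule_regs t (2 * T + 1))(12 := ?v))
       ((1 + 1) + (1 + 1)) h ((rule_regs t (2 * T + 3))(12 := ?v)) []"
    proof -
      have 13: "R(12 := ?v, 13 := 0) = R(12 := ?v)" if "R 13 = 0" for R :: "nat \<Rightarrow> nat" using that by auto
      have "emits x Z (Seq (Inc 9) (Inc 10)) h ((rule_regs t a)(12 := ?v)) (1 + 1) h ((rule_regs t (Suc a))(12 := ?v)) []" for a
        using emits_next_cell[of h t a ?v 0] 13 by (simp add: rule_regs_simps)
      from emits_Seq[OF this[of "2 * T + 1"] this[of "Suc (2 * T + 1)"]]
      show ?thesis by (simp add: numeral_3_eq_3)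
    qed
    from emits_Seq[OF emits_rule_row[OF t] skip]
    show "emits x Z (Seq (loop 13 (columns_poly qT) (Seq (emit_at C e 9 Ru) (Seq (Inc 9) (Inc 10))))
            (Seq (Seq (Inc 9) (Inc 10)) (Seq (Inc 9) (Inc 10)))) h ((rule_regs t 0)(12 := ?v)) ?time h ((rule_regs (Suc t) 0)(12 := ?v))
        (concat (map (\<lambda>a. map (clause_at t a) Ru) [0..<2 * T + 1]))"
      unfolding rule_regs_wrap by simp
  qed (simp_all add: rule_regs_simps T_poly)
  show ?thesis
    using emits_Seq[OF 1 2] unfolding rules_com_def rules_time_def by (simp add: rule_regs_simps T_poly)
qed

lemma set_rules_output: "set rules_output = (\<Union>t<T. \<Union>a<2 * T + 1. clause_at t a ` rule_clauses)"
  by (simp only: rules_output_def set_concat set_map set_upt image_image sets(6) atLeast0LessThan)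

lemma emits_verdict:
  "emits x Z (verdict_com C e F qT) h (rule_regs T 0)
     (horner_time (coeffs (width_poly qT * qT + qT)) (length x) + emit_time C e 11 F Z) h
     ((rule_regs T 0)(11 := width * T + T)) [clause_at T T final_clause]"
proof -
  let ?q = "width_poly qT * qT + qT"
  have q: "poly ?q (length x) = width * T + T" by (simp add: width_poly T_poly)
  have 1: "emits x Z (set_poly 11 ?q) h (rule_regs T 0) (horner_time (coeffs ?q) (rule_regs T 0 0)) h
     ((rule_regs T 0)(11 := poly ?q (rule_regs T 0 0))) []"
    by (intro emits_set_poly) (simp_all add: rule_regs_simps)
  have "emits x Z (emit_at C e 11 F) h ((rule_regs T 0)(11 := width * T + T)) (emit_time C e 11 F Z) h
     ((rule_regs T 0)(11 := width * T + T)) (map (clause_at T T) F)"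
    using row_le_Z[of T T] row_0_offsets[of final_clause]
    by (intro emits_at) (auto simp: rule_regs_simps clean_update)
  then show ?thesis
    using emits_Seq[OF 1] unfolding verdict_com_def rule_regs_simps q by fastforce
qed

lemma emits_input: "emits x Z input_com 0 (\<lambda>_. 0) ((length x * (1 + 2) + 1) + (length x + 2)) 0 (row_regs 0) []"
proof -
  have "emits x Z (InLoop (Inc 0) (Inc 0)) 0 ((\<lambda>_. 0)(0 := 0)) (length x * (1 + 2) + 1) (length x) ((\<lambda>_. 0)(0 := length x))
     (concat (map (\<lambda>_. []) [0..<length x]))"
  proof (rule emits_InLoop[where R = "\<lambda>i. (\<lambda>_. 0)(0 := i)"])
    fix i
    show "emits x Z (if x ! i then Inc 0 else Inc 0) i ((\<lambda>_. 0)(0 := i)) 1 i ((\<lambda>_. 0)(0 := Suc i)) []"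
      unfolding if_cancel
    proof (rule emits_runs)
      fix n w
      show "runs x (Inc 0) (i, counted ((\<lambda>_. 0)(0 := i)) n, w) 1 (i, counted ((\<lambda>_. 0)(0 := Suc i)) n, w)"
        by (rule runs_eqI[OF runs_Inc[of x 0 i "counted ((\<lambda>_. 0)(0 := i)) n" w]]) (auto simp: counted_def fun_eq_iff)
    qed
  qed
  moreover have e: "((\<lambda>_. 0)(0 := 0)) = (\<lambda>_. 0 :: nat)" "(\<lambda>_. 0)(0 := length x) = row_regs 0"
    "concat (map (\<lambda>_. []) [0..<length x]) = ([] :: clause3 list)"
    by (auto simp: row_regs_def fun_eq_iff)
  ultimately have 1: "emits x Z (InLoop (Inc 0) (Inc 0)) 0 (\<lambda>_. 0) (length x * (1 + 2) + 1) (length x) (row_regs 0) []"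
    unfolding e by (simp only:)
  have 2: "emits x Z Rewind (length x) (row_regs 0) (length x + 2) 0 (row_regs 0) []"
    by (rule emits_runs) (rule runs_Rewind, simp)
  show ?thesis using emits_Seq[OF 1 2] by (simp add: input_com_def)
qed

definition output_clauses :: "clause3 list" where
  "output_clauses = row_output @ rules_output @ [clause_at T T final_clause]"

lemma set_output_clauses: "set output_clauses = tableau_clauses"
  unfolding output_clauses_def tableau_clauses_def by (simp add: set_row_output set_rules_output)

lemma emits_clauses:
  "emits x Z (clauses_com C e S0 S1 S2 G H Ru F qT qP qQ) 0 (\<lambda>_. 0)
     (clauses_time C e S0 S1 S2 G H Ru F qT qP qQ (length x) Z) (length x) ((rule_regs T 0)(11 := width * T + T)) output_clauses"
proof -
  have "emits x Z (clauses_com C e S0 S1 S2 G H Ru F qT qP qQ) 0 (\<lambda>_. 0)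
     (clauses_time C e S0 S1 S2 G H Ru F qT qP qQ (length x) Z) (length x) ((rule_regs T 0)(11 := width * T + T))
     ([] @ row_output @ rules_output @ [clause_at T T final_clause])"
    unfolding clauses_com_def clauses_time_def
    by (intro emits_Seq[OF emits_input] emits_Seq[OF emits_row] emits_Seq[OF emits_rules] emits_verdict)
  then show ?thesis by (simp add: output_clauses_def)
qed

lemma length_concat_le: "(\<And>y. y \<in> set ys \<Longrightarrow> length (f y) \<le> m) \<Longrightarrow> length (concat (map f ys)) \<le> length ys * m"
  by (induction ys) (auto intro!: add_mono)

text \<open>Clause indices are themselves among the numbers written, so the number of clauses has to
  be bounded in advance.\<close>

lemma length_output_clauses:
  "length output_clauses \<le> (2 * T + 1) * (length S0 + length S1 + length S2 + length G) + length H +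
     T * ((2 * T + 1) * length Ru) + 1"
proof -
  let ?b = "T + 2 * length x" and ?m = "length S0 + length S1 + length S2 + length G"
  have m: "length (cell_output a) \<le> ?m" for a
    by (auto simp: cell_output_def cell_list_def)
  have "length (concat (map cell_output [a..<b])) \<le> (b - a) * ?m" for a b
    using length_concat_le[of "[a..<b]" cell_output ?m] m by simp
  from this[of 0 T] this[of T ?b] this[of "?b + 2" "?b + 2 + P"] this[of "?b + 2 + P" "2 * T + 1"] m[of ?b] m[of "?b + 1"]
  have "length row_output \<le> T * ?m + length H + (2 * length x) * ?m + ?m + ?m + P * ?m + (2 * T + 1 - (?b + 2 + P)) * ?m"
    unfolding row_output_def by simp
  also have "\<dots> = (T + 2 * length x + 1 + 1 + P + (2 * T + 1 - (?b + 2 + P))) * ?m + length H"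
    by (simp add: add_mult_distrib)
  also have "T + 2 * length x + 1 + 1 + P + (2 * T + 1 - (?b + 2 + P)) = 2 * T + 1"
    using T_eq by simp
  finally have "length row_output \<le> (2 * T + 1) * ?m + length H" .
  moreover have "length rules_output \<le> length [0..<T] * ((2 * T + 1) * length Ru)"
    unfolding rules_output_def
  proof (rule length_concat_le)
    fix t
    show "length (concat (map (\<lambda>a. map (clause_at t a) Ru) [0..<2 * T + 1])) \<le> (2 * T + 1) * length Ru"
      using length_concat_le[of "[0..<2 * T + 1]" "\<lambda>a. map (clause_at t a) Ru" "length Ru"] by simp
  qed
  ultimately show ?thesis unfolding output_clauses_def by simp
qed

end

section \<open>NP-hardness\<close>

text \<open>A sum of three bounds: for the cell numbers, the number of variables and the number of
  clauses.\<close>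

definition register_bound where
  "register_bound C S0 S1 S2 G H Ru qT n =
     poly (width_poly qT * (qT + [:1:])) n + (poly (vars_poly C qT) n +
     ((2 * poly qT n + 1) * (length S0 + length S1 + length S2 + length G) + length H +
      poly qT n * ((2 * poly qT n + 1) * length Ru) + 1))"

lemma poly_bounded_register_bound: "poly_bounded (register_bound C S0 S1 S2 G H Ru qT)"
  unfolding register_bound_def[abs_def] by (intro poly_bounded_intros)

definition reduction_time where
  "reduction_time C e S0 S1 S2 G H Ru F qT qP qQ n =
     clauses_time C e S0 S1 S2 G H Ru F qT qP qQ n (register_bound C S0 S1 S2 G H Ru qT n) +
     tail_time (vars_poly C qT) n (register_bound C S0 S1 S2 G H Ru qT n)"

lemma poly_bounded_reduction_time: "poly_bounded (reduction_time C e S0 S1 S2 G H Ru F qT qP qQ)"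
  unfolding reduction_time_def[abs_def]
  by (intro poly_bounded_add poly_bounded_clauses_time poly_bounded_tail_time poly_bounded_register_bound)

definition reduction_com where
  "reduction_com C e S0 S1 S2 G H Ru F qT qP qQ =
     Seq (clauses_com C e S0 S1 S2 G H Ru F qT qP qQ) (tail_com (vars_poly C qT))"

context reduction
begin

definition var_bound :: nat where
  "var_bound = C * (width * (T + 1))"

lemma var_bound_poly: "poly (vars_poly C qT) (length x) = var_bound"
  by (simp add: vars_poly_def var_bound_def width_poly T_poly)

lemma var_bound_pos: "0 < var_bound"
proof -
  have "Head 0 \<in> kinds" using tapes_ge by (simp add: kinds_iff)
  then have "0 < C" using e_bounds(2) by fastforce
  then show ?thesis by (simp add: var_bound_def width_def)
qed

lemma output_well_formed: "well_formed_clauses var_bound output_clauses"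
  using tableau_clauses_vars unfolding well_formed_clauses_def set_output_clauses var_bound_def by blast

definition output_word :: "bool list" where
  "output_word = enc_input (sat_instance var_bound output_clauses) (of_nat (var_bound + 3 * length output_clauses))"

lemma output_word_correct:
  "output_word \<in> inputs_satisfying (\<lambda>G. strict_prefs G \<and> max_list_length 3 G \<and> from_master_list G)"
  "output_word \<in> MIN_COST_AUGMENTATION \<longleftrightarrow> (\<exists>u. length u \<le> P \<and> snd (snd (conf u T) ! 1) 0 \<noteq> 1)"
proof -
  show "output_word \<in> inputs_satisfying (\<lambda>G. strict_prefs G \<and> max_list_length 3 G \<and> from_master_list G)"
    unfolding output_word_def by (rule sat_instance_input[OF output_well_formed var_bound_pos])
  show "output_word \<in> MIN_COST_AUGMENTATION \<longleftrightarrow> (\<exists>u. length u \<le> P \<and> snd (snd (conf u T) ! 1) 0 \<noteq> 1)"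
    unfolding output_word_def sat_instance_reduction[OF output_well_formed var_bound_pos]
      satisfiable_def set_output_clauses by (rule tableau_satisfiable_iff)
qed

lemma exec_reduction:
  assumes "Z = register_bound C S0 S1 S2 G H Ru qT (length x)"
  shows "\<exists>t\<le>reduction_time C e S0 S1 S2 G H Ru F qT qP qQ (length x). \<exists>h R.
    exec x (reduction_com C e S0 S1 S2 G H Ru F qT qP qQ) (0, (\<lambda>_. 0), []) t (h, R, output_word)"
proof -
  let ?R = "(rule_regs T 0)(11 := width * T + T)"
  have Z_eq: "Z = width * (T + 1) + (var_bound + ((2 * T + 1) * (length S0 + length S1 + length S2 + length G) + length H +
      T * ((2 * T + 1) * length Ru) + 1))"
    unfolding assms register_bound_def var_bound_poly T_poly by (simp add: width_poly T_poly)
  then have V: "var_bound \<le> Z" and len: "length output_clauses \<le> Z"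
    using length_output_clauses by linarith+
  have "counted (\<lambda>_. 0) 0 = (\<lambda>_. 0)" "clauses_word [] = []"
    by (auto simp: counted_def clauses_word_def triples_word_def fun_eq_iff)
  then have 1: "runs x (clauses_com C e S0 S1 S2 G H Ru F qT qP qQ) (0, (\<lambda>_. 0), [])
     (clauses_time C e S0 S1 S2 G H Ru F qT qP qQ (length x) Z) (length x, counted ?R (length output_clauses), clauses_word output_clauses)"
    using emits_clauses[unfolded emits_def, rule_format, of "[]"] len by simp
  have R0: "?R 0 = length x" by (simp add: rule_regs_simps)
  obtain R' where 2: "runs x (tail_com (vars_poly C qT)) (length x, counted ?R (length output_clauses), clauses_word output_clauses)
     (tail_time (vars_poly C qT) (length x) Z) (length x, R', output_word)"
    using runs_tail[of ?R var_bound "vars_poly C qT" Z output_clauses x "length x"] V len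
    unfolding R0 var_bound_poly output_word_def by (auto simp: rule_regs_simps clean_update)
  from runs_Seq[OF 1 2] show ?thesis
    unfolding runs_def reduction_com_def reduction_time_def assms by blast
qed

end

lemma poly_nat_mono:
  fixes p :: "nat poly"
  shows "a \<le> b \<Longrightarrow> poly p a \<le> poly p b"
  by (induction p) (auto intro!: add_mono mult_le_mono)

lemma halted_config: "fst c = 1 \<Longrightarrow> (tm_step M ^^ d) c = c"
  by (induction d) (cases c; simp)+

text \<open>The program is determined by the verifier of \<open>L\<close> and its polynomial bounds;
  the input enters only through its bits and its length.\<close>

theorem NP_hard_on_master_list:
  "NP_hard_on (inputs_satisfying (\<lambda>G. strict_prefs G \<and> max_list_length 3 G \<and> from_master_list G)) MIN_COST_AUGMENTATION"
  unfolding NP_hard_on_def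
proof
  let ?C = "inputs_satisfying (\<lambda>G. strict_prefs G \<and> max_list_length 3 G \<and> from_master_list G)"
  fix L :: language assume "L \<in> class_NP"
  then obtain K p where K: "K \<in> class_P"
    and L: "\<And>x. x \<in> L \<longleftrightarrow> (\<exists>u. length u \<le> poly p (length x) \<and> pair_word x u \<in> K)"
    unfolding class_NP_def by blast
  then have "poly_time (\<lambda>y. [y \<in> K])" unfolding class_P_def by simp
  then obtain M p' where wf: "wf_tm M"
    and halts: "\<And>y. \<exists>n\<le>poly p' (length y). halts_with ((tm_step M ^^ n) (init_config M y)) [y \<in> K]"
    unfolding poly_time_def by blast
  interpret machine M by unfold_locales (rule wf)
  obtain h where h: "bij_betw h kinds {0..<card kinds}"
    using ex_bij_betw_finite_nat[OF finite_kinds] by blast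
  \<comment> \<open>Shifted by one, because variable 0 stands for the constant False.\<close>
  define e where "e \<kappa> = Suc (h \<kappa>)" for \<kappa>
  define C where "C = Suc (card kinds)"
  have e: "inj_on e kinds" "e ` kinds \<subseteq> {1..<C}"
    using h unfolding e_def C_def bij_betw_def inj_on_def by (auto simp: image_subset_iff)
  have lists: "\<exists>l. set l = A" if "A \<subseteq> ref_clauses" for A
    using finite_list[OF finite_subset[OF that finite_ref_clauses]] by blast
  obtain S0 S1 S2 G H Ru where sets: "set S0 = symbol_clauses 0" "set S1 = symbol_clauses 1" "set S2 = symbol_clauses 2"
      "set G = guess_clauses" "set H = head_clauses" "set Ru = rule_clauses"
    using lists[OF clauses_refs(1)[of 0]] lists[OF clauses_refs(1)[of 1]] lists[OF clauses_refs(1)[of 2]]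
      lists[OF clauses_refs(2)] lists[OF clauses_refs(3)] lists[OF clauses_refs(4)] symbols_ge by auto
  \<comment> \<open>The running time of the verifier on a paired word of length at most
    \<open>2 * length x + 2 + poly p (length x)\<close>.\<close>
  define qQ where "qQ = pcompose p' ([:2, 2:] + p)"
  define qT where "qT = steps_poly p qQ"
  let ?com = "reduction_com C e S0 S1 S2 G H Ru [final_clause] qT p qQ"
  obtain t where t: "\<And>n. reduction_time C e S0 S1 S2 G H Ru [final_clause] qT p qQ n \<le> poly t n"
    using poly_bounded_reduction_time unfolding poly_bounded_def by blast
  have "\<exists>y. (\<exists>n\<le>poly t (length x). \<exists>h R. exec x ?com (0, (\<lambda>_. 0), []) n (h, R, y)) \<and>
      y \<in> ?C \<and> (x \<in> L \<longleftrightarrow> y \<in> MIN_COST_AUGMENTATION)" for x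
  proof -
    define n where "n = length x"
    interpret tableau M x "poly qT n" "poly p n" "poly qQ n" C e
      by unfold_locales (use e in \<open>simp_all add: qT_def steps_poly_def n_def\<close>)
    interpret reduction M x "poly qT n" "poly p n" "poly qQ n" C e S0 S1 S2 G H Ru qT p qQ
        "register_bound C S0 S1 S2 G H Ru qT n"
    proof unfold_locales
      have "width * (poly qT n + 1) = poly (width_poly qT * (qT + [:1:])) n"
        by (simp add: width_def width_poly_def)
      then show "width * (poly qT n + 1) \<le> register_bound C S0 S1 S2 G H Ru qT n"
        unfolding register_bound_def by simp
    qed (use sets in \<open>simp_all add: qT_def n_def\<close>)
    \<comment> \<open>By the last row the verifier has halted and its configuration has been
      repeated, so cell 0 of the output tape shows its answer; symbol 1 is the negative one.\<close>
    have verdict: "snd (snd (conf u (poly qT n)) ! 1) 0 \<noteq> 1 \<longleftrightarrow> pair_word x u \<in> K" if u: "length u \<le> poly p n" for u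
    proof -
      obtain k where k: "k \<le> poly p' (length (pair_word x u))"
        "halts_with ((tm_step M ^^ k) (init_config M (pair_word x u))) [pair_word x u \<in> K]"
        using halts by blast
      have "length (pair_word x u) \<le> 2 + n * 2 + poly p n" using u by (simp add: length_pair_word n_def)
      then have "poly p' (length (pair_word x u)) \<le> poly qQ n"
        using poly_nat_mono[of _ _ p'] by (simp add: qQ_def poly_pcompose)
      also have "\<dots> \<le> poly qT n" by (simp add: qT_def steps_poly_def)
      finally obtain d where d: "poly qT n = d + k" using k(1) by (metis add.commute le_iff_add le_trans)
      have "conf u (poly qT n) = conf u k"
        using k(2) unfolding d conf_def funpow_add o_apply by (intro halted_config) (simp add: halts_with_def)
      then have "snd (snd (conf u (poly qT n)) ! 1) 0 = word_cells [pair_word x u \<in> K] 0"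
        using k(2) by (simp add: halts_with_def conf_def)
      then show ?thesis by (simp add: word_cells_def)
    qed
    have "output_word \<in> MIN_COST_AUGMENTATION \<longleftrightarrow> x \<in> L"
      unfolding output_word_correct(2) L n_def[symmetric] by (intro ex_cong1 conj_cong refl verdict)
    moreover have "\<exists>n\<le>poly t (length x). \<exists>h R. exec x ?com (0, (\<lambda>_. 0), []) n (h, R, output_word)"
    proof -
      obtain k h R where k: "k \<le> reduction_time C e S0 S1 S2 G H Ru [final_clause] qT p qQ (length x)"
        "exec x ?com (0, (\<lambda>_. 0), []) k (h, R, output_word)"
        using exec_reduction n_def by auto
      have "k \<le> poly t (length x)" using k(1) t by (rule le_trans)
      then show ?thesis using k(2) by blast
    qed
    ultimately show ?thesis using output_word_correct(1) by blast
  qed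
  then have "\<forall>x. \<exists>y. (\<exists>n\<le>poly t (length x). \<exists>h R. exec x ?com (0, (\<lambda>_. 0), []) n (h, R, y)) \<and>
      y \<in> ?C \<and> (x \<in> L \<longleftrightarrow> y \<in> MIN_COST_AUGMENTATION)" ..
  \<comment> \<open>The reduction maps each \<open>x\<close> to a word that the program writes on
    input \<open>x\<close>.\<close>
  from choice[OF this] obtain f where f: "\<forall>x. (\<exists>n\<le>poly t (length x). \<exists>h R. exec x ?com (0, (\<lambda>_. 0), []) n (h, R, f x)) \<and>
      f x \<in> ?C \<and> (x \<in> L \<longleftrightarrow> f x \<in> MIN_COST_AUGMENTATION)" ..
  have pt: "poly_time f"
    by (rule poly_time_exec) (rule f[rule_format, THEN conjunct1])
  show "\<exists>f. poly_time f \<and> (\<forall>x. f x \<in> ?C \<and> (x \<in> L \<longleftrightarrow> f x \<in> MIN_COST_AUGMENTATION))"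
    by (intro exI[of _ f] conjI allI pt f[rule_format, THEN conjunct2, THEN conjunct1] f[rule_format, THEN conjunct2, THEN conjunct2])
qed

text \<open>Reductions into the smallest class of inputs also serve for the other two
  claims.\<close>

theorem theorem4:
  "NP_hard MIN_COST_AUGMENTATION \<and>
   NP_hard_on (inputs_satisfying (\<lambda>G. strict_prefs G \<and> max_list_length 3 G))
     MIN_COST_AUGMENTATION \<and>
   NP_hard_on (inputs_satisfying (\<lambda>G. strict_prefs G \<and> max_list_length 3 G \<and> from_master_list G))
     MIN_COST_AUGMENTATION"
proof -
  have "inputs_satisfying (\<lambda>G. strict_prefs G \<and> max_list_length 3 G \<and> from_master_list G) \<subseteq>
      inputs_satisfying (\<lambda>G. strict_prefs G \<and> max_list_length 3 G)"
    unfolding inputs_satisfying_def by blast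
  then show ?thesis
    using NP_hard_on_master_list unfolding NP_hard_on_def NP_hard_def by (meson subsetD)
qed

end
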